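(* Let $\Omega\subset\mathbb{R}$ be a bounded open interval, $\alpha>0$, $g\in L^\infty(\Omega)$, and assume that the minimizer $u\in BV(\Omega)\cap L^2(\Omega)$ of $$I(u)=|Du|(\Omega)+\frac{\alpha}{2}\|g-u\|^2$$ (subject to $u=0$ on $\Gamma_D$) is a piecewise $W^{2,1}$ function. Let $\beta\ge1$. If $\mathcal{T}_h$ is graded with strength $\beta$ towards the jumps $J_u$ of $u$, then for the $P1$ finite element minimizer $u_h\in\mathcal{S}^1_D(\mathcal{T}_h)$, i.e., the minimizer of $I$ in $\mathcal{S}^1_D(\mathcal{T}_h)$, we have $$\|u-u_h\|^2\le c\,\big(h^\beta|Du|(\Omega)+\beta^2h^2\|u''\|_{L^1(\Omega\setminus J_u)}\big)\|g\|_{L^\infty(\Omega)}$$ with a constant $c>0$ that is independent of $h$.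
   Context: $\|\cdot\|$ is the norm of $L^2(\Omega)$, $|Du|(\Omega)$ is the total variation of $u$ and $J_u$ its jump set. $\Gamma_D\subset\partial\Omega$ is a (possibly empty) part of the boundary. For a triangulation $\mathcal{T}_h$ of $\Omega$ (partition into closed subintervals), $\mathcal{S}^1_D(\mathcal{T}_h)$ is the space of continuous functions on $\overline\Omega$ that are affine on every $T\in\mathcal{T}_h$ and vanish on $\Gamma_D$. That $u$ is piecewise $W^{2,1}$ means that $J_u$ is finite and $u$ is of class $W^{2,1}$ on each connected component of $\Omega\setminus J_u$. A $\beta$-graded grid of the reference element $[0,1]$ is, for $J\in\mathbb{N}$ and $\beta\ge1$, given by the points $\xi_j=(j/J)^\beta$, $j=0,\dots,J$; it has minimal mesh-size $h_{\min}=J^{-\beta}$, maximal mesh-size $h_{\max}\le\beta J^{-1}$ and average mesh-size $h=J^{-1}$. A triangulation $\mathcal{T}_h$ is graded with strength $\beta$ towards $J_u$ if it arises from a fixed (independent of $h$) finite partition of $\overline\Omega$ into macro intervals, such that every point of $J_u$ is an endpoint of macro intervals and every macro interval has at most one endpoint in $J_u$, by mapping affinely the $\beta$-graded grid of $[0,1]$ with $J=1/h$ to each macro interval, where $0$ is mapped to the endpoint belonging to $J_u$ if there is one. The constant $c$ may depend on $\alpha$ and the macro partition. *)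

theory Defs
  imports "HOL-Analysis.Analysis" "HOL-Probability.Essential_Supremum"
begin

text \<open>Elements of Lebesgue spaces are represented by functions on the real line; only their
  values almost everywhere on the set under consideration matter.\<close>

definition C1c :: "real set \<Rightarrow> (real \<Rightarrow> real) set" where
  "C1c S = {\<phi>. (\<forall>x. \<phi> differentiable (at x)) \<and> continuous_on UNIV (deriv \<phi>) \<and>
              (\<exists>K. compact K \<and> K \<subseteq> S \<and> (\<forall>x. x \<notin> K \<longrightarrow> \<phi> x = 0))}"

definition L1_norm :: "real set \<Rightarrow> (real \<Rightarrow> real) \<Rightarrow> real" where
  "L1_norm S v = (LINT x|lebesgue_on S. \<bar>v x\<bar>)"

definition L2 :: "real set \<Rightarrow> (real \<Rightarrow> real) set" where
  "L2 S = {v. v \<in> borel_measurable (lebesgue_on S) \<and> integrable (lebesgue_on S) (\<lambda>x. (v x)\<^sup>2)}"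

definition L2_norm :: "real set \<Rightarrow> (real \<Rightarrow> real) \<Rightarrow> real" where
  "L2_norm S v = sqrt (LINT x|lebesgue_on S. (v x)\<^sup>2)"

definition Linf :: "real set \<Rightarrow> (real \<Rightarrow> real) set" where
  "Linf S = {v. v \<in> borel_measurable (lebesgue_on S) \<and>
               esssup (lebesgue_on S) (\<lambda>x. ereal \<bar>v x\<bar>) < \<infinity>}"

definition Linf_norm :: "real set \<Rightarrow> (real \<Rightarrow> real) \<Rightarrow> real" where
  "Linf_norm S v = real_of_ereal (esssup (lebesgue_on S) (\<lambda>x. ereal \<bar>v x\<bar>))"

definition total_variation :: "real set \<Rightarrow> (real \<Rightarrow> real) \<Rightarrow> ereal" where
  "total_variation S v =
     (SUP \<phi> \<in> {\<phi> \<in> C1c S. \<forall>x. \<bar>\<phi> x\<bar> \<le> 1}. ereal (LINT x|lebesgue_on S. v x * deriv \<phi> x))"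

definition BV :: "real set \<Rightarrow> (real \<Rightarrow> real) set" where
  "BV S = {v. integrable (lebesgue_on S) v \<and> total_variation S v < \<infinity>}"

text \<open>\<open>l\<close> is the approximate limit at \<open>z\<close> of the restriction of \<open>v\<close> to \<open>S\<close>. It is used only for
  \<open>v\<close> integrable on \<open>S\<close> and for \<open>S\<close> an open interval having \<open>z\<close> as an endpoint. If \<open>z\<close> is a
  boundary point of \<open>S\<close> and \<open>v\<close> is of bounded variation on \<open>S\<close>, then \<open>l\<close> is the trace of \<open>v\<close>
  at \<open>z\<close>.\<close>

definition approx_limit :: "real set \<Rightarrow> (real \<Rightarrow> real) \<Rightarrow> real \<Rightarrow> real \<Rightarrow> bool" where
  "approx_limit S v z l \<longleftrightarrow>
     ((\<lambda>r. (LINT x|lebesgue_on (S \<inter> ball z r). \<bar>v x - l\<bar>) / r) \<longlongrightarrow> 0) (at_right 0)"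

definition jump_set :: "real set \<Rightarrow> (real \<Rightarrow> real) \<Rightarrow> real set" where
  "jump_set S v = {z \<in> S. \<exists>l r. l \<noteq> r \<and>
     approx_limit (S \<inter> {..<z}) v z l \<and> approx_limit (S \<inter> {z<..}) v z r}"

definition has_weak_deriv :: "real set \<Rightarrow> (real \<Rightarrow> real) \<Rightarrow> (real \<Rightarrow> real) \<Rightarrow> bool" where
  "has_weak_deriv S v w \<longleftrightarrow>
     (\<forall>K. compact K \<and> K \<subseteq> S \<longrightarrow> integrable (lebesgue_on K) v \<and> integrable (lebesgue_on K) w) \<and>
     (\<forall>\<phi>\<in>C1c S. (LINT x|lebesgue_on S. v x * deriv \<phi> x) = - (LINT x|lebesgue_on S. w x * \<phi> x))"

text \<open>An arbitrary representative of the weak derivative, which is unique almost everywhere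
  on open sets.\<close>

definition weak_deriv :: "real set \<Rightarrow> (real \<Rightarrow> real) \<Rightarrow> real \<Rightarrow> real" where
  "weak_deriv S v = (SOME w. has_weak_deriv S v w)"

definition W21 :: "real set \<Rightarrow> (real \<Rightarrow> real) set" where
  "W21 S = {v. integrable (lebesgue_on S) v \<and>
     (\<exists>v' v''. integrable (lebesgue_on S) v' \<and> has_weak_deriv S v v' \<and>
               integrable (lebesgue_on S) v'' \<and> has_weak_deriv S v' v'')}"

definition piecewise_W21 :: "real set \<Rightarrow> (real \<Rightarrow> real) set" where
  "piecewise_W21 S = {v. finite (jump_set S v) \<and> (\<forall>C \<in> components (S - jump_set S v). v \<in> W21 C)}"

definition functional :: "real set \<Rightarrow> real \<Rightarrow> (real \<Rightarrow> real) \<Rightarrow> (real \<Rightarrow> real) \<Rightarrow> ereal" where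
  "functional S \<alpha> g v = total_variation S v + ereal (\<alpha> / 2 * (L2_norm S (\<lambda>x. g x - v x))\<^sup>2)"

text \<open>The boundary condition is understood in the sense of traces.\<close>

definition BV_L2_D :: "real set \<Rightarrow> real set \<Rightarrow> (real \<Rightarrow> real) set" where
  "BV_L2_D S \<Gamma> = {v \<in> BV S \<inter> L2 S. \<forall>z\<in>\<Gamma>. approx_limit S v z 0}"

definition P1_D :: "real set \<Rightarrow> real set \<Rightarrow> real set set \<Rightarrow> (real \<Rightarrow> real) set" where
  "P1_D S \<Gamma> \<T> = {v. continuous_on (closure S) v \<and>
     (\<forall>T\<in>\<T>. \<exists>m k. \<forall>x\<in>T. v x = m * x + k) \<and> (\<forall>z\<in>\<Gamma>. v z = 0)}"

definition macro_partition :: "real set \<Rightarrow> real set set \<Rightarrow> bool" where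
  "macro_partition S \<M> \<longleftrightarrow> \<M> division_of (closure S) \<and> (\<forall>K\<in>\<M>. interior K \<noteq> {})"

definition graded_node :: "real \<Rightarrow> nat \<Rightarrow> nat \<Rightarrow> real" where
  "graded_node \<beta> J j = (real j / real J) powr \<beta>"

text \<open>The affine map from \<open>[0,1]\<close> onto the macro interval \<open>K\<close> sends \<open>0\<close> to \<open>p K\<close> and \<open>1\<close> to
  \<open>q K\<close>; its orientation is arbitrary if no endpoint of \<open>K\<close> lies in the set \<open>Z\<close>.\<close>

definition graded_triangulation ::
    "real set set \<Rightarrow> real set \<Rightarrow> real \<Rightarrow> nat \<Rightarrow> real set set \<Rightarrow> bool" where
  "graded_triangulation \<M> Z \<beta> J \<T> \<longleftrightarrow>
     (\<forall>z\<in>Z. \<exists>K\<in>\<M>. z \<in> frontier K) \<and>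
     (\<forall>K\<in>\<M>. card (frontier K \<inter> Z) \<le> 1) \<and>
     (\<exists>p q. (\<forall>K\<in>\<M>. K = closed_segment (p K) (q K) \<and> frontier K \<inter> Z \<subseteq> {p K}) \<and>
        \<T> = {closed_segment (p K + graded_node \<beta> J j * (q K - p K))
                            (p K + graded_node \<beta> J (Suc j) * (q K - p K)) | K j. K \<in> \<M> \<and> j < J})"

end

theory Submission
  imports Defs
begin

text \<open>
  The functional is the sum of a convex term and a quadratic one, so every admissible \<open>w\<close> satisfies
  \<open>\<alpha> / 4 * \<parallel>u - w\<parallel>\<^sup>2 \<le> I w - I u\<close> (lemma \<open>strong_convexity\<close>). With \<open>w = u\<^sub>h\<close> and the minimality of
  \<open>u\<^sub>h\<close>, the right-hand side is at most \<open>I v - I u\<close> for every discrete \<open>v\<close>. The proof constructs a \<open>v\<close>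
  whose total variation does not exceed that of \<open>u\<close>; what remains is the difference of the fidelity
  terms, \<open>\<alpha> / 2\<close> times the integral of \<open>(u - v) * (2 * g - u - v)\<close>. Since \<open>u\<close>, \<open>v\<close> and \<open>g\<close> are all
  bounded by \<open>G = \<parallel>g\<parallel>\<^sub>\<infinity>\<close>, this gives \<open>\<parallel>u - u\<^sub>h\<parallel>\<^sup>2 \<le> 8 * G * \<parallel>u - v\<parallel>\<^sub>1\<close> (lemma
  \<open>error_by_interpolation\<close>).

  The function \<open>v\<close> interpolates, at the nodes of the grid, the representative of \<open>u\<close> that is
  left-continuous (and right-continuous at the left end of the interval). For this representative
  the sum of the absolute increments over any division is at most the distributional total
  variation (lemma \<open>total_variation_ge_division\<close>): test functions that are sums of smoothed steps
  located just to the left of the nodes recover the increments in the limit. Conversely the total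
  variation of a continuous piecewise affine function is at most the sum of its increments (lemma
  \<open>total_variation_piecewise_affine_le\<close>). The same two inequalities give the bound \<open>\<bar>u\<bar> \<le> G\<close>: the
  interpolants of the truncation of \<open>u\<close> on finer and finer uniform grids are competitors of \<open>u\<close>, and
  they converge in the square mean to the truncation (lemmas \<open>dist2_clip_le\<close> and \<open>u_bound\<close>).

  The interpolation error is estimated cell by cell. On a cell without jump it is of second order,
  and the length of the cell is at most \<open>\<beta> * h\<close> times the length of its macro interval. If there is a
  jump at the left end of a cell, the error is at most the total variation times the length of the
  cell, which by the grading is at most \<open>h powr \<beta>\<close> times that of the macro interval; a jump at the
  right end is harmless, because the representative is left-continuous. The second-order estimate
  needs classical derivatives: a function with a weak derivative is almost everywhere a primitive of
  it (lemma \<open>weak_deriv_primitive\<close>), which is obtained by testing with smoothed indicator functions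
  of intervals between Lebesgue points.
\<close>

section \<open>Integrals over sets of reals and test functions\<close>

text \<open>The definitions of the function spaces use the Bochner integral on a restricted Lebesgue
  measure. Calculus on intervals is more convenient with absolutely gauge-integrable functions; this
  lemma and the next one translate between the two.\<close>
lemma integrable_lebesgue_on_iff:
  fixes f :: "real \<Rightarrow> real"
  assumes "S \<in> sets lebesgue"
  shows "integrable (lebesgue_on S) f \<longleftrightarrow> f absolutely_integrable_on S"
  using assms by (simp add: integrable_restrict_space set_integrable_def)

lemma LINT_lebesgue_on_eq_integral:
  fixes f :: "real \<Rightarrow> real"
  assumes "S \<in> sets lebesgue" "f absolutely_integrable_on S"
  shows "(LINT x|lebesgue_on S. f x) = integral S f"
  using assms by (simp add: lebesgue_integral_eq_integral integrable_lebesgue_on_iff)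

lemma absolutely_integrable_on_subset:
  fixes f :: "real \<Rightarrow> real"
  assumes "f absolutely_integrable_on S" "T \<in> sets lebesgue" "T \<subseteq> S"
  shows "f absolutely_integrable_on T"
  using set_integrable_subset[OF assms] .

lemma absolutely_integrable_mult_continuous:
  fixes f \<psi> :: "real \<Rightarrow> real"
  assumes "f absolutely_integrable_on K" "compact K" "continuous_on K \<psi>"
  shows "(\<lambda>x. f x * \<psi> x) absolutely_integrable_on K"
proof -
  have K: "K \<in> sets lebesgue"
    using assms(2) by (simp add: compact_imp_closed)
  have "(\<lambda>x. \<psi> x * f x) absolutely_integrable_on K"
  proof (rule absolutely_integrable_bounded_measurable_product_real[OF _ K _ assms(1)])
    show "\<psi> \<in> borel_measurable (lebesgue_on K)"
      using assms(3) K by (rule continuous_imp_measurable_on_sets_lebesgue)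
    show "bounded (\<psi> ` K)"
      using assms(2,3) by (simp add: compact_continuous_image compact_imp_bounded)
  qed
  then show ?thesis by (simp add: mult.commute)
qed

text \<open>Only local integrability is available for weakly differentiable functions; compact support of
  the other factor makes the product integrable on the whole set.\<close>
lemma integral_supported_product:
  fixes f \<psi> :: "real \<Rightarrow> real"
  assumes f: "f absolutely_integrable_on K" and K: "compact K" "K \<subseteq> S"
    and \<psi>: "continuous_on K \<psi>" "\<And>x. x \<notin> K \<Longrightarrow> \<psi> x = 0"
  shows "(\<lambda>x. f x * \<psi> x) absolutely_integrable_on S"
    and "integral S (\<lambda>x. f x * \<psi> x) = integral K (\<lambda>x. f x * \<psi> x)"
proof -
  have 0: "x \<in> S - K \<Longrightarrow> f x * \<psi> x = 0" "x \<in> K - S \<Longrightarrow> f x * \<psi> x = 0" for x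
    using K \<psi> by auto
  have e: "{x \<in> S - K. f x * \<psi> x \<noteq> 0} = {}" "{x \<in> K - S. f x * \<psi> x \<noteq> 0} = {}"
    using 0 by blast+
  show "(\<lambda>x. f x * \<psi> x) absolutely_integrable_on S"
    by (rule absolutely_integrable_spike_set[OF absolutely_integrable_mult_continuous[OF f K(1) \<psi>(1)]])
      (simp_all only: e negligible_empty)
  show "integral S (\<lambda>x. f x * \<psi> x) = integral K (\<lambda>x. f x * \<psi> x)"
    by (rule integral_spike_set) (simp_all only: e negligible_empty)
qed

lemma C1cE:
  assumes "\<phi> \<in> C1c S"
  obtains K where "compact K" "K \<subseteq> S" "\<forall>x. x \<notin> K \<longrightarrow> \<phi> x = 0 \<and> deriv \<phi> x = 0"
    "\<forall>x. (\<phi> has_real_derivative deriv \<phi> x) (at x)" "continuous_on UNIV (deriv \<phi>)" "continuous_on UNIV \<phi>"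
proof -
  obtain K where K: "compact K" "K \<subseteq> S" and 0: "\<And>x. x \<notin> K \<Longrightarrow> \<phi> x = 0"
    using assms by (auto simp: C1c_def)
  have d: "(\<phi> has_real_derivative deriv \<phi> x) (at x)" for x
    using assms by (auto simp: C1c_def DERIV_deriv_iff_real_differentiable)
  have "deriv \<phi> x = 0" if "x \<notin> K" for x
  proof -
    have "((\<lambda>_. 0) has_real_derivative deriv \<phi> x) (at x)"
      by (rule has_field_derivative_transform_within_open[OF d, of "- K"])
        (use that K 0 in \<open>auto simp: compact_imp_closed open_Compl\<close>)
    then show ?thesis
      using DERIV_const DERIV_unique by blast
  qed
  moreover have "continuous_on UNIV \<phi>"
    using d by (meson DERIV_isCont continuous_at_imp_continuous_on)
  ultimately show ?thesis
    using that[OF K] 0 d assms by (auto simp: C1c_def)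
qed

lemma C1cI:
  assumes d: "\<And>x. (\<phi> has_real_derivative \<phi>' x) (at x)" and "continuous_on UNIV \<phi>'"
    and "compact K" "K \<subseteq> S" "\<And>x. x \<notin> K \<Longrightarrow> \<phi> x = 0"
  shows "\<phi> \<in> C1c S" and "deriv \<phi> = \<phi>'"
proof -
  show e: "deriv \<phi> = \<phi>'"
    using DERIV_imp_deriv[OF d] by auto
  show "\<phi> \<in> C1c S"
    using assms unfolding C1c_def mem_Collect_eq e real_differentiable_def by blast
qed

lemma C1c_mono: "S \<subseteq> T \<Longrightarrow> C1c S \<subseteq> C1c T"
  unfolding C1c_def by blast

lemma C1c_integral_local:
  assumes "\<phi> \<in> C1c S" "\<And>K. compact K \<Longrightarrow> K \<subseteq> S \<Longrightarrow> v absolutely_integrable_on K"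
  shows "(\<lambda>x. v x * \<phi> x) absolutely_integrable_on S"
    and "(\<lambda>x. v x * deriv \<phi> x) absolutely_integrable_on S"
proof -
  from assms(1) obtain K where K: "compact K" "K \<subseteq> S"
    "\<forall>x. x \<notin> K \<longrightarrow> \<phi> x = 0 \<and> deriv \<phi> x = 0"
    "\<forall>x. (\<phi> has_real_derivative deriv \<phi> x) (at x)" "continuous_on UNIV (deriv \<phi>)" "continuous_on UNIV \<phi>"
    by (rule C1cE)
  note v = assms(2)[OF K(1,2)]
  show "(\<lambda>x. v x * \<phi> x) absolutely_integrable_on S"
    using K by (intro integral_supported_product[OF v]) (auto intro: continuous_on_subset)
  show "(\<lambda>x. v x * deriv \<phi> x) absolutely_integrable_on S"
    using K by (intro integral_supported_product[OF v]) (auto intro: continuous_on_subset)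
qed

lemma compact_imp_sets_lebesgue: "compact K \<Longrightarrow> K \<in> sets lebesgue" for K :: "real set"
  by (simp add: compact_imp_closed)

lemma C1c_integral:
  assumes "\<phi> \<in> C1c S" "v absolutely_integrable_on S"
  shows "(\<lambda>x. v x * deriv \<phi> x) absolutely_integrable_on S"
  using assms(1) absolutely_integrable_on_subset[OF assms(2) compact_imp_sets_lebesgue]
  by (intro C1c_integral_local(2)) auto

lemma total_variation_leI:
  assumes "S \<in> sets lebesgue" "v absolutely_integrable_on S"
    and "\<And>\<phi>. \<phi> \<in> C1c S \<Longrightarrow> (\<And>x. \<bar>\<phi> x\<bar> \<le> 1) \<Longrightarrow> integral S (\<lambda>x. v x * deriv \<phi> x) \<le> c"
  shows "total_variation S v \<le> ereal c"
  unfolding total_variation_def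
  by (rule SUP_least)
    (use assms C1c_integral[OF _ assms(2)] in \<open>auto simp: LINT_lebesgue_on_eq_integral\<close>)

lemma total_variation_geI:
  assumes "S \<in> sets lebesgue" "v absolutely_integrable_on S"
    and "\<phi> \<in> C1c S" "\<And>x. \<bar>\<phi> x\<bar> \<le> 1"
  shows "ereal (integral S (\<lambda>x. v x * deriv \<phi> x)) \<le> total_variation S v"
proof -
  have "integral S (\<lambda>x. v x * deriv \<phi> x) = (LINT x|lebesgue_on S. v x * deriv \<phi> x)"
    using assms C1c_integral by (auto simp: LINT_lebesgue_on_eq_integral)
  then show ?thesis
    unfolding total_variation_def using assms(3,4) by (auto intro!: SUP_upper2[of \<phi>])
qed

lemma total_variation_nonneg: "total_variation S v \<ge> 0"
proof -
  have "(\<lambda>_. 0) \<in> C1c S"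
    by (rule C1cI[where \<phi>' = "\<lambda>_. 0" and K = "{}"]) auto
  then show ?thesis
    unfolding total_variation_def by (auto intro!: SUP_upper2[of "\<lambda>_. 0"])
qed

section \<open>Smoothed step functions\<close>

text \<open>A monotone \<open>C\<^sup>1\<close> transition from 0 on \<open>t \<le> 0\<close> to 1 on \<open>t \<ge> 1\<close>. Building it from squares of
  positive parts avoids a case distinction at the knots; its derivative \<open>tent\<close> is the piecewise affine
  hat function with peak 2 at \<open>t = 1/2\<close>.\<close>
definition smooth_step :: "real \<Rightarrow> real" where
  "smooth_step t = 2 * (max 0 t)\<^sup>2 - 4 * (max 0 (t - 1/2))\<^sup>2 + 2 * (max 0 (t - 1))\<^sup>2"

definition tent :: "real \<Rightarrow> real" where
  "tent t = 4 * max 0 t - 8 * max 0 (t - 1/2) + 4 * max 0 (t - 1)"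

lemma DERIV_max0_square: "((\<lambda>t. (max 0 t)\<^sup>2) has_real_derivative 2 * max 0 t) (at (t::real))"
proof -
  consider "t < 0" | "t = 0" | "t > 0" by linarith
  then show ?thesis
  proof cases
    case 1
    have "((\<lambda>_. 0) has_real_derivative 2 * max 0 t) (at t)"
      using 1 by simp
    then show ?thesis
      by (rule has_field_derivative_transform_within_open[of _ _ _ "{..<0}"]) (use 1 in auto)
  next
    case 2
    have "\<forall>\<^sub>F y::real in at 0. norm ((max 0 y)\<^sup>2 / y) \<le> \<bar>y\<bar>"
      by (rule always_eventually) (auto simp: max_def power2_eq_square)
    moreover have "((\<lambda>y::real. \<bar>y\<bar>) \<longlongrightarrow> 0) (at 0)"
      by (rule tendsto_rabs_zero) simp
    ultimately have "((\<lambda>y::real. (max 0 y)\<^sup>2 / y) \<longlongrightarrow> 0) (at 0)"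
      by (rule Lim_null_comparison)
    then show ?thesis
      using 2 by (simp add: has_field_derivative_iff)
  next
    case 3
    have "((\<lambda>t. t\<^sup>2) has_real_derivative 2 * max 0 t) (at t)"
      using 3 by (auto intro!: derivative_eq_intros)
    then show ?thesis
      by (rule has_field_derivative_transform_within_open[of _ _ _ "{0<..}"]) (use 3 in auto)
  qed
qed

lemma smooth_step_deriv: "(smooth_step has_real_derivative tent t) (at t)"
proof -
  have "((\<lambda>t. (max 0 (t - c))\<^sup>2) has_real_derivative 2 * max 0 (t - c)) (at t)" for c :: real
  proof -
    have "((\<lambda>t. t - c) has_real_derivative 1) (at t)"
      by (auto intro!: derivative_eq_intros)
    from DERIV_chain2[OF DERIV_max0_square this] show ?thesis
      by simp
  qed
  from DERIV_add[OF DERIV_diff[OF DERIV_cmult[OF DERIV_max0_square, of 2 t] DERIV_cmult[OF this, of 4 "1/2"]]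
      DERIV_cmult[OF this, of 2 1]]
  show ?thesis
    unfolding smooth_step_def[abs_def] tent_def by (rule DERIV_cong) simp
qed

lemma smooth_step_le_0: "t \<le> 0 \<Longrightarrow> smooth_step t = 0"
  by (simp add: smooth_step_def)

lemma smooth_step_ge_1: "t \<ge> 1 \<Longrightarrow> smooth_step t = 1"
  by (simp add: smooth_step_def power2_eq_square algebra_simps)

lemma tent_nonneg: "0 \<le> tent t" and tent_le_2: "tent t \<le> 2"
  and tent_outside: "t \<notin> {0..1} \<Longrightarrow> tent t = 0"
  by (auto simp: tent_def max_def)

lemma continuous_on_tent: "continuous_on S tent"
  unfolding tent_def[abs_def] by (intro continuous_intros)

lemma smooth_step_mono: "s \<le> t \<Longrightarrow> smooth_step s \<le> smooth_step t"
  using smooth_step_deriv tent_nonneg by (metis DERIV_nonneg_imp_nondecreasing)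

lemma smooth_step_bounds: "0 \<le> smooth_step t" "smooth_step t \<le> 1"
  using smooth_step_mono[of 0 t] smooth_step_mono[of t 0] smooth_step_mono[of t 1] smooth_step_mono[of 1 t]
    smooth_step_le_0[of 0] smooth_step_ge_1[of 1] smooth_step_le_0[of t] smooth_step_ge_1[of t]
  by linarith+

definition ramp :: "real \<Rightarrow> real \<Rightarrow> real \<Rightarrow> real" where
  "ramp d c x = smooth_step ((x - c) / d)"

definition bump :: "real \<Rightarrow> real \<Rightarrow> real \<Rightarrow> real" where
  "bump d c x = tent ((x - c) / d) / d"

lemma ramp_deriv: "d > 0 \<Longrightarrow> (ramp d c has_real_derivative bump d c x) (at x)"
  unfolding ramp_def[abs_def] bump_def
  by (rule DERIV_cong[OF DERIV_chain2[OF smooth_step_deriv]])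
    (auto intro!: derivative_eq_intros simp: field_simps)

lemma ramp_left: "d > 0 \<Longrightarrow> x \<le> c \<Longrightarrow> ramp d c x = 0"
  unfolding ramp_def by (rule smooth_step_le_0) (simp add: field_simps)

lemma ramp_right: "d > 0 \<Longrightarrow> x \<ge> c + d \<Longrightarrow> ramp d c x = 1"
  unfolding ramp_def by (rule smooth_step_ge_1) (simp add: field_simps)

lemma ramp_bounds: "0 \<le> ramp d c x" "ramp d c x \<le> 1"
  unfolding ramp_def by (rule smooth_step_bounds)+

lemma ramp_antimono: "d > 0 \<Longrightarrow> c \<le> c' \<Longrightarrow> ramp d c' x \<le> ramp d c x"
  unfolding ramp_def by (rule smooth_step_mono) (simp add: divide_right_mono)

lemma bump_outside: "d > 0 \<Longrightarrow> x \<notin> {c..c + d} \<Longrightarrow> bump d c x = 0"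
  unfolding bump_def using tent_outside[of "(x - c) / d"] by (auto simp: field_simps)

lemma bump_bounds: "d > 0 \<Longrightarrow> 0 \<le> bump d c x" "d > 0 \<Longrightarrow> bump d c x \<le> 2 / d"
  unfolding bump_def using tent_nonneg tent_le_2 by (auto simp: divide_right_mono)

lemma continuous_on_bump: "continuous_on S (bump d c)"
  unfolding bump_def[abs_def] divide_inverse
  by (intro continuous_intros continuous_on_compose2[OF continuous_on_tent, where t=UNIV]) auto

lemma bump_has_integral: "d > 0 \<Longrightarrow> (bump d c has_integral 1) {c..c + d}"
  using fundamental_theorem_of_calculus[of c "c + d" "ramp d c" "bump d c"]
  by (simp add: ramp_left ramp_right has_field_derivative_at_within ramp_deriv
      flip: has_real_derivative_iff_has_vector_derivative)

lemma ramp_difference_C1c: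
  assumes "d > 0" "c \<le> c'" "{c..c' + d} \<subseteq> S"
  shows "(\<lambda>x. ramp d c x - ramp d c' x) \<in> C1c S"
    and "deriv (\<lambda>x. ramp d c x - ramp d c' x) = (\<lambda>x. bump d c x - bump d c' x)"
proof -
  have D: "((\<lambda>x. ramp d c x - ramp d c' x) has_real_derivative bump d c x - bump d c' x) (at x)" for x
    using ramp_deriv[OF assms(1)] by (auto intro!: derivative_eq_intros)
  have C: "continuous_on UNIV (\<lambda>x. bump d c x - bump d c' x)"
    by (intro continuous_intros continuous_on_bump)
  have Z: "ramp d c x - ramp d c' x = 0" if "x \<notin> {c..c' + d}" for x
    using that assms ramp_left[of d x c] ramp_left[of d x c'] ramp_right[of d c x] ramp_right[of d c' x]
    by auto
  show "(\<lambda>x. ramp d c x - ramp d c' x) \<in> C1c S"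
    "deriv (\<lambda>x. ramp d c x - ramp d c' x) = (\<lambda>x. bump d c x - bump d c' x)"
    using C1cI[OF D C compact_Icc assms(3) Z] by auto
qed

text \<open>The bump has integral 1 and height at most \<open>2 / d\<close>, so testing with it is as good as averaging
  over its support.\<close>
lemma bump_average:
  assumes v: "v absolutely_integrable_on {c..c + d}" and "d > 0"
  shows "\<bar>integral {c..c + d} (\<lambda>x. v x * bump d c x) - l\<bar>
    \<le> 2 * (integral {c..c + d} (\<lambda>x. \<bar>v x - l\<bar>) / d)"
proof -
  have cb: "continuous_on {c..c + d} (bump d c)"
    by (rule continuous_on_bump)
  have vl: "(\<lambda>x. v x - l) absolutely_integrable_on {c..c + d}"
    using v by (auto intro!: set_integral_diff absolutely_integrable_continuous_real)
  have i: "(\<lambda>x. v x * bump d c x) absolutely_integrable_on {c..c + d}"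
    "(\<lambda>x. (v x - l) * bump d c x) absolutely_integrable_on {c..c + d}"
    using v vl cb by (auto intro!: absolutely_integrable_mult_continuous)
  have "integral {c..c + d} (\<lambda>x. v x * bump d c x) - l
      = integral {c..c + d} (\<lambda>x. v x * bump d c x) - integral {c..c + d} (\<lambda>x. l * bump d c x)"
    using bump_has_integral[OF assms(2), of c] by (simp add: integral_unique)
  also have "\<dots> = integral {c..c + d} (\<lambda>x. (v x - l) * bump d c x)"
    using i bump_has_integral[OF assms(2), of c]
    by (subst integral_diff[symmetric])
      (auto simp: left_diff_distrib set_lebesgue_integral_eq_integral has_integral_iff
        intro!: integrable_continuous_real continuous_intros continuous_on_bump)
  finally have e: "integral {c..c + d} (\<lambda>x. v x * bump d c x) - l
      = integral {c..c + d} (\<lambda>x. (v x - l) * bump d c x)" .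
  have "norm (integral {c..c + d} (\<lambda>x. (v x - l) * bump d c x))
      \<le> integral {c..c + d} (\<lambda>x. (2 / d) * \<bar>v x - l\<bar>)"
  proof (rule integral_norm_bound_integral)
    show "(\<lambda>x. (v x - l) * bump d c x) integrable_on {c..c + d}"
      using i by (simp add: set_lebesgue_integral_eq_integral)
    show "(\<lambda>x. (2 / d) * \<bar>v x - l\<bar>) integrable_on {c..c + d}"
      using vl integrable_on_cmult_left[of "\<lambda>x. \<bar>v x - l\<bar>" "{c..c + d}" "2 / d"]
      by (auto simp: absolutely_integrable_on_def)
    show "norm ((v x - l) * bump d c x) \<le> 2 / d * \<bar>v x - l\<bar>" for x
      using mult_right_mono[of "bump d c x" "2 / d" "\<bar>v x - l\<bar>"] bump_bounds[OF assms(2), of c x]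
      by (simp add: abs_mult mult.commute)
  qed
  then show ?thesis unfolding e by simp
qed

section \<open>Lebesgue points and weak derivatives on the line\<close>

text \<open>A one-sided approximate limit, written with an interval instead of the intersection of a set
  with a ball. A point is a right Lebesgue point if the value there is this limit.\<close>
definition approx_right :: "(real \<Rightarrow> real) \<Rightarrow> real \<Rightarrow> real \<Rightarrow> bool" where
  "approx_right v z l \<longleftrightarrow> ((\<lambda>r. integral {z..z + r} (\<lambda>x. \<bar>v x - l\<bar>) / r) \<longlongrightarrow> 0) (at_right 0)"

abbreviation right_lebesgue_point :: "(real \<Rightarrow> real) \<Rightarrow> real \<Rightarrow> bool" where
  "right_lebesgue_point v x \<equiv> approx_right v x (v x)"

lemma absolutely_integrable_abs_diff_const:
  fixes v :: "real \<Rightarrow> real"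
  assumes "v absolutely_integrable_on {s..t}"
  shows "(\<lambda>y. \<bar>v y - q\<bar>) absolutely_integrable_on {s..t}" "(\<lambda>y. \<bar>v y - q\<bar>) integrable_on {s..t}"
proof -
  have "(\<lambda>y. v y - q) absolutely_integrable_on {s..t}"
    using assms by (auto intro!: set_integral_diff absolutely_integrable_continuous_real)
  then show "(\<lambda>y. \<bar>v y - q\<bar>) absolutely_integrable_on {s..t}"
    using set_integrable_abs[of lebesgue "{s..t}" "\<lambda>y. v y - q"] by simp
  then show "(\<lambda>y. \<bar>v y - q\<bar>) integrable_on {s..t}"
    by (simp add: set_lebesgue_integral_eq_integral)
qed

text \<open>The indefinite integral of an integrable function has that function as its derivative almost
  everywhere. This is applied to the functions
  \<open>y \<mapsto> \<bar>v y - q\<bar>\<close> for all rational \<open>q\<close>; outside the countable union of the exceptional sets the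
  upper limit of the averages of \<open>\<bar>v y - v x\<bar>\<close> is at most \<open>2 * \<bar>v x - q\<bar>\<close>, for every \<open>q\<close>.\<close>
lemma right_lebesgue_points_interval:
  assumes v: "v absolutely_integrable_on {s..t}"
  shows "negligible {x \<in> {s<..<t}. \<not> right_lebesgue_point v x}"
proof -
  define V where "V q y = (if y \<in> {s..t} then \<bar>v y - q\<bar> else 0)" for q y
  have Vint: "V q integrable_on cbox c d" for q c d
  proof -
    have "V q absolutely_integrable_on UNIV"
      using absolutely_integrable_abs_diff_const(1)[OF v, of q]
      unfolding V_def[abs_def] by (simp only: absolutely_integrable_restrict_UNIV)
    then show ?thesis
      by (meson absolutely_integrable_on_def integrable_on_subcbox subset_UNIV)
  qed
  have "\<exists>N. negligible N \<and> (\<forall>x e. x \<notin> N \<longrightarrow> 0 < e \<longrightarrow> (\<exists>d>0. \<forall>h. 0 < h \<and> h < d \<longrightarrow>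
      \<bar>integral {x..x + h} (V q) / h - V q x\<bar> < e))" for q
    using integrable_ccontinuous_explicit[OF Vint[of q]]
    by (simp add: divide_inverse mult.commute) metis
  then obtain N where N: "\<And>q. negligible (N q)"
    and Nlim: "\<And>q x e. x \<notin> N q \<Longrightarrow> 0 < e \<Longrightarrow>
      \<exists>d>0. \<forall>h. 0 < h \<and> h < d \<longrightarrow> \<bar>integral {x..x + h} (V q) / h - V q x\<bar> < e"
    by metis
  have "negligible (\<Union>q\<in>\<rat>. N q)"
    using N by (intro negligible_countable_Union) (auto simp: countable_rat)
  moreover have "right_lebesgue_point v x" if x: "x \<in> {s<..<t}" and "x \<notin> (\<Union>q\<in>\<rat>. N q)" for x
    unfolding approx_right_def
  proof (rule tendstoI)
    fix e :: real assume e: "e > 0"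
    obtain q where q: "q \<in> \<rat>" "v x < q" "q < v x + e / 3"
      using Rats_dense_in_real[of "v x" "v x + e / 3"] e by auto
    from that(2) q(1) have "x \<notin> N q" by auto
    with e obtain d where d: "d > 0"
      "\<And>h. 0 < h \<Longrightarrow> h < d \<Longrightarrow> \<bar>integral {x..x + h} (V q) / h - V q x\<bar> < e / 3"
      using Nlim[of x q "e / 3"] by auto
    have "dist (integral {x..x + h} (\<lambda>y. \<bar>v y - v x\<bar>) / h) 0 < e" if h: "0 < h" "h < min d (t - x)" for h
    proof -
      have sub: "{x..x + h} \<subseteq> {s..t}" using x h by auto
      have v': "v absolutely_integrable_on {x..x + h}"
        using v sub by (rule absolutely_integrable_on_subinterval)
      note I = absolutely_integrable_abs_diff_const(2)[OF v']
      have "integral {x..x + h} (\<lambda>y. \<bar>v y - v x\<bar>) \<le> integral {x..x + h} (\<lambda>y. \<bar>v y - q\<bar> + \<bar>v x - q\<bar>)"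
        by (rule integral_le) (auto intro!: I integrable_add)
      also have "\<dots> = integral {x..x + h} (\<lambda>y. \<bar>v y - q\<bar>) + \<bar>v x - q\<bar> * h"
        using h I by (subst integral_add) auto
      also have "integral {x..x + h} (\<lambda>y. \<bar>v y - q\<bar>) = integral {x..x + h} (V q)"
        using sub by (intro integral_cong) (auto simp: V_def)
      finally have "integral {x..x + h} (\<lambda>y. \<bar>v y - v x\<bar>) / h \<le> integral {x..x + h} (V q) / h + \<bar>v x - q\<bar>"
        using h by (simp add: field_simps)
      moreover have "V q x = \<bar>v x - q\<bar>" using x by (simp add: V_def)
      moreover have "\<bar>v x - q\<bar> < e / 3" using q by auto
      moreover have "integral {x..x + h} (\<lambda>y. \<bar>v y - v x\<bar>) / h \<ge> 0"
        using h I by (intro divide_nonneg_pos integral_nonneg) auto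
      moreover have "\<bar>integral {x..x + h} (V q) / h - V q x\<bar> < e / 3"
        using d(2) h by simp
      ultimately show ?thesis unfolding dist_real_def by linarith
    qed
    moreover have "min d (t - x) > 0" using d x by simp
    ultimately show "\<forall>\<^sub>F h in at_right 0. dist (integral {x..x + h} (\<lambda>y. \<bar>v y - v x\<bar>) / h) 0 < e"
      unfolding eventually_at_right_field by blast
  qed
  then have "{x \<in> {s<..<t}. \<not> right_lebesgue_point v x} \<subseteq> (\<Union>q\<in>\<rat>. N q)"
    by blast
  ultimately show ?thesis
    using negligible_subset by blast
qed

lemma right_lebesgue_points:
  assumes S: "open S" and v: "\<And>K. compact K \<Longrightarrow> K \<subseteq> S \<Longrightarrow> v absolutely_integrable_on K"
  shows "negligible {x \<in> S. \<not> right_lebesgue_point v x}"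
proof -
  obtain \<D> where D: "countable \<D>" "\<D> \<subseteq> Pow S" "\<And>X. X \<in> \<D> \<Longrightarrow> \<exists>a b. X = cbox a b" "\<Union>\<D> = S"
    using open_countable_Union_open_cbox[OF S] by metis
  have "negligible {x \<in> X. \<not> right_lebesgue_point v x}" if XD: "X \<in> \<D>" for X
  proof -
    obtain c d where X: "X = {c..d}" using D(3)[OF XD] by auto
    have "v absolutely_integrable_on {c..d}"
      using v[of X] X D(2) XD by auto
    from right_lebesgue_points_interval[OF this]
    have "negligible ({x \<in> {c<..<d}. \<not> right_lebesgue_point v x} \<union> {c, d})" by simp
    then show ?thesis
      by (rule negligible_subset) (auto simp: X)
  qed
  then have "negligible (\<Union>X\<in>\<D>. {x \<in> X. \<not> right_lebesgue_point v x})"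
    using D(1) by (intro negligible_countable_Union) auto
  then show ?thesis
    by (rule negligible_subset) (use D(4) in auto)
qed

lemma filterlim_shrinking_at_right:
  assumes "r > 0"
  shows "filterlim (\<lambda>n. r / real (Suc n)) (at_right 0) sequentially"
proof -
  have "(\<lambda>n. r / real (Suc n)) \<longlonglongrightarrow> 0"
    using LIMSEQ_Suc[OF lim_const_over_n[of r]] by simp
  then show ?thesis
    using assms by (auto simp: filterlim_at)
qed

lemma bump_tendsto:
  assumes "right_lebesgue_point v x" "v absolutely_integrable_on {x..x + r}" "r > 0"
  shows "(\<lambda>n. integral {x..x + r / real (Suc n)} (\<lambda>y. v y * bump (r / real (Suc n)) x y)) \<longlonglongrightarrow> v x"
proof -
  let ?d = "\<lambda>n. r / real (Suc n)"
  have "(\<lambda>n. 2 * (integral {x..x + ?d n} (\<lambda>y. \<bar>v y - v x\<bar>) / ?d n)) \<longlonglongrightarrow> 2 * 0"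
    using assms(1) filterlim_shrinking_at_right[OF assms(3)] unfolding approx_right_def
    by (intro tendsto_mult tendsto_const) (rule filterlim_compose)
  then have "(\<lambda>n. integral {x..x + ?d n} (\<lambda>y. v y * bump (?d n) x y) - v x) \<longlonglongrightarrow> 0"
    unfolding mult_zero_right
  proof (rule Lim_null_comparison[rotated])
    have "?d n \<le> r" for n
      using assms(3) by (simp add: field_simps)
    then have "v absolutely_integrable_on {x..x + ?d n}" for n
      by (intro absolutely_integrable_on_subinterval[OF assms(2)]) auto
    then show "\<forall>\<^sub>F n in sequentially. norm (integral {x..x + ?d n} (\<lambda>y. v y * bump (?d n) x y) - v x)
        \<le> 2 * (integral {x..x + ?d n} (\<lambda>y. \<bar>v y - v x\<bar>) / ?d n)"
      unfolding real_norm_def using assms(3)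
      by (intro always_eventually allI bump_average) (auto simp del: of_nat_Suc)
  qed
  then show ?thesis
    by (simp only: LIM_zero_iff)
qed

text \<open>The differences of ramps are uniformly bounded and converge to the indicator function of the
  half-open interval from \<open>x\<close> to \<open>y\<close>.\<close>
lemma ramp_difference_tendsto:
  assumes w: "w absolutely_integrable_on {x..y + r}" and "x \<le> y" "r > 0"
  shows "(\<lambda>n. integral {x..y + r} (\<lambda>z. w z * (ramp (r / real (Suc n)) x z - ramp (r / real (Suc n)) y z)))
    \<longlonglongrightarrow> integral {x..y} w"
proof -
  let ?d = "\<lambda>n. r / real (Suc n)"
  let ?f = "\<lambda>n z. w z * (ramp (?d n) x z - ramp (?d n) y z)"
  let ?g = "\<lambda>z. if z \<in> {x<..y} then w z else 0"
  have d: "?d n > 0" for n using assms(3) by simp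
  have d0: "?d \<longlonglongrightarrow> 0"
    using LIMSEQ_Suc[OF lim_const_over_n[of r]] by simp
  have "(\<lambda>n. integral {x..y + r} (?f n)) \<longlonglongrightarrow> integral {x..y + r} ?g"
  proof (rule dominated_convergence(2)[where h = "\<lambda>z. \<bar>w z\<bar>"])
    have "continuous_on A (ramp (?d n) c)" for n c A
      by (meson DERIV_isCont continuous_at_imp_continuous_on d ramp_deriv)
    then show "?f n integrable_on {x..y + r}" for n
      by (intro set_lebesgue_integral_eq_integral absolutely_integrable_mult_continuous[OF w]
          continuous_intros compact_Icc)
    show "(\<lambda>z. \<bar>w z\<bar>) integrable_on {x..y + r}"
      using w by (simp add: absolutely_integrable_on_def)
    show "norm (?f n z) \<le> \<bar>w z\<bar>" for n z
      using ramp_bounds[of "?d n" x z] ramp_bounds[of "?d n" y z]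
      by (auto simp: abs_mult intro!: mult_left_le)
    show "(\<lambda>n. ?f n z) \<longlonglongrightarrow> ?g z" if "z \<in> {x..y + r}" for z
    proof -
      have ev: "\<forall>\<^sub>F n in sequentially. ramp (?d n) c z = 1" if "c < z" for c
      proof -
        from order_tendstoD(2)[OF d0, of "z - c"] that
        have "\<forall>\<^sub>F n in sequentially. ?d n < z - c" by simp
        then show ?thesis
          by eventually_elim (use d in \<open>auto intro!: ramp_right simp del: of_nat_Suc\<close>)
      qed
      have z0: "ramp (?d n) c z = 0" if "z \<le> c" for n c
        using that d ramp_left by blast
      consider "z = x" | "x < z" "z \<le> y" | "x < z" "y < z" using \<open>z \<in> _\<close> by force
      then have "\<forall>\<^sub>F n in sequentially. ?f n z = ?g z"
      proof cases
        case 1 then show ?thesis using z0 assms(2) by simp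
      next
        case 2 then show ?thesis using ev[of x] z0[of y] by (auto elim!: eventually_mono)
      next
        case 3 
        have "\<forall>\<^sub>F n in sequentially. ramp (?d n) x z = 1 \<and> ramp (?d n) y z = 1"
          using 3 ev[of x] ev[of y] by (intro eventually_conj) auto
        then show ?thesis
          by (rule eventually_mono) (use 3 in auto)
      qed
      then show ?thesis by (rule tendsto_eventually)
    qed
  qed
  also have "integral {x..y + r} ?g = integral {x<..y} w"
    using assms(2,3) by (subst integral_restrict_Int) (auto intro!: arg_cong[where f = "\<lambda>S. integral S w"])
  also have "\<dots> = integral {x..y} w"
  proof (rule integral_spike_set)
    show "negligible {z \<in> {x<..y} - {x..y}. w z \<noteq> 0}"
      by (rule negligible_subset[of "{}"]) auto
    show "negligible {z \<in> {x..y} - {x<..y}. w z \<noteq> 0}"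
      by (rule negligible_subset[of "{x}"]) auto
  qed
  finally show ?thesis .
qed

lemma has_weak_derivD:
  assumes "has_weak_deriv S v w" and S: "S \<in> sets lebesgue"
  shows "\<And>K. compact K \<Longrightarrow> K \<subseteq> S \<Longrightarrow> v absolutely_integrable_on K"
    and "\<And>K. compact K \<Longrightarrow> K \<subseteq> S \<Longrightarrow> w absolutely_integrable_on K"
    and "\<And>\<phi>. \<phi> \<in> C1c S \<Longrightarrow> integral S (\<lambda>x. v x * deriv \<phi> x) = - integral S (\<lambda>x. w x * \<phi> x)"
proof -
  have K: "v absolutely_integrable_on K \<and> w absolutely_integrable_on K" if "compact K" "K \<subseteq> S" for K
  proof -
    have "integrable (lebesgue_on K) v \<and> integrable (lebesgue_on K) w"
      using assms(1) that unfolding has_weak_deriv_def by blast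
    then show ?thesis
      by (simp only: integrable_lebesgue_on_iff[OF compact_imp_sets_lebesgue[OF that(1)]])
  qed
  then show "\<And>K. compact K \<Longrightarrow> K \<subseteq> S \<Longrightarrow> v absolutely_integrable_on K"
    "\<And>K. compact K \<Longrightarrow> K \<subseteq> S \<Longrightarrow> w absolutely_integrable_on K" by auto
  fix \<phi> assume \<phi>: "\<phi> \<in> C1c S"
  have "(\<lambda>x. v x * deriv \<phi> x) absolutely_integrable_on S" "(\<lambda>x. w x * \<phi> x) absolutely_integrable_on S"
    using K by (auto intro!: C1c_integral_local[OF \<phi>])
  moreover have "(LINT x|lebesgue_on S. v x * deriv \<phi> x) = - (LINT x|lebesgue_on S. w x * \<phi> x)"
    using assms(1) \<phi> unfolding has_weak_deriv_def by blast
  ultimately show "integral S (\<lambda>x. v x * deriv \<phi> x) = - integral S (\<lambda>x. w x * \<phi> x)"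
    using S by (simp add: LINT_lebesgue_on_eq_integral)
qed

lemma has_weak_derivI:
  assumes S: "S \<in> sets lebesgue"
    and vK: "\<And>K. compact K \<Longrightarrow> K \<subseteq> S \<Longrightarrow> v absolutely_integrable_on K"
    and wK: "\<And>K. compact K \<Longrightarrow> K \<subseteq> S \<Longrightarrow> w absolutely_integrable_on K"
    and e: "\<And>\<phi>. \<phi> \<in> C1c S \<Longrightarrow> integral S (\<lambda>x. v x * deriv \<phi> x) = - integral S (\<lambda>x. w x * \<phi> x)"
  shows "has_weak_deriv S v w"
proof -
  have "(LINT x|lebesgue_on S. v x * deriv \<phi> x) = - (LINT x|lebesgue_on S. w x * \<phi> x)" if \<phi>: "\<phi> \<in> C1c S" for \<phi>
  proof -
    have "(\<lambda>x. v x * deriv \<phi> x) absolutely_integrable_on S" "(\<lambda>x. w x * \<phi> x) absolutely_integrable_on S"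
      using vK wK by (auto intro!: C1c_integral_local[OF \<phi>])
    with e[OF \<phi>] S show ?thesis
      by (simp add: LINT_lebesgue_on_eq_integral)
  qed
  moreover have "integrable (lebesgue_on K) v \<and> integrable (lebesgue_on K) w" if "compact K" "K \<subseteq> S" for K
    using that vK wK integrable_lebesgue_on_iff[OF compact_imp_sets_lebesgue[OF that(1)]] by simp
  ultimately show ?thesis
    unfolding has_weak_deriv_def by blast
qed

text \<open>The test functions are smoothed indicator functions of the interval from \<open>x\<close> to \<open>y\<close>. Their
  derivatives are a bump at \<open>x\<close> minus a bump at \<open>y\<close>, so one side of the defining identity tends to
  \<open>v x - v y\<close> and the other to minus the integral of \<open>w\<close>.\<close>
lemma weak_deriv_increment:
  assumes wd: "has_weak_deriv S v w" and S: "open S"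
    and xy: "x \<le> y" "r > 0" "{x..y + r} \<subseteq> S"
    and L: "right_lebesgue_point v x" "right_lebesgue_point v y"
  shows "v y - v x = integral {x..y} w"
proof -
  let ?d = "\<lambda>n. r / real (Suc n)"
  have Sm: "S \<in> sets lebesgue" using S by simp
  note wd = has_weak_derivD[OF wd Sm]
  have d: "?d n > 0" "?d n \<le> r" for n using xy(2) by (auto simp: field_simps)
  have vI: "v absolutely_integrable_on {x..y + r}" and wI: "w absolutely_integrable_on {x..y + r}"
    using wd(1,2)[OF compact_Icc xy(3)] by auto
  have sub: "{c..c + ?d n} \<subseteq> {x..y + r}" if "c \<in> {x, y}" for c n
    using that d[of n] xy(1) by (auto simp del: of_nat_Suc intro: order_trans[OF _ add_mono])
  have eq: "integral {x..x + ?d n} (\<lambda>z. v z * bump (?d n) x z) - integral {y..y + ?d n} (\<lambda>z. v z * bump (?d n) y z)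
      = - integral {x..y + r} (\<lambda>z. w z * (ramp (?d n) x z - ramp (?d n) y z))" for n
  proof -
    have s: "{x..y + ?d n} \<subseteq> {x..y + r}" using d by (simp del: of_nat_Suc)
    then have s': "{x..y + ?d n} \<subseteq> S" using xy(3) by blast
    note R = ramp_difference_C1c[OF d(1) xy(1) s']
    have i: "(\<lambda>z. v z * bump (?d n) c z) integrable_on {x..y + r}
        \<and> integral {x..y + r} (\<lambda>z. v z * bump (?d n) c z) = integral {c..c + ?d n} (\<lambda>z. v z * bump (?d n) c z)"
      if "c \<in> {x, y}" for c
    proof -
      have "v absolutely_integrable_on {c..c + ?d n}"
        using vI sub[OF that] by (rule absolutely_integrable_on_subinterval)
      from integral_supported_product[OF this compact_Icc sub[OF that] continuous_on_bump bump_outside[OF d(1)]]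
      show ?thesis by (simp add: set_lebesgue_integral_eq_integral)
    qed
    have "- integral {x..y + r} (\<lambda>z. w z * (ramp (?d n) x z - ramp (?d n) y z))
      = - integral S (\<lambda>z. w z * (ramp (?d n) x z - ramp (?d n) y z))"
    proof -
      have "continuous_on A (ramp (?d n) c)" for c A
        by (meson DERIV_isCont continuous_at_imp_continuous_on d(1) ramp_deriv)
      moreover have "ramp (?d n) x z - ramp (?d n) y z = 0" if "z \<notin> {x..y + r}" for z
        using that d[of n] xy ramp_left[OF d(1)[of n], of z x] ramp_left[OF d(1)[of n], of z y]
          ramp_right[OF d(1)[of n], of x z] ramp_right[OF d(1)[of n], of y z]
        by (auto simp del: of_nat_Suc)
      ultimately show ?thesis
        by (subst integral_supported_product(2)[OF wI compact_Icc xy(3)]) (auto intro!: continuous_intros)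
    qed
    also have "\<dots> = integral S (\<lambda>z. v z * (bump (?d n) x z - bump (?d n) y z))"
      using wd(3)[OF R(1)] unfolding R(2) by simp
    also have "\<dots> = integral {x..y + r} (\<lambda>z. v z * (bump (?d n) x z - bump (?d n) y z))"
    proof (rule integral_supported_product(2)[OF vI compact_Icc xy(3)])
      show "continuous_on {x..y + r} (\<lambda>z. bump (?d n) x z - bump (?d n) y z)"
        by (intro continuous_intros continuous_on_bump)
      show "bump (?d n) x z - bump (?d n) y z = 0" if "z \<notin> {x..y + r}" for z
      proof -
        have "z \<notin> {x..x + ?d n}" "z \<notin> {y..y + ?d n}"
          using that sub[of x n] sub[of y n] by blast+
        then show ?thesis
          using bump_outside[OF d(1)[of n]] by simp
      qed
    qed
    also have "\<dots> = integral {x..y + r} (\<lambda>z. v z * bump (?d n) x z) - integral {x..y + r} (\<lambda>z. v z * bump (?d n) y z)"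
      using i[of x] i[of y] by (simp add: right_diff_distrib integral_diff)
    finally show ?thesis using i[of x] i[of y] by simp
  qed
  have "v absolutely_integrable_on {x..x + r}" "v absolutely_integrable_on {y..y + r}"
    using xy by (auto intro: absolutely_integrable_on_subinterval[OF vI])
  then have "(\<lambda>n. integral {x..x + ?d n} (\<lambda>z. v z * bump (?d n) x z) - integral {y..y + ?d n} (\<lambda>z. v z * bump (?d n) y z))
      \<longlonglongrightarrow> v x - v y"
    using L xy(2) by (intro tendsto_diff bump_tendsto)
  moreover have "(\<lambda>n. - integral {x..y + r} (\<lambda>z. w z * (ramp (?d n) x z - ramp (?d n) y z))) \<longlonglongrightarrow> - integral {x..y} w"
    by (intro tendsto_minus ramp_difference_tendsto wI xy)
  ultimately have "v x - v y = - integral {x..y} w"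
    unfolding eq using LIMSEQ_unique by blast
  then show ?thesis by simp
qed

text \<open>The difference of two weak derivatives is a weak derivative of 0. All its integrals over small
  intervals vanish by the previous lemma, hence it vanishes at each of its Lebesgue points.\<close>
lemma weak_deriv_unique:
  assumes "has_weak_deriv S v w" "has_weak_deriv S v w'" and S: "open S"
  shows "negligible {x \<in> S. w x \<noteq> w' x}"
proof -
  have Sm: "S \<in> sets lebesgue" using S by simp
  note W = has_weak_derivD[OF assms(1) Sm] and W' = has_weak_derivD[OF assms(2) Sm]
  define f where "f x = w x - w' x" for x
  have fI: "f absolutely_integrable_on K" if "compact K" "K \<subseteq> S" for K
    unfolding f_def[abs_def] using W(2) W'(2) that by (intro set_integral_diff) auto
  have wd: "has_weak_deriv S (\<lambda>_. 0) f"
  proof (rule has_weak_derivI[OF Sm])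
    fix \<phi> assume \<phi>: "\<phi> \<in> C1c S"
    have "(\<lambda>x. w x * \<phi> x) absolutely_integrable_on S" "(\<lambda>x. w' x * \<phi> x) absolutely_integrable_on S"
      using W(2) W'(2) by (auto intro!: C1c_integral_local[OF \<phi>])
    then have "integral S (\<lambda>x. f x * \<phi> x) = integral S (\<lambda>x. w x * \<phi> x) - integral S (\<lambda>x. w' x * \<phi> x)"
      unfolding f_def left_diff_distrib
      by (intro integral_diff) (simp_all add: set_lebesgue_integral_eq_integral)
    with W(3)[OF \<phi>] W'(3)[OF \<phi>]
    show "integral S (\<lambda>x. 0 * deriv \<phi> x) = - integral S (\<lambda>x. f x * \<phi> x)" by simp
  qed (use fI in auto)
  have rl0: "right_lebesgue_point (\<lambda>_. 0) x" for x
    by (simp add: approx_right_def)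
  have "f x = 0" if x: "x \<in> S" and L: "right_lebesgue_point f x" for x
  proof -
    obtain r where r: "r > 0" "cball x r \<subseteq> S"
      using S x open_contains_cball by blast
    then have rS: "{x..x + r} \<subseteq> S" by (auto simp: cball_def dist_real_def)
    have "\<forall>\<^sub>F h in at_right 0. \<bar>f x\<bar> \<le> integral {x..x + h} (\<lambda>y. \<bar>f y - f x\<bar>) / h"
      unfolding eventually_at_right_field
    proof (intro exI[of _ r] conjI allI impI)
      fix h :: real assume h: "0 < h" "h < r"
      have fi: "f absolutely_integrable_on {x..x + h}"
        using fI[of "{x..x + h}"] rS h by force
      have "0 = integral {x..x + h} f"
        using weak_deriv_increment[OF wd S, of x "x + h" "r - h"] rl0 h rS by simp
      then have "f x * h = integral {x..x + h} (\<lambda>y. f x - f y)"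
        using h fi by (subst integral_diff) (simp_all add: set_lebesgue_integral_eq_integral)
      moreover have "norm (integral {x..x + h} (\<lambda>y. f x - f y)) \<le> integral {x..x + h} (\<lambda>y. \<bar>f y - f x\<bar>)"
        using fi absolutely_integrable_abs_diff_const(2)[OF fi]
        by (intro integral_norm_bound_integral integrable_diff) (auto simp: set_lebesgue_integral_eq_integral)
      ultimately show "\<bar>f x\<bar> \<le> integral {x..x + h} (\<lambda>y. \<bar>f y - f x\<bar>) / h"
        using h by (simp add: field_simps abs_mult)
    qed (use r in auto)
    with L have "\<bar>f x\<bar> \<le> 0"
      unfolding approx_right_def by (intro tendsto_lowerbound[where F = "at_right 0"]) auto
    then show ?thesis by simp
  qed
  then have "{x \<in> S. w x \<noteq> w' x} \<subseteq> {x \<in> S. \<not> right_lebesgue_point f x}"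
    by (auto simp: f_def)
  then show ?thesis
    using right_lebesgue_points[OF S fI] negligible_subset by blast
qed

text \<open>Almost every point is a Lebesgue point; one of them serves as base point for the increments.\<close>
lemma weak_deriv_primitive:
  assumes wd: "has_weak_deriv {s<..<t} v w" and w: "w absolutely_integrable_on {s..t}"
  shows "\<exists>k. negligible {x \<in> {s<..<t}. v x \<noteq> k + integral {s..x} w}"
proof (cases "s < t")
  case True
  let ?N = "{x \<in> {s<..<t}. \<not> right_lebesgue_point v x}"
  have neg: "negligible ?N"
    using has_weak_derivD(1)[OF wd] by (intro right_lebesgue_points) auto
  have "\<not> {s<..<t} \<subseteq> ?N"
  proof
    assume "{s<..<t} \<subseteq> ?N"
    then have "negligible (box s t)" using neg negligible_subset by (simp add: box_real)
    then show False using True negligible_interval(2)[of s t] by (simp add: box_real)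
  qed
  then obtain x0 where x0: "x0 \<in> {s<..<t}" "right_lebesgue_point v x0" by blast
  have inc: "v y - v x = integral {s..y} w - integral {s..x} w"
    if "x \<le> y" "x \<in> {s<..<t}" "y \<in> {s<..<t}" "right_lebesgue_point v x" "right_lebesgue_point v y" for x y
  proof -
    have "v y - v x = integral {x..y} w"
      using that by (intro weak_deriv_increment[OF wd, where r = "(t - y) / 2"]) (auto simp: field_simps)
    moreover have "w integrable_on {s..y}"
      using that absolutely_integrable_on_subinterval[OF w, of s y]
      by (simp add: set_lebesgue_integral_eq_integral)
    ultimately show ?thesis
      using Henstock_Kurzweil_Integration.integral_combine[where a = s and c = x and b = y and f = w] that
      by auto
  qed
  have "v x = (v x0 - integral {s..x0} w) + integral {s..x} w" if "x \<in> {s<..<t} - ?N" for x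
    using inc[of x x0] inc[of x0 x] x0 that by (cases "x \<le> x0") auto
  then have "{x \<in> {s<..<t}. v x \<noteq> (v x0 - integral {s..x0} w) + integral {s..x} w} \<subseteq> ?N"
    by blast
  then show ?thesis using neg negligible_subset by blast
qed auto

section \<open>Interpolation of functions with two integrable derivatives\<close>

text \<open>Two applications of the previous lemma: the weak derivative agrees almost everywhere with a
  continuous function \<open>W'\<close>, whose primitive \<open>W\<close> is therefore differentiable in the classical
  sense.\<close>
lemma W21_representative:
  assumes "v \<in> W21 {s<..<t}" "s < t"
  obtains v' v'' W W' where
    "has_weak_deriv {s<..<t} v v'" "has_weak_deriv {s<..<t} v' v''"
    "v absolutely_integrable_on {s..t}" "v' absolutely_integrable_on {s..t}" "v'' absolutely_integrable_on {s..t}"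
    "negligible {x \<in> {s<..<t}. v x \<noteq> W x}"
    "\<And>x. x \<in> {s..t} \<Longrightarrow> (W has_real_derivative W' x) (at x within {s..t})"
    "\<And>x. x \<in> {s..t} \<Longrightarrow> W' x = W' s + integral {s..x} v''"
proof -
  have I: "integrable (lebesgue_on {s<..<t}) f \<longleftrightarrow> f absolutely_integrable_on {s..t}" for f :: "real \<Rightarrow> real"
    by (simp add: integrable_lebesgue_on_iff absolutely_integrable_on_Icc_iff_Ioo)
  from assms(1) obtain v' v'' where v': "v' absolutely_integrable_on {s..t}" "has_weak_deriv {s<..<t} v v'"
    and v'': "v'' absolutely_integrable_on {s..t}" "has_weak_deriv {s<..<t} v' v''"
    and v: "v absolutely_integrable_on {s..t}"
    unfolding W21_def mem_Collect_eq I by blast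
  obtain k where k: "negligible {x \<in> {s<..<t}. v x \<noteq> k + integral {s..x} v'}"
    using weak_deriv_primitive[OF v'(2,1)] by blast
  obtain k' where k': "negligible {x \<in> {s<..<t}. v' x \<noteq> k' + integral {s..x} v''}"
    using weak_deriv_primitive[OF v''(2,1)] by blast
  define W' where "W' x = k' + integral {s..x} v''" for x
  define W where "W x = k + integral {s..x} W'" for x
  have "continuous_on {s..t} W'"
    unfolding W'_def using v''(1)
    by (intro continuous_intros indefinite_integral_continuous_1) (simp add: set_lebesgue_integral_eq_integral)
  then have D: "(W has_real_derivative W' x) (at x within {s..t})" if "x \<in> {s..t}" for x
    unfolding W_def has_real_derivative_iff_has_vector_derivative using that
    by (auto intro!: derivative_eq_intros integral_has_vector_derivative)
  have "integral {s..x} v' = integral {s..x} W'" if "x \<in> {s<..<t}" for x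
  proof (rule integral_spike)
    show "negligible ({x \<in> {s<..<t}. v' x \<noteq> k' + integral {s..x} v''} \<union> {s, t})"
      using k' by simp
    show "W' y = v' y" if "y \<in> {s..x} - ({x \<in> {s<..<t}. v' x \<noteq> k' + integral {s..x} v''} \<union> {s, t})" for y
      using that \<open>x \<in> _\<close> by (auto simp: W'_def)
  qed
  then have "{x \<in> {s<..<t}. v x \<noteq> W x} = {x \<in> {s<..<t}. v x \<noteq> k + integral {s..x} v'}"
    by (auto simp: W_def)
  with k have "negligible {x \<in> {s<..<t}. v x \<noteq> W x}" by simp
  moreover have "W' x = W' s + integral {s..x} v''" for x
    by (simp add: W'_def)
  ultimately show ?thesis
    using that[OF v'(2) v''(2) v v'(1) v''(1)] D by blast
qed

definition affine_through :: "(real \<Rightarrow> real) \<Rightarrow> real \<Rightarrow> real \<Rightarrow> real \<Rightarrow> real" where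
  "affine_through f p q x = f p + (f q - f p) / (q - p) * (x - p)"

text \<open>By the mean value theorem the slope of the interpolant is a value of \<open>W'\<close>, from which \<open>W'\<close>
  differs by at most the integral of \<open>\<bar>w\<bar>\<close>.\<close>
lemma affine_interpolation_error:
  assumes D: "\<And>x. x \<in> {s..t} \<Longrightarrow> (W has_real_derivative W' x) (at x within {s..t})"
    and W': "\<And>x. x \<in> {s..t} \<Longrightarrow> W' x = W' s + integral {s..x} w"
    and w: "w absolutely_integrable_on {s..t}"
    and pq: "s \<le> p" "p < q" "q \<le> t" and x: "x \<in> {p..q}"
  shows "\<bar>W x - affine_through W p q x\<bar> \<le> (q - p) * integral {p..q} (\<lambda>x. \<bar>w x\<bar>)"
proof -
  define E where "E = integral {p..q} (\<lambda>x. \<bar>w x\<bar>)"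
  have osc0: "\<bar>W' y - W' z\<bar> \<le> E" if "p \<le> z" "z \<le> y" "y \<le> q" for y z
  proof -
    have wi: "w absolutely_integrable_on {s..y}" "w absolutely_integrable_on {z..y}"
      "w absolutely_integrable_on {p..q}"
      using that pq by (auto intro!: absolutely_integrable_on_subinterval[OF w])
    have "W' y - W' z = integral {z..y} w"
      using W'[of y] W'[of z] that pq wi
        Henstock_Kurzweil_Integration.integral_combine[where a = s and c = z and b = y and f = w]
      by (auto simp: set_lebesgue_integral_eq_integral)
    also have "\<bar>\<dots>\<bar> \<le> integral {z..y} (\<lambda>x. \<bar>w x\<bar>)"
      using wi integral_norm_bound_integral[of w "{z..y}" "\<lambda>x. \<bar>w x\<bar>"]
      by (auto simp: absolutely_integrable_on_def)
    also have "\<dots> \<le> E"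
      unfolding E_def using wi that by (intro integral_subset_le) (auto simp: absolutely_integrable_on_def)
    finally show ?thesis .
  qed
  have osc: "\<bar>W' y - W' z\<bar> \<le> E" if "y \<in> {p..q}" "z \<in> {p..q}" for y z
    using osc0[of y z] osc0[of z y] that by (cases "y \<le> z") (auto simp: abs_minus_commute)
  have D': "(W has_real_derivative W' y) (at y within {p..q})" if "y \<in> {p..q}" for y
    using D[of y] that pq by (auto intro: DERIV_subset)
  have mv: "\<exists>z\<in>{c..d}. W d - W c = W' z * (d - c)" if "p \<le> c" "c \<le> d" "d \<le> q" for c d
  proof (cases "c = d")
    case False
    with that have "c < d" by simp
    moreover have "(W has_derivative (*) (W' y)) (at y within {c..d})" if "c \<le> y" "y \<le> d" for y
      using D'[of y] that \<open>p \<le> c\<close> \<open>d \<le> q\<close>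
      by (auto simp: has_field_derivative_def intro: has_derivative_subset)
    ultimately obtain z where "c < z" "z < d" "W d - W c = W' z * (d - c)"
      using mvt_simple[of c d W "\<lambda>y. (*) (W' y)"] by force
    then show ?thesis by force
  qed (use that in auto)
  from mv[of p q] pq obtain z where z: "z \<in> {p..q}" "W q - W p = W' z * (q - p)" by auto
  from mv[of p x] x obtain y where y: "y \<in> {p..x}" "W x - W p = W' y * (x - p)" by auto
  have "W x - affine_through W p q x = (W' y - W' z) * (x - p)"
    using y z pq by (simp add: affine_through_def left_diff_distrib)
  also have "\<bar>\<dots>\<bar> \<le> E * (q - p)"
    unfolding abs_mult using osc[of y z] x y z by (intro mult_mono) auto
  finally show ?thesis by (simp add: E_def mult.commute)
qed

section \<open>Weak derivatives on open sets with finitely many components\<close>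

lemma has_weak_deriv_restrict:
  assumes wd: "has_weak_deriv S v w" and S: "S \<in> sets lebesgue" and T: "T \<in> sets lebesgue" "T \<subseteq> S"
  shows "has_weak_deriv T v w"
proof (rule has_weak_derivI[OF T(1)])
  note D = has_weak_derivD[OF wd S]
  show "v absolutely_integrable_on K" "w absolutely_integrable_on K" if "compact K" "K \<subseteq> T" for K
    using D(1,2)[of K] that T(2) by auto
  fix \<phi> assume \<phi>: "\<phi> \<in> C1c T"
  then obtain K where K: "compact K" "K \<subseteq> T"
    "\<forall>x. x \<notin> K \<longrightarrow> \<phi> x = 0 \<and> deriv \<phi> x = 0"
    "\<forall>x. (\<phi> has_real_derivative deriv \<phi> x) (at x)" "continuous_on UNIV (deriv \<phi>)" "continuous_on UNIV \<phi>"
    by (rule C1cE)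
  have "K \<subseteq> S" using K(2) T(2) by blast
  have "integral R (\<lambda>x. v x * deriv \<phi> x) = integral K (\<lambda>x. v x * deriv \<phi> x)"
    "integral R (\<lambda>x. w x * \<phi> x) = integral K (\<lambda>x. w x * \<phi> x)" if "K \<subseteq> R" for R
    using D(1,2)[OF K(1) \<open>K \<subseteq> S\<close>] K that
    by (auto intro!: integral_supported_product(2) intro: continuous_on_subset)
  from this[OF K(2)] this[OF \<open>K \<subseteq> S\<close>] D(3)[of \<phi>] \<phi> C1c_mono[OF T(2)]
  show "integral T (\<lambda>x. v x * deriv \<phi> x) = - integral T (\<lambda>x. w x * \<phi> x)"
    by auto
qed

lemma W21_restrict:
  assumes "v \<in> W21 S" and S: "S \<in> sets lebesgue" and T: "T \<in> sets lebesgue" "T \<subseteq> S"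
  shows "v \<in> W21 T"
  using assms(1) has_weak_deriv_restrict[OF _ S T] absolutely_integrable_on_subset[OF _ T]
  unfolding W21_def mem_Collect_eq integrable_lebesgue_on_iff[OF S] integrable_lebesgue_on_iff[OF T(1)]
  by blast

lemma has_weak_deriv_cong_AE:
  assumes wd: "has_weak_deriv S v w" and S: "S \<in> sets lebesgue"
    and v: "negligible {x \<in> S. v x \<noteq> v1 x}" and w: "negligible {x \<in> S. w x \<noteq> w1 x}"
  shows "has_weak_deriv S v1 w1"
proof (rule has_weak_derivI[OF S])
  note D = has_weak_derivD[OF wd S]
  show "v1 absolutely_integrable_on K" if "compact K" "K \<subseteq> S" for K
    by (rule absolutely_integrable_spike[OF D(1)[OF that] v]) (use that in auto)
  show "w1 absolutely_integrable_on K" if "compact K" "K \<subseteq> S" for K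
    by (rule absolutely_integrable_spike[OF D(2)[OF that] w]) (use that in auto)
  fix \<phi> assume \<phi>: "\<phi> \<in> C1c S"
  have "integral S (\<lambda>x. v1 x * deriv \<phi> x) = integral S (\<lambda>x. v x * deriv \<phi> x)"
    by (rule integral_spike[OF v]) auto
  moreover have "integral S (\<lambda>x. w1 x * \<phi> x) = integral S (\<lambda>x. w x * \<phi> x)"
    by (rule integral_spike[OF w]) auto
  ultimately show "integral S (\<lambda>x. v1 x * deriv \<phi> x) = - integral S (\<lambda>x. w1 x * \<phi> x)"
    using D(3)[OF \<phi>] by simp
qed

text \<open>A component is determined by its infimum, which is the left end of the interval or one of the
  removed points.\<close>
lemma finite_components_interval_minus_finite:
  fixes J :: "real set"
  assumes "finite J"
  shows "finite (components ({a<..<b} - J))"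
proof -
  let ?S = "{a<..<b} - J"
  have opS: "open ?S" using assms by (simp add: finite_imp_closed open_Diff)
  have C: "open C" "C \<noteq> {}" "C \<subseteq> ?S" "connected C" "bdd_below C" if "C \<in> components ?S" for C
  proof -
    show "open C" using opS that open_components by blast
    show "C \<noteq> {}" "C \<subseteq> ?S" "connected C"
      using in_components_nonempty[OF that] in_components_subset[OF that] in_components_connected[OF that]
      by simp_all
    then show "bdd_below C" by (intro bdd_belowI[of _ a]) auto
  qed
  have btw: "y \<in> C" if "C \<in> components ?S" "Inf C < y" "x \<in> C" "y \<le> x" for x y C
  proof -
    from cInf_lessD[OF C(2)[OF that(1)] that(2)] obtain z where "z \<in> C" "z < y" by blast
    with connectedD_interval[OF C(4)[OF that(1)] _ that(3), of z y] that show ?thesis by simp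
  qed
  have notin: "Inf C \<notin> C" if "C \<in> components ?S" for C
  proof
    assume "Inf C \<in> C"
    with C(1)[OF that] obtain e where "e > 0" "ball (Inf C) e \<subseteq> C"
      by (meson open_contains_ball)
    then have "Inf C - e / 2 \<in> C" by (auto simp: dist_real_def)
    with cInf_lower[OF this C(5)[OF that]] \<open>e > 0\<close> show False by simp
  qed
  have gt: "Inf C < x" if "C \<in> components ?S" "x \<in> C" for C x
    using cInf_lower[OF that(2) C(5)[OF that(1)]] notin[OF that(1)] that(2) by (cases "Inf C = x") auto
  have "Inf C \<in> insert a J" if "C \<in> components ?S" for C
  proof (rule ccontr)
    assume n: "Inf C \<notin> insert a J"
    from C(2)[OF that] obtain x where x: "x \<in> C" by blast
    have "a \<le> Inf C" using C(2,3)[OF that] by (intro cInf_greatest) auto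
    moreover have "Inf C < b" using gt[OF that x] x C(3)[OF that] by auto
    ultimately have "Inf C \<in> ?S" using n by auto
    then obtain D where D: "D \<in> components ?S" "Inf C \<in> D"
      using Union_components[of ?S] by blast
    with C(1)[OF D(1)] obtain e where e: "e > 0" "ball (Inf C) e \<subseteq> D"
      by (meson open_contains_ball)
    from cInf_lessD[OF C(2)[OF that], of "Inf C + e"] e(1) obtain y where y: "y \<in> C" "y < Inf C + e" by auto
    with gt[OF that y(1)] e(2) have "y \<in> D" by (auto simp: dist_real_def)
    with y(1) that D(1) have "C = D" using components_eq by blast
    with D(2) notin[OF that] show False by simp
  qed
  then have "Inf ` components ?S \<subseteq> insert a J" by blast
  then have "finite (Inf ` components ?S)" using assms by (meson finite_insert finite_subset)
  moreover have "inj_on Inf (components ?S)"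
  proof (rule inj_onI)
    fix C D assume CD: "C \<in> components ?S" "D \<in> components ?S" "Inf C = Inf D"
    obtain x y where xy: "x \<in> C" "y \<in> D" using C(2) CD by blast
    have "min x y \<in> C" "min x y \<in> D"
      using btw[OF CD(1), of "min x y" x] btw[OF CD(2), of "min x y" y] gt[OF CD(1) xy(1)] gt[OF CD(2) xy(2)] xy CD(3)
      by auto
    then show "C = D" using CD components_eq by blast
  qed
  ultimately show ?thesis by (rule finite_imageD)
qed

lemma absolutely_integrable_on_components:
  fixes f :: "real \<Rightarrow> real"
  assumes "finite \<C>" "\<And>C. C \<in> \<C> \<Longrightarrow> C \<in> sets lebesgue" "\<And>C. C \<in> \<C> \<Longrightarrow> f absolutely_integrable_on C"
  shows "f absolutely_integrable_on (\<Union>\<C>)"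
  using set_integrable_UN[of \<C> lebesgue "\<lambda>C. C" f] assms by simp

text \<open>A test function on \<open>S\<close> cut off to one component is again a test function, because a compact
  subset of \<open>S\<close> meets each component in a compact set.\<close>
lemma has_weak_deriv_glue:
  assumes S: "open S" and fin: "finite (components S)"
    and wd: "\<And>C. C \<in> components S \<Longrightarrow> has_weak_deriv C v w"
  shows "has_weak_deriv S v w"
proof (rule has_weak_derivI)
  have opC: "open C" if "C \<in> components S" for C
    using open_components[OF S that] .
  then have Cm: "C \<in> sets lebesgue" if "C \<in> components S" for C
    using that by simp
  have disj: "C \<inter> D = {}" if "C \<in> components S" "D \<in> components S" "C \<noteq> D" for C D
    using components_nonoverlap that by blast
  have comp: "compact (K \<inter> C)" if "compact K" "K \<subseteq> S" "C \<in> components S" for K C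
  proof -
    have "K \<inter> C = K - \<Union>(components S - {C})"
      using that(2,3) disj Union_components[of S] by blast
    moreover have "open (\<Union>(components S - {C}))" using opC by blast
    ultimately show ?thesis using that(1) compact_diff by metis
  qed
  show "S \<in> sets lebesgue" using S by simp
  have K: "v absolutely_integrable_on K" "w absolutely_integrable_on K" if K: "compact K" "K \<subseteq> S" for K
  proof -
    let ?K = "(\<lambda>C. K \<inter> C) ` components S"
    have "\<Union>?K = K" using K(2) Union_components[of S] by blast
    moreover have "f absolutely_integrable_on (\<Union>?K)"
      if "\<And>C. C \<in> components S \<Longrightarrow> f absolutely_integrable_on (K \<inter> C)" for f :: "real \<Rightarrow> real"
      using fin that comp[OF K] compact_imp_sets_lebesgue by (intro absolutely_integrable_on_components) auto
    moreover have "v absolutely_integrable_on (K \<inter> C)" "w absolutely_integrable_on (K \<inter> C)"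
      if "C \<in> components S" for C
      using has_weak_derivD(1,2)[OF wd[OF that] Cm[OF that] comp[OF K that]] by auto
    ultimately show "v absolutely_integrable_on K" "w absolutely_integrable_on K" by auto
  qed
  then show "\<And>K. compact K \<Longrightarrow> K \<subseteq> S \<Longrightarrow> v absolutely_integrable_on K"
    "\<And>K. compact K \<Longrightarrow> K \<subseteq> S \<Longrightarrow> w absolutely_integrable_on K" by auto
  fix \<phi> assume \<phi>: "\<phi> \<in> C1c S"
  then obtain K where K': "compact K" "K \<subseteq> S"
    "\<forall>x. x \<notin> K \<longrightarrow> \<phi> x = 0 \<and> deriv \<phi> x = 0"
    "\<forall>x. (\<phi> has_real_derivative deriv \<phi> x) (at x)" "continuous_on UNIV (deriv \<phi>)" "continuous_on UNIV \<phi>"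
    by (rule C1cE)
  have i: "(\<lambda>x. v x * deriv \<phi> x) absolutely_integrable_on S" "(\<lambda>x. w x * \<phi> x) absolutely_integrable_on S"
    using K by (auto intro!: C1c_integral_local[OF \<phi>])
  have sum: "integral S f = (\<Sum>C\<in>components S. integral C f)" if "f absolutely_integrable_on S" for f :: "real \<Rightarrow> real"
  proof -
    have "(f has_integral (\<Sum>C\<in>components S. integral C f)) (\<Union>(components S))"
    proof (rule has_integral_Union[OF fin])
      show "(f has_integral integral C f) C" if "C \<in> components S" for C
        using absolutely_integrable_on_subset[OF \<open>f absolutely_integrable_on S\<close> Cm[OF that] in_components_subset[OF that]]
        by (simp add: set_lebesgue_integral_eq_integral has_integral_iff)
      show "pairwise (\<lambda>C D. negligible (C \<inter> D)) (components S)"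
        using disj by (auto simp: pairwise_def)
    qed
    then show ?thesis by (simp add: integral_unique Union_components)
  qed
  have "integral C (\<lambda>x. v x * deriv \<phi> x) = - integral C (\<lambda>x. w x * \<phi> x)" if C: "C \<in> components S" for C
  proof -
    define \<psi> where "\<psi> x = (if x \<in> C then \<phi> x else 0)" for x
    define \<psi>' where "\<psi>' x = (if x \<in> C then deriv \<phi> x else 0)" for x
    have zero: "\<exists>T. open T \<and> x \<in> T \<and> (\<forall>y\<in>T. \<psi> y = 0 \<and> \<psi>' y = 0)" if "x \<notin> C" for x
    proof (cases "x \<in> S")
      case True
      then obtain D where D: "D \<in> components S" "x \<in> D" using Union_components[of S] by blast
      with that disj[OF C D(1)] opC[OF D(1)] show ?thesis
        by (intro exI[of _ D]) (auto simp: \<psi>_def \<psi>'_def)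
    next
      case False
      then show ?thesis
        using K' by (intro exI[of _ "- K"]) (auto simp: \<psi>_def \<psi>'_def compact_imp_closed)
    qed
    have "(\<psi> has_real_derivative \<psi>' x) (at x)" for x
    proof (cases "x \<in> C")
      case True
      have "(\<phi> has_real_derivative \<psi>' x) (at x)" using K'(4) True by (simp add: \<psi>'_def)
      then show ?thesis
        by (rule has_field_derivative_transform_within_open[OF _ opC[OF C] True]) (simp add: \<psi>_def)
    next
      case False
      from zero[OF this] obtain T where T: "open T" "x \<in> T" "\<forall>y\<in>T. \<psi> y = 0 \<and> \<psi>' y = 0" by blast
      have "((\<lambda>_. 0) has_real_derivative \<psi>' x) (at x)" using T by simp
      then show ?thesis
        by (rule has_field_derivative_transform_within_open[OF _ T(1,2)]) (use T in simp)
    qed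
    moreover have "isCont \<psi>' x" for x
    proof (cases "x \<in> C")
      case True
      have "isCont (deriv \<phi>) x" using K'(5) by (simp add: continuous_on_eq_continuous_at)
      then show ?thesis
        using eventually_nhds_in_open[OF opC[OF C] True]
        by (subst isCont_cong[of _ "deriv \<phi>"]) (auto simp: \<psi>'_def elim!: eventually_mono)
    next
      case False
      from zero[OF this] obtain T where T: "open T" "x \<in> T" "\<forall>y\<in>T. \<psi> y = 0 \<and> \<psi>' y = 0" by blast
      show ?thesis
        using eventually_nhds_in_open[OF T(1,2)] T(3)
        by (subst isCont_cong[of _ "\<lambda>_. 0"]) (auto elim!: eventually_mono)
    qed
    then have "continuous_on UNIV \<psi>'" by (simp add: continuous_on_eq_continuous_at)
    moreover have "\<psi> x = 0" if "x \<notin> K \<inter> C" for x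
      using that K' by (auto simp: \<psi>_def)
    ultimately have "\<psi> \<in> C1c C" "deriv \<psi> = \<psi>'"
      using C1cI[of \<psi> \<psi>' "K \<inter> C" C] comp[OF K'(1,2) C] by auto
    then have "integral C (\<lambda>x. v x * \<psi>' x) = - integral C (\<lambda>x. w x * \<psi> x)"
      using has_weak_derivD(3)[OF wd[OF C] Cm[OF C]] by metis
    moreover have "integral C (\<lambda>x. v x * \<psi>' x) = integral C (\<lambda>x. v x * deriv \<phi> x)"
      by (rule integral_cong) (simp add: \<psi>'_def)
    moreover have "integral C (\<lambda>x. w x * \<psi> x) = integral C (\<lambda>x. w x * \<phi> x)"
      by (rule integral_cong) (simp add: \<psi>_def)
    ultimately show ?thesis by simp
  qed
  then show "integral S (\<lambda>x. v x * deriv \<phi> x) = - integral S (\<lambda>x. w x * \<phi> x)"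
    by (simp add: sum i sum_negf)
qed

text \<open>The function \<open>weak_deriv\<close> picks some weak derivative if there is one. Existence on the whole
  complement of the jumps comes from gluing the derivatives on the components. The inner choice may
  differ from the glued derivative on a null set; it has the same weak derivatives.\<close>
lemma piecewise_W21_weak_derivs:
  fixes v :: "real \<Rightarrow> real"
  assumes "v \<in> piecewise_W21 {a<..<b}"
  defines "S \<equiv> {a<..<b} - jump_set {a<..<b} v"
  shows "has_weak_deriv S v (weak_deriv S v)"
    and "has_weak_deriv S (weak_deriv S v) (weak_deriv S (weak_deriv S v))"
    and "weak_deriv S (weak_deriv S v) absolutely_integrable_on S"
proof -
  have J: "finite (jump_set {a<..<b} v)" and W: "\<And>C. C \<in> components S \<Longrightarrow> v \<in> W21 C"
    using assms by (auto simp: piecewise_W21_def)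
  have S: "open S" unfolding S_def using J by (simp add: finite_imp_closed open_Diff)
  have Sm: "S \<in> sets lebesgue" using S by simp
  have fin: "finite (components S)"
    unfolding S_def using J by (rule finite_components_interval_minus_finite)
  have Cm: "C \<in> sets lebesgue" if "C \<in> components S" for C
    using open_components[OF S that] by simp
  have "\<exists>p q. has_weak_deriv C v p \<and> has_weak_deriv C p q \<and> q absolutely_integrable_on C"
    if "C \<in> components S" for C
    using W[OF that] unfolding W21_def mem_Collect_eq integrable_lebesgue_on_iff[OF Cm[OF that]] by blast
  then obtain P Q where PQ: "\<And>C. C \<in> components S \<Longrightarrow> has_weak_deriv C v (P C)"
    "\<And>C. C \<in> components S \<Longrightarrow> has_weak_deriv C (P C) (Q C)"
    "\<And>C. C \<in> components S \<Longrightarrow> Q C absolutely_integrable_on C"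
    by metis
  define p where "p x = P (connected_component_set S x) x" for x
  define q where "q x = Q (connected_component_set S x) x" for x
  have cc: "connected_component_set S x = C" if "C \<in> components S" "x \<in> C" for x C
    using that by (metis components_iff connected_component_eq)
  have neg: "negligible {x \<in> C. P C x \<noteq> p x}" "negligible {x \<in> C. Q C x \<noteq> q x}"
    "negligible {x \<in> C. v x \<noteq> v x}" if "C \<in> components S" for C
  proof -
    have "{x \<in> C. P C x \<noteq> p x} = {}" "{x \<in> C. Q C x \<noteq> q x} = {}"
      using cc[OF that] by (auto simp: p_def q_def)
    then show "negligible {x \<in> C. P C x \<noteq> p x}" "negligible {x \<in> C. Q C x \<noteq> q x}"
      by (simp_all only: negligible_empty)
    show "negligible {x \<in> C. v x \<noteq> v x}" by simp
  qed
  have vp: "has_weak_deriv S v p"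
    by (rule has_weak_deriv_glue[OF S fin]) (rule has_weak_deriv_cong_AE[OF PQ(1) Cm neg(3) neg(1)])
  have pq: "has_weak_deriv S p q"
    by (rule has_weak_deriv_glue[OF S fin]) (rule has_weak_deriv_cong_AE[OF PQ(2) Cm neg(1) neg(2)])
  have "q absolutely_integrable_on (\<Union>(components S))"
  proof (rule absolutely_integrable_on_components[OF fin Cm])
    fix C assume C: "C \<in> components S"
    show "q absolutely_integrable_on C"
      by (rule absolutely_integrable_spike[OF PQ(3)[OF C] neg(2)[OF C]]) auto
  qed
  then have qi: "q absolutely_integrable_on S" by (simp add: Union_components)
  show 1: "has_weak_deriv S v (weak_deriv S v)"
    unfolding weak_deriv_def by (rule someI[of "has_weak_deriv S v", OF vp])
  have wq: "has_weak_deriv S (weak_deriv S v) q"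
    by (rule has_weak_deriv_cong_AE[OF pq Sm weak_deriv_unique[OF vp 1 S]]) simp
  show 2: "has_weak_deriv S (weak_deriv S v) (weak_deriv S (weak_deriv S v))"
    unfolding weak_deriv_def[of S "weak_deriv S v"] by (rule someI[of "has_weak_deriv S (weak_deriv S v)", OF wq])
  show "weak_deriv S (weak_deriv S v) absolutely_integrable_on S"
    by (rule absolutely_integrable_spike[OF qi weak_deriv_unique[OF wq 2 S]]) auto
qed

lemma piecewise_W21_imp_W21:
  assumes "v \<in> piecewise_W21 {a<..<b}" "{s<..<t} \<subseteq> {a<..<b} - jump_set {a<..<b} v"
  shows "v \<in> W21 {s<..<t}"
proof (cases "s < t")
  case True
  let ?S = "{a<..<b} - jump_set {a<..<b} v"
  have S: "open ?S" using assms(1) by (simp add: piecewise_W21_def finite_imp_closed open_Diff)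
  have "(s + t) / 2 \<in> {s<..<t}" using True by simp
  with assms(2) have "?S \<noteq> {}" by blast
  from exists_component_superset[OF assms(2) this connected_Ioo]
  obtain C where C: "C \<in> components ?S" "{s<..<t} \<subseteq> C" by blast
  moreover have "open C" using open_components[OF S C(1)] .
  moreover have "v \<in> W21 C" using assms(1) C(1) by (auto simp: piecewise_W21_def)
  ultimately show ?thesis by (auto intro: W21_restrict[of v C])
next
  case False
  then have e: "{s<..<t} = {}" by simp
  show ?thesis unfolding e W21_def has_weak_deriv_def by auto
qed

section \<open>One-sided approximate limits\<close>

definition approx_left :: "(real \<Rightarrow> real) \<Rightarrow> real \<Rightarrow> real \<Rightarrow> bool" where
  "approx_left v z l \<longleftrightarrow> ((\<lambda>r. integral {z - r..z} (\<lambda>x. \<bar>v x - l\<bar>) / r) \<longlongrightarrow> 0) (at_right 0)"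

lemma LINT_abs_diff_interval:
  fixes v :: "real \<Rightarrow> real"
  assumes "v absolutely_integrable_on {p..q}"
  shows "(LINT x|lebesgue_on {p<..<q}. \<bar>v x - l\<bar>) = integral {p..q} (\<lambda>x. \<bar>v x - l\<bar>)"
proof -
  have "(\<lambda>x. \<bar>v x - l\<bar>) absolutely_integrable_on {p<..<q}"
    using absolutely_integrable_abs_diff_const(1)[OF assms] by (simp add: absolutely_integrable_on_Icc_iff_Ioo)
  then show ?thesis
    by (simp add: LINT_lebesgue_on_eq_integral integral_open_interval_real)
qed

lemma approx_limit_iff_approx_left:
  assumes v: "v absolutely_integrable_on {a..b}" and z: "a < z" "z \<le> b"
  shows "approx_limit ({a<..<b} \<inter> {..<z}) v z l \<longleftrightarrow> approx_left v z l"
  unfolding approx_limit_def approx_left_def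
proof (rule filterlim_cong[OF refl refl])
  have "(LINT x|lebesgue_on ({a<..<b} \<inter> {..<z} \<inter> ball z r). \<bar>v x - l\<bar>) / r
      = integral {z - r..z} (\<lambda>x. \<bar>v x - l\<bar>) / r" if "0 < r" "r < z - a" for r
  proof -
    have "{a<..<b} \<inter> {..<z} \<inter> ball z r = {z - r<..<z}"
      using that z by (auto simp: dist_real_def)
    moreover have "v absolutely_integrable_on {z - r..z}"
      using that z by (intro absolutely_integrable_on_subinterval[OF v]) auto
    ultimately show ?thesis by (simp add: LINT_abs_diff_interval)
  qed
  then show "\<forall>\<^sub>F r in at_right 0. (LINT x|lebesgue_on ({a<..<b} \<inter> {..<z} \<inter> ball z r). \<bar>v x - l\<bar>) / r
      = integral {z - r..z} (\<lambda>x. \<bar>v x - l\<bar>) / r"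
    unfolding eventually_at_right_field using z by (intro exI[of _ "z - a"]) auto
qed

lemma approx_limit_iff_approx_right:
  assumes v: "v absolutely_integrable_on {a..b}" and z: "a \<le> z" "z < b"
  shows "approx_limit ({a<..<b} \<inter> {z<..}) v z l \<longleftrightarrow> approx_right v z l"
  unfolding approx_limit_def approx_right_def
proof (rule filterlim_cong[OF refl refl])
  have "(LINT x|lebesgue_on ({a<..<b} \<inter> {z<..} \<inter> ball z r). \<bar>v x - l\<bar>) / r
      = integral {z..z + r} (\<lambda>x. \<bar>v x - l\<bar>) / r" if "0 < r" "r < b - z" for r
  proof -
    have "{a<..<b} \<inter> {z<..} \<inter> ball z r = {z<..<z + r}"
      using that z by (auto simp: dist_real_def)
    moreover have "v absolutely_integrable_on {z..z + r}"
      using that z by (intro absolutely_integrable_on_subinterval[OF v]) auto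
    ultimately show ?thesis by (simp add: LINT_abs_diff_interval)
  qed
  then show "\<forall>\<^sub>F r in at_right 0. (LINT x|lebesgue_on ({a<..<b} \<inter> {z<..} \<inter> ball z r). \<bar>v x - l\<bar>) / r
      = integral {z..z + r} (\<lambda>x. \<bar>v x - l\<bar>) / r"
    unfolding eventually_at_right_field using z by (intro exI[of _ "b - z"]) auto
qed

lemma integral_abs_diff_triangle:
  fixes v :: "real \<Rightarrow> real"
  assumes v: "v absolutely_integrable_on {p..q}" and "p \<le> q"
  shows "\<bar>l - l'\<bar> * (q - p) \<le> integral {p..q} (\<lambda>x. \<bar>v x - l\<bar>) + integral {p..q} (\<lambda>x. \<bar>v x - l'\<bar>)"
proof -
  note I = absolutely_integrable_abs_diff_const(2)[OF v]
  have "\<bar>l - l'\<bar> * (q - p) = integral {p..q} (\<lambda>x. \<bar>l - l'\<bar>)"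
    using assms(2) by simp
  also have "\<dots> \<le> integral {p..q} (\<lambda>x. \<bar>v x - l\<bar> + \<bar>v x - l'\<bar>)"
    by (rule integral_le) (auto intro!: integrable_add I)
  finally show ?thesis by (simp add: integral_add I)
qed

lemma averages_limit_unique:
  fixes v :: "real \<Rightarrow> real"
  assumes "d > 0" and I: "\<And>r. 0 < r \<Longrightarrow> r < d \<Longrightarrow> v absolutely_integrable_on {p r..q r} \<and> q r - p r = r"
    and l: "((\<lambda>r. integral {p r..q r} (\<lambda>x. \<bar>v x - l\<bar>) / r) \<longlongrightarrow> 0) (at_right 0)"
    and l': "((\<lambda>r. integral {p r..q r} (\<lambda>x. \<bar>v x - l'\<bar>) / r) \<longlongrightarrow> 0) (at_right 0)"
  shows "l = l'"
proof -
  have "\<forall>\<^sub>F r in at_right 0. \<bar>l - l'\<bar>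
      \<le> integral {p r..q r} (\<lambda>x. \<bar>v x - l\<bar>) / r + integral {p r..q r} (\<lambda>x. \<bar>v x - l'\<bar>) / r"
    unfolding eventually_at_right_field
  proof (intro exI[of _ d] conjI allI impI)
    fix r assume r: "0 < r" "r < d"
    from integral_abs_diff_triangle[where v = v and p = "p r" and q = "q r" and l = l and l' = l'] I[OF r] r
    show "\<bar>l - l'\<bar> \<le> integral {p r..q r} (\<lambda>x. \<bar>v x - l\<bar>) / r + integral {p r..q r} (\<lambda>x. \<bar>v x - l'\<bar>) / r"
      by (simp add: field_simps)
  qed (use assms(1) in auto)
  with tendsto_add[OF l l'] have "\<bar>l - l'\<bar> \<le> 0"
    by (intro tendsto_lowerbound[where F = "at_right 0"]) auto
  then show ?thesis by simp
qed

lemma approx_left_unique: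
  assumes "v absolutely_integrable_on {a..z}" "a < z" "approx_left v z l" "approx_left v z l'"
  shows "l = l'"
  using assms(2-) unfolding approx_left_def
  by (elim averages_limit_unique[rotated 2, where d = "z - a"])
    (auto intro: absolutely_integrable_on_subinterval[OF assms(1)])

lemma approx_right_unique:
  assumes "v absolutely_integrable_on {z..b}" "z < b" "approx_right v z l" "approx_right v z l'"
  shows "l = l'"
  using assms(2-) unfolding approx_right_def
  by (elim averages_limit_unique[rotated 2, where d = "b - z"])
    (auto intro: absolutely_integrable_on_subinterval[OF assms(1)])

lemma integral_abs_diff_le_AE:
  fixes v :: "real \<Rightarrow> real"
  assumes v: "v absolutely_integrable_on {p..q}" and "p \<le> q"
    and N: "negligible N" and le: "\<And>x. x \<in> {p..q} - N \<Longrightarrow> \<bar>v x - l\<bar> \<le> e"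
  shows "integral {p..q} (\<lambda>x. \<bar>v x - l\<bar>) \<le> e * (q - p)"
proof -
  define g where "g x = (if x \<in> N then e else \<bar>v x - l\<bar>)" for x
  have "integral {p..q} (\<lambda>x. \<bar>v x - l\<bar>) = integral {p..q} g"
    by (rule integral_spike[OF N]) (simp add: g_def)
  also have "\<dots> \<le> integral {p..q} (\<lambda>_. e)"
  proof (rule integral_le)
    show "g integrable_on {p..q}"
      by (rule integrable_spike[OF absolutely_integrable_abs_diff_const(2)[OF v, of l] N]) (simp add: g_def)
  qed (use le in \<open>auto simp: g_def\<close>)
  finally show ?thesis using assms(2) by (simp add: mult.commute)
qed

lemma approx_limits_of_continuous:
  assumes v: "v absolutely_integrable_on {s..t}" and N: "negligible {x \<in> {s<..<t}. v x \<noteq> W x}"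
    and W: "continuous_on {s..t} W"
  shows approx_left_of_continuous: "z \<in> {s<..t} \<Longrightarrow> approx_left v z (W z)"
    and approx_right_of_continuous: "z \<in> {s..<t} \<Longrightarrow> approx_right v z (W z)"
proof -
  let ?N = "{x \<in> {s<..<t}. v x \<noteq> W x} \<union> {s, t}"
  have N': "negligible ?N" using N by simp
  have delta: "\<exists>d>0. \<forall>x\<in>{s..t}. \<bar>x - z\<bar> < d \<longrightarrow> \<bar>W x - W z\<bar> < e" if "z \<in> {s..t}" "e > 0" for z e :: real
    using W that unfolding continuous_on_iff by (simp add: dist_real_def)
  have small: "\<bar>integral {p..q} (\<lambda>x. \<bar>v x - W z\<bar>) / (q - p)\<bar> < e"
    if "p < q" "s \<le> p" "q \<le> t" "e > 0" and cl: "\<And>x. x \<in> {p..q} \<Longrightarrow> \<bar>W x - W z\<bar> < e / 2" for p q z e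
  proof -
    have vi: "v absolutely_integrable_on {p..q}"
      using that by (intro absolutely_integrable_on_subinterval[OF v]) auto
    have "\<bar>v x - W z\<bar> \<le> e / 2" if "x \<in> {p..q} - ?N" for x
    proof -
      have "v x = W x" using that \<open>s \<le> p\<close> \<open>q \<le> t\<close> by auto
      then show ?thesis using cl[of x] that by simp
    qed
    then have "integral {p..q} (\<lambda>x. \<bar>v x - W z\<bar>) \<le> e / 2 * (q - p)"
      using that by (intro integral_abs_diff_le_AE[OF vi _ N']) auto
    moreover have "integral {p..q} (\<lambda>x. \<bar>v x - W z\<bar>) \<ge> 0"
      using absolutely_integrable_abs_diff_const(2)[OF vi] by (intro integral_nonneg) auto
    moreover have "e / 2 * (q - p) < e * (q - p)" using that by simp
    ultimately show ?thesis
      using that(1) by (simp add: field_simps)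
  qed
  show "approx_left v z (W z)" if z: "z \<in> {s<..t}"
    unfolding approx_left_def
  proof (rule tendstoI)
    fix e :: real assume e: "e > 0"
    from delta[of z "e / 2"] z e obtain d where d: "d > 0" "\<forall>x\<in>{s..t}. \<bar>x - z\<bar> < d \<longrightarrow> \<bar>W x - W z\<bar> < e / 2" by auto
    have "dist (integral {z - r..z} (\<lambda>x. \<bar>v x - W z\<bar>) / r) 0 < e" if "0 < r" "r < min d (z - s)" for r
      using small[of "z - r" z e z] that z d e by (auto simp: dist_real_def)
    then show "\<forall>\<^sub>F r in at_right 0. dist (integral {z - r..z} (\<lambda>x. \<bar>v x - W z\<bar>) / r) 0 < e"
      unfolding eventually_at_right_field using d z by (intro exI[of _ "min d (z - s)"]) auto
  qed
  show "approx_right v z (W z)" if z: "z \<in> {s..<t}"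
    unfolding approx_right_def
  proof (rule tendstoI)
    fix e :: real assume e: "e > 0"
    from delta[of z "e / 2"] z e obtain d where d: "d > 0" "\<forall>x\<in>{s..t}. \<bar>x - z\<bar> < d \<longrightarrow> \<bar>W x - W z\<bar> < e / 2" by auto
    have "dist (integral {z..z + r} (\<lambda>x. \<bar>v x - W z\<bar>) / r) 0 < e" if "0 < r" "r < min d (t - z)" for r
      using small[of z "z + r" e z] that z d e by (auto simp: dist_real_def)
    then show "\<forall>\<^sub>F r in at_right 0. dist (integral {z..z + r} (\<lambda>x. \<bar>v x - W z\<bar>) / r) 0 < e"
      unfolding eventually_at_right_field using d z by (intro exI[of _ "min d (t - z)"]) auto
  qed
qed

section \<open>Total variation and divisions\<close>

lemma division_of_Icc_element:
  assumes "\<D> division_of {a..b::real}" "T \<in> \<D>"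
  shows "T = {Inf T..Sup T}" "Inf T \<le> Sup T" "a \<le> Inf T" "Sup T \<le> b"
proof -
  obtain p q where T: "T = {p..q}" "T \<noteq> {}" "T \<subseteq> {a..b}"
    using division_ofD(2-4)[OF assms(1)] assms(2) by force
  then have "p \<le> q" by simp
  with T show "T = {Inf T..Sup T}" "Inf T \<le> Sup T" "a \<le> Inf T" "Sup T \<le> b" by auto
qed

lemma division_of_Icc_elementE:
  assumes "\<D> division_of {a..b::real}" "T \<in> \<D>"
  obtains p q where "T = {p..q}" "p \<le> q" "Inf T = p" "Sup T = q" "a \<le> p" "q \<le> b"
  using that[of "Inf T" "Sup T"] division_of_Icc_element[OF assms] by blast

text \<open>Tagging every interval with its left endpoint reduces this to tagged divisions.\<close>
lemma division_telescope:
  fixes F :: "real \<Rightarrow> real"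
  assumes "\<D> division_of {a..b}" "a \<le> b"
  shows "(\<Sum>T\<in>\<D>. F (Sup T) - F (Inf T)) = F b - F a"
proof -
  let ?p = "(\<lambda>T. (Inf T, T)) ` \<D>"
  have "?p tagged_division_of {a..b}"
  proof (rule tagged_division_ofI)
    show "finite ?p" using division_of_finite[OF assms(1)] by simp
    show "x \<in> K" if "(x, K) \<in> ?p" for x K
    proof -
      from that have K: "K \<in> \<D>" "x = Inf K" by auto
      from division_of_Icc_elementE[OF assms(1) K(1)] show ?thesis
        using K(2) by (metis atLeastAtMost_iff order_refl)
    qed
    show "K \<subseteq> {a..b}" if "(x, K) \<in> ?p" for x K
      using that division_ofD(2)[OF assms(1)] by auto
    show "\<exists>c d. K = cbox c d" if "(x, K) \<in> ?p" for x K
      using that division_ofD(4)[OF assms(1)] by auto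
    show "interior K1 \<inter> interior K2 = {}"
      if "(x1, K1) \<in> ?p" "(x2, K2) \<in> ?p" "(x1, K1) \<noteq> (x2, K2)" for x1 K1 x2 K2
      using that division_ofD(5)[OF assms(1), of K1 K2] by auto
    have "{K. \<exists>x. (x, K) \<in> ?p} = \<D>" by auto
    then show "\<Union>{K. \<exists>x. (x, K) \<in> ?p} = {a..b}"
      using division_ofD(6)[OF assms(1)] by simp
  qed
  from additive_tagged_division_1[OF assms(2) this, of F] show ?thesis
    by (subst (asm) sum.reindex) (auto simp: inj_on_def)
qed

text \<open>The test function is constant, with the value that matches the sign of the increment, on most of
  each interval of the division, and its derivative is a combination of bumps located just to the
  left of the nodes. As the width of the bumps tends to 0, pairing with \<open>v\<close> yields the approximate
  left limits at the nodes, hence the sum of the absolute increments.\<close>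
lemma total_variation_ge_division:
  assumes v: "v absolutely_integrable_on {a..b}" and ab: "a < b"
    and D: "\<D> division_of {a..b}"
    and f: "approx_right v a (f a)" "\<And>z. z \<in> {a<..b} \<Longrightarrow> approx_left v z (f z)"
  shows "ereal (\<Sum>T\<in>\<D>. \<bar>f (Sup T) - f (Inf T)\<bar>) \<le> total_variation {a<..<b} v"
proof -
  note E = division_of_Icc_element[OF D]
  have finD: "finite \<D>" using D by (rule division_of_finite)
  \<comment> \<open>For small \<open>e\<close> the bump belonging to \<open>y > a\<close> lives on \<open>{y - e..y - e / 2}\<close> and the one belonging to
    \<open>a\<close> on \<open>{a + e / 2..a + e}\<close>: both keep a distance from the end points of the interval, as compact
    support requires, and the maximum makes their position monotone in \<open>y\<close>.\<close>
  define c where "c e y = max (y - e) (a + e / 2)" for e y :: real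
  define B where "B e y = integral {a..b} (\<lambda>x. v x * bump (e / 2) (c e y) x)" for e y
  define \<sigma> where "\<sigma> T = sgn (f (Inf T) - f (Sup T))" for T
  have csub: "{c e y..c e y + e / 2} \<subseteq> {a + e / 2..b - e / 2}" if "0 < e" "e < (b - a) / 2" "y \<le> b" for e y
    using that by (auto simp: c_def max_def field_simps)
  have csub': "{c e y..c e y + e / 2} \<subseteq> {a..b}" if "0 < e" "e < (b - a) / 2" "y \<le> b" for e y
    using csub[OF that] that by (auto simp: subset_iff)
  have Bi: "(\<lambda>x. v x * bump (e / 2) (c e y) x) integrable_on {a..b}
      \<and> B e y = integral {c e y..c e y + e / 2} (\<lambda>x. v x * bump (e / 2) (c e y) x)"
    if "0 < e" "e < (b - a) / 2" "y \<le> b" for e y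
  proof -
    have "v absolutely_integrable_on {c e y..c e y + e / 2}"
      using v csub'[OF that] by (rule absolutely_integrable_on_subinterval)
    from integral_supported_product[OF this compact_Icc csub'[OF that] continuous_on_bump bump_outside] that(1)
    show ?thesis by (simp add: B_def set_lebesgue_integral_eq_integral)
  qed
  have Blim: "((\<lambda>e. B e y) \<longlongrightarrow> f y) (at_right 0)" if y: "y \<in> {a..b}" for y
  proof -
    define I where "I e = (if y = a then integral {a..a + e} (\<lambda>x. \<bar>v x - f y\<bar>) else integral {y - e..y} (\<lambda>x. \<bar>v x - f y\<bar>))" for e
    have "((\<lambda>e. I e / e) \<longlongrightarrow> 0) (at_right 0)"
      using f y unfolding I_def approx_right_def approx_left_def by (cases "y = a") auto
    then have "((\<lambda>e. 4 * (I e / e)) \<longlongrightarrow> 4 * 0) (at_right 0)"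
      by (intro tendsto_intros)
    then have l0: "((\<lambda>e. 4 * (I e / e)) \<longlongrightarrow> 0) (at_right 0)" by simp
    have "norm (B e y - f y) \<le> 4 * (I e / e)"
      if e: "0 < e" "e < (if y = a then (b - a) / 2 else min ((b - a) / 2) ((y - a) / 2))" for e
    proof -
      have e': "e < (b - a) / 2" using e(2) by (auto split: if_splits)
      have yb: "y \<le> b" using y by simp
      have vi: "v absolutely_integrable_on {c e y..c e y + e / 2}"
        using v csub'[OF e(1) e' yb] by (rule absolutely_integrable_on_subinterval)
      have ce: "c e y = (if y = a then a + e / 2 else y - e)"
        using e y by (auto simp: c_def max_def field_simps)
      have ii: "(\<lambda>x. \<bar>v x - l\<bar>) integrable_on {p..q}" if "a \<le> p" "q \<le> b" for p q l
        using that by (intro absolutely_integrable_abs_diff_const(2) absolutely_integrable_on_subinterval[OF v]) auto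
      have "integral {c e y..c e y + e / 2} (\<lambda>x. \<bar>v x - f y\<bar>) \<le> I e"
        unfolding I_def ce using e y e'
        by (auto intro!: integral_subset_le ii simp: field_simps)
      then have "2 * (integral {c e y..c e y + e / 2} (\<lambda>x. \<bar>v x - f y\<bar>) / (e / 2)) \<le> 4 * (I e / e)"
        using e(1) by (simp add: divide_right_mono)
      with bump_average[OF vi, of "f y"] e(1) Bi[OF e(1) e' yb] show ?thesis by auto
    qed
    then have "\<forall>\<^sub>F e in at_right 0. norm (B e y - f y) \<le> 4 * (I e / e)"
      unfolding eventually_at_right_field using ab y
      by (intro exI[of _ "if y = a then (b - a) / 2 else min ((b - a) / 2) ((y - a) / 2)"]) auto
    then have "((\<lambda>e. B e y - f y) \<longlongrightarrow> 0) (at_right 0)"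
      using l0 by (rule Lim_null_comparison)
    then show ?thesis by (simp add: LIM_zero_iff)
  qed
  have le: "ereal (\<Sum>T\<in>\<D>. \<sigma> T * (B e (Inf T) - B e (Sup T))) \<le> total_variation {a<..<b} v"
    if e: "0 < e" "e < (b - a) / 2" for e
  proof -
    define \<phi> where "\<phi> x = (\<Sum>T\<in>\<D>. \<sigma> T * (ramp (e / 2) (c e (Inf T)) x - ramp (e / 2) (c e (Sup T)) x))" for x
    define \<phi>' where "\<phi>' x = (\<Sum>T\<in>\<D>. \<sigma> T * (bump (e / 2) (c e (Inf T)) x - bump (e / 2) (c e (Sup T)) x))" for x
    have e2: "e / 2 > 0" using e by simp
    have ys: "Inf T \<le> b" "Sup T \<le> b" "Inf T \<le> Sup T" if "T \<in> \<D>" for T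
      using E[OF that] by auto
    have D\<phi>: "(\<phi> has_real_derivative \<phi>' x) (at x)" for x
      unfolding \<phi>_def[abs_def] \<phi>'_def
      by (intro DERIV_sum DERIV_cmult DERIV_diff ramp_deriv[OF e2])
    have C\<phi>: "continuous_on UNIV \<phi>'"
      unfolding \<phi>'_def[abs_def] by (intro continuous_intros continuous_on_bump)
    have Z: "\<phi> x = 0" if "x \<notin> {a + e / 2..b - e / 2}" for x
      unfolding \<phi>_def
    proof (rule sum.neutral, rule ballI)
      fix T assume T: "T \<in> \<D>"
      from that consider "x < a + e / 2" | "x > b - e / 2" by force
      then have "ramp (e / 2) (c e (Inf T)) x = ramp (e / 2) (c e (Sup T)) x"
      proof cases
        case 1
        then have "x \<le> c e y" for y by (auto simp: c_def)
        then show ?thesis using ramp_left[OF e2] by simp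
      next
        case 2
        then have "c e y + e / 2 \<le> x" if "y \<le> b" for y using that e by (auto simp: c_def max_def field_simps)
        then show ?thesis using ramp_right[OF e2] ys[OF T] by simp
      qed
      then show "\<sigma> T * (ramp (e / 2) (c e (Inf T)) x - ramp (e / 2) (c e (Sup T)) x) = 0" by simp
    qed
    have sub: "{a + e / 2..b - e / 2} \<subseteq> {a<..<b}" using e by auto
    have C1: "\<phi> \<in> C1c {a<..<b}" "deriv \<phi> = \<phi>'"
      using C1cI[OF D\<phi> C\<phi> compact_Icc sub Z] by blast+
    have "\<bar>\<phi> x\<bar> \<le> 1" for x
    proof -
      \<comment> \<open>Without the signs the sum telescopes to the difference of two ramps.\<close>
      have "\<bar>\<phi> x\<bar> \<le> (\<Sum>T\<in>\<D>. ramp (e / 2) (c e (Inf T)) x - ramp (e / 2) (c e (Sup T)) x)"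
        unfolding \<phi>_def
      proof (rule order_trans[OF sum_abs sum_mono])
        fix T assume T: "T \<in> \<D>"
        have "c e (Inf T) \<le> c e (Sup T)" using ys[OF T] by (auto simp: c_def)
        then have "ramp (e / 2) (c e (Sup T)) x \<le> ramp (e / 2) (c e (Inf T)) x"
          by (rule ramp_antimono[OF e2])
        then show "\<bar>\<sigma> T * (ramp (e / 2) (c e (Inf T)) x - ramp (e / 2) (c e (Sup T)) x)\<bar>
            \<le> ramp (e / 2) (c e (Inf T)) x - ramp (e / 2) (c e (Sup T)) x"
          by (auto simp: abs_mult \<sigma>_def sgn_if)
      qed
      also have "\<dots> = ramp (e / 2) (c e a) x - ramp (e / 2) (c e b) x"
        using division_telescope[OF D, of "\<lambda>y. - ramp (e / 2) (c e y) x"] ab by simp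
      also have "\<dots> \<le> 1" using ramp_bounds[of "e / 2"] by (smt (verit))
      finally show ?thesis .
    qed
    moreover have "v absolutely_integrable_on {a<..<b}"
      using v by (simp add: absolutely_integrable_on_Icc_iff_Ioo)
    ultimately have "ereal (integral {a<..<b} (\<lambda>x. v x * deriv \<phi> x)) \<le> total_variation {a<..<b} v"
      using C1(1) by (intro total_variation_geI) auto
    also have "integral {a<..<b} (\<lambda>x. v x * deriv \<phi> x) = integral {a..b}
        (\<lambda>x. \<Sum>T\<in>\<D>. \<sigma> T * (v x * bump (e / 2) (c e (Inf T)) x - v x * bump (e / 2) (c e (Sup T)) x))"
      unfolding C1(2) integral_open_interval_real \<phi>'_def sum_distrib_left
      by (intro integral_cong sum.cong) (simp_all add: algebra_simps)
    also have "\<dots> = (\<Sum>T\<in>\<D>. \<sigma> T * (B e (Inf T) - B e (Sup T)))"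
      using Bi[OF e] ys finD unfolding B_def
      by (subst integral_sum) (auto simp: integral_diff intro!: integrable_diff integrable_on_cmult_left[where 'b = real, simplified] sum.cong)
    finally show ?thesis .
  qed
  have "((\<lambda>e. ereal (\<Sum>T\<in>\<D>. \<sigma> T * (B e (Inf T) - B e (Sup T))))
      \<longlongrightarrow> ereal (\<Sum>T\<in>\<D>. \<sigma> T * (f (Inf T) - f (Sup T)))) (at_right 0)"
  proof (intro tendsto_intros Blim)
    fix T assume "T \<in> \<D>"
    from E[OF this] show "Inf T \<in> {a..b}" "Sup T \<in> {a..b}" by auto
  qed
  moreover have "\<forall>\<^sub>F e in at_right 0. ereal (\<Sum>T\<in>\<D>. \<sigma> T * (B e (Inf T) - B e (Sup T))) \<le> total_variation {a<..<b} v"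
    unfolding eventually_at_right_field using le ab by (intro exI[of _ "(b - a) / 2"]) auto
  ultimately have "ereal (\<Sum>T\<in>\<D>. \<sigma> T * (f (Inf T) - f (Sup T))) \<le> total_variation {a<..<b} v"
    by (rule tendsto_upperbound) simp
  moreover have "\<sigma> T * (f (Inf T) - f (Sup T)) = \<bar>f (Sup T) - f (Inf T)\<bar>" for T
    by (simp add: \<sigma>_def sgn_if)
  ultimately show ?thesis by simp
qed

text \<open>Integration by parts on each interval; the boundary terms telescope and vanish because test
  functions have compact support in the open interval.\<close>
lemma total_variation_piecewise_affine_le:
  assumes ab: "a < b" and v: "continuous_on {a..b} v" and D: "\<D> division_of {a..b}"
    and aff: "\<And>T. T \<in> \<D> \<Longrightarrow> \<exists>m k. \<forall>x\<in>T. v x = m * x + k"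
  shows "total_variation {a<..<b} v \<le> ereal (\<Sum>T\<in>\<D>. \<bar>v (Sup T) - v (Inf T)\<bar>)"
proof (rule total_variation_leI)
  have vi: "v absolutely_integrable_on {a..b}"
    using v by (rule absolutely_integrable_continuous_real)
  then show "v absolutely_integrable_on {a<..<b}"
    by (simp add: absolutely_integrable_on_Icc_iff_Ioo)
  fix \<phi> assume \<phi>: "\<phi> \<in> C1c {a<..<b}" and le1: "\<And>x. \<bar>\<phi> x\<bar> \<le> 1"
  from \<phi> obtain K where K: "compact K" "K \<subseteq> {a<..<b}"
    "\<forall>x. x \<notin> K \<longrightarrow> \<phi> x = 0 \<and> deriv \<phi> x = 0"
    "\<forall>x. (\<phi> has_real_derivative deriv \<phi> x) (at x)" "continuous_on UNIV (deriv \<phi>)" "continuous_on UNIV \<phi>"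
    by (rule C1cE)
  have \<phi>0: "\<phi> a = 0" "\<phi> b = 0" using K(2,3) by auto
  have cont: "continuous_on A \<phi>" "continuous_on A (deriv \<phi>)" for A
    using K(5,6) continuous_on_subset by blast+
  have "integral {a<..<b} (\<lambda>x. v x * deriv \<phi> x) = integral {a..b} (\<lambda>x. v x * deriv \<phi> x)"
    by (simp add: integral_open_interval_real)
  also have "\<dots> = (\<Sum>T\<in>\<D>. integral T (\<lambda>x. v x * deriv \<phi> x))"
    using v cont by (intro integral_combine_division_topdown D integrable_continuous_real continuous_intros)
  also have "\<dots> \<le> (\<Sum>T\<in>\<D>. (v (Sup T) * \<phi> (Sup T) - v (Inf T) * \<phi> (Inf T)) + \<bar>v (Sup T) - v (Inf T)\<bar>)"
  proof (rule sum_mono)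
    fix T assume T: "T \<in> \<D>"
    define p q where "p = Inf T" and "q = Sup T"
    have pq: "T = {p..q}" "p \<le> q" using division_of_Icc_element[OF D T] by (auto simp: p_def q_def)
    from aff[OF T] obtain m k where mk: "\<forall>x\<in>T. v x = m * x + k" by blast
    have "((\<lambda>x. m * \<phi> x + (m * x + k) * deriv \<phi> x) has_integral
        ((m * q + k) * \<phi> q - (m * p + k) * \<phi> p)) {p..q}"
    proof (rule fundamental_theorem_of_calculus[OF pq(2)])
      fix x
      have "((\<lambda>x. (m * x + k) * \<phi> x) has_real_derivative m * \<phi> x + (m * x + k) * deriv \<phi> x) (at x)"
        using K(4) by (auto intro!: derivative_eq_intros)
      then show "((\<lambda>x. (m * x + k) * \<phi> x) has_vector_derivative m * \<phi> x + (m * x + k) * deriv \<phi> x) (at x within {p..q})"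
        by (simp add: has_real_derivative_iff_has_vector_derivative has_vector_derivative_at_within)
    qed
    then have 1: "integral {p..q} (\<lambda>x. m * \<phi> x + (m * x + k) * deriv \<phi> x) = v q * \<phi> q - v p * \<phi> p"
      using mk pq by (simp add: integral_unique)
    have "integral T (\<lambda>x. v x * deriv \<phi> x) = integral {p..q} (\<lambda>x. (m * x + k) * deriv \<phi> x)"
      unfolding pq(1) by (rule integral_cong) (use mk pq in auto)
    also have "\<dots> = integral {p..q} (\<lambda>x. m * \<phi> x + (m * x + k) * deriv \<phi> x) - integral {p..q} (\<lambda>x. m * \<phi> x)"
      by (subst integral_diff[symmetric])
        (auto intro!: integrable_continuous_real continuous_intros cont)
    finally have 2: "integral T (\<lambda>x. v x * deriv \<phi> x) = v q * \<phi> q - v p * \<phi> p - integral {p..q} (\<lambda>x. m * \<phi> x)"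
      unfolding 1 .
    have "norm (integral {p..q} (\<lambda>x. m * \<phi> x)) \<le> integral {p..q} (\<lambda>x. \<bar>m\<bar>)"
      using le1 by (intro integral_norm_bound_integral)
        (auto intro!: integrable_continuous_real continuous_intros cont simp: abs_mult mult_left_le)
    also have "\<dots> = \<bar>v q - v p\<bar>"
      using mk pq by (simp add: abs_mult flip: right_diff_distrib)
    finally show "integral T (\<lambda>x. v x * deriv \<phi> x)
        \<le> (v (Sup T) * \<phi> (Sup T) - v (Inf T) * \<phi> (Inf T)) + \<bar>v (Sup T) - v (Inf T)\<bar>"
      using 2 by (simp add: p_def q_def)
  qed
  also have "\<dots> = (\<Sum>T\<in>\<D>. \<bar>v (Sup T) - v (Inf T)\<bar>)"
    using division_telescope[OF D, of "\<lambda>x. v x * \<phi> x"] ab \<phi>0 by (simp add: sum.distrib)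
  finally show "integral {a<..<b} (\<lambda>x. v x * deriv \<phi> x) \<le> (\<Sum>T\<in>\<D>. \<bar>v (Sup T) - v (Inf T)\<bar>)" .
qed simp

section \<open>Piecewise affine interpolation\<close>

text \<open>At a node shared by two intervals the choice of the interval is arbitrary; both affine functions
  take the prescribed value there.\<close>
definition interpolant :: "real set set \<Rightarrow> (real \<Rightarrow> real) \<Rightarrow> real \<Rightarrow> real" where
  "interpolant \<D> f x = (let T = SOME T. T \<in> \<D> \<and> x \<in> T in affine_through f (Inf T) (Sup T) x)"

lemma affine_through_endpoints:
  "affine_through f p q p = f p" "p \<noteq> q \<Longrightarrow> affine_through f p q q = f q"
  by (simp_all add: affine_through_def)

lemma affine_through_dist:
  assumes "p < q" "x \<in> {p..q}" "\<bar>h p - c\<bar> \<le> e" "\<bar>h q - c\<bar> \<le> e"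
  shows "\<bar>affine_through h p q x - c\<bar> \<le> e"
proof -
  define t where "t = (x - p) / (q - p)"
  have t: "0 \<le> t" "t \<le> 1" using assms(1,2) by (auto simp: t_def field_simps)
  have "affine_through h p q x = h p + t * (h q - h p)"
    by (simp add: affine_through_def t_def)
  then have "affine_through h p q x - c = (1 - t) * (h p - c) + t * (h q - c)"
    by (simp add: algebra_simps)
  also have "\<bar>\<dots>\<bar> \<le> (1 - t) * \<bar>h p - c\<bar> + t * \<bar>h q - c\<bar>"
    using t abs_triangle_ineq[of "(1 - t) * (h p - c)" "t * (h q - c)"] by (simp add: abs_mult)
  also have "\<dots> \<le> (1 - t) * e + t * e"
    using t assms(3,4) by (intro add_mono mult_left_mono) auto
  finally show ?thesis by (simp add: algebra_simps)
qed

text \<open>Two different nondegenerate intervals of a division can only share an endpoint.\<close>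
lemma interpolant_eq:
  assumes D: "\<D> division_of {a..b}" and nd: "\<And>T. T \<in> \<D> \<Longrightarrow> Inf T < Sup T"
    and T: "T \<in> \<D>" "x \<in> T"
  shows "interpolant \<D> f x = affine_through f (Inf T) (Sup T) x"
proof -
  define R where "R = (SOME T. T \<in> \<D> \<and> x \<in> T)"
  have R: "R \<in> \<D>" "x \<in> R" using someI[of "\<lambda>T. T \<in> \<D> \<and> x \<in> T" T] T by (auto simp: R_def)
  have "affine_through f (Inf R) (Sup R) x = affine_through f (Inf T) (Sup T) x"
  proof (cases "R = T")
    case False
    from division_ofD(5)[OF D R(1) T(1) False] have "interior R \<inter> interior T = {}" .
    moreover obtain r s where rs: "R = {r..s}" "r \<le> s" "Inf R = r" "Sup R = s" "a \<le> r" "s \<le> b"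
      using D R(1) by (rule division_of_Icc_elementE)
    moreover obtain p q where pq: "T = {p..q}" "p \<le> q" "Inf T = p" "Sup T = q" "a \<le> p" "q \<le> b"
      using D T(1) by (rule division_of_Icc_elementE)
    ultimately have e: "{max r p<..<min s q} = {}" by auto
    have "min s q \<le> max r p"
    proof (rule ccontr)
      assume "\<not> min s q \<le> max r p"
      then have "max r p < min s q" by (simp only: not_le)
      from dense[OF this] obtain z where "max r p < z" "z < min s q" by blast
      then have "z \<in> {max r p<..<min s q}" by (simp only: greaterThanLessThan_iff)
      with e show False by blast
    qed
    then have "(x = r \<and> x = q) \<or> (x = s \<and> x = p)"
      using nd[OF R(1)] nd[OF T(1)] R(2) T(2) rs pq by (auto simp: min_def max_def split: if_splits)
    then show ?thesis
      using nd[OF R(1)] nd[OF T(1)] rs(3,4) pq(3,4) affine_through_endpoints[where f = f] by auto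
  qed simp
  then show ?thesis by (simp add: interpolant_def R_def Let_def)
qed

lemma interpolant_endpoints:
  assumes "\<D> division_of {a..b}" "\<And>T. T \<in> \<D> \<Longrightarrow> Inf T < Sup T" "T \<in> \<D>"
  shows "interpolant \<D> f (Inf T) = f (Inf T)" "interpolant \<D> f (Sup T) = f (Sup T)"
proof -
  obtain p q where "T = {p..q}" "p \<le> q" "Inf T = p" "Sup T = q" "a \<le> p" "q \<le> b"
    using assms(1,3) by (rule division_of_Icc_elementE)
  then have "Inf T \<in> T" "Sup T \<in> T" by auto
  then show "interpolant \<D> f (Inf T) = f (Inf T)" "interpolant \<D> f (Sup T) = f (Sup T)"
    using assms(2)[OF assms(3)] interpolant_eq[OF assms] by (simp_all add: affine_through_endpoints)
qed

lemma interpolant_affine: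
  assumes "\<D> division_of {a..b}" "\<And>T. T \<in> \<D> \<Longrightarrow> Inf T < Sup T" "T \<in> \<D>"
  shows "\<exists>m k. \<forall>x\<in>T. interpolant \<D> f x = m * x + k"
proof (intro exI ballI)
  fix x assume "x \<in> T"
  from interpolant_eq[OF assms this]
  show "interpolant \<D> f x = (f (Sup T) - f (Inf T)) / (Sup T - Inf T) * x
    + (f (Inf T) - (f (Sup T) - f (Inf T)) / (Sup T - Inf T) * Inf T)"
    by (simp add: affine_through_def right_diff_distrib)
qed

lemma continuous_on_piecewise_affine:
  assumes D: "\<D> division_of {a..b::real}"
    and aff: "\<And>T. T \<in> \<D> \<Longrightarrow> \<exists>m k. \<forall>x\<in>T. v x = m * x + (k::real)"
  shows "continuous_on {a..b} v"
proof -
  have "continuous_on (\<Union>T\<in>\<D>. T) v"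
  proof (rule continuous_on_closed_Union)
    show "finite \<D>" using D by (rule division_of_finite)
    fix T assume T: "T \<in> \<D>"
    from D T show "closed T"
      by (rule division_of_Icc_elementE) simp
    from aff[OF T] obtain m k where "\<forall>x\<in>T. v x = m * x + k" by blast
    then show "continuous_on T v"
      by (subst continuous_on_cong[OF refl, of _ _ "\<lambda>x. m * x + k"]) (auto intro!: continuous_intros)
  qed
  then show ?thesis using division_ofD(6)[OF D] by simp
qed

section \<open>The left-continuous representative and its interpolation error\<close>

text \<open>For a piecewise regular function this representative is left-continuous on \<open>{a<..}\<close> and
  right-continuous at \<open>a\<close>. One-sided limits are taken also at the jumps, so that the increments are
  controlled by the total variation, and at the ends of the interval, where they are the traces.\<close>
definition good_rep :: "real \<Rightarrow> (real \<Rightarrow> real) \<Rightarrow> real \<Rightarrow> real" where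
  "good_rep a v z = (if z \<le> a then SOME l. approx_right v z l else SOME l. approx_left v z l)"

locale piecewise_W21_function =
  fixes a b :: real and u :: "real \<Rightarrow> real"
  assumes ab: "a < b" and u: "u \<in> piecewise_W21 {a<..<b}" and ui: "u absolutely_integrable_on {a..b}"
begin

abbreviation jumps :: "real set" where "jumps \<equiv> jump_set {a<..<b} u"

abbreviation f :: "real \<Rightarrow> real" where "f \<equiv> good_rep a u"

abbreviation second_deriv :: "real \<Rightarrow> real" where
  "second_deriv \<equiv> weak_deriv ({a<..<b} - jumps) (weak_deriv ({a<..<b} - jumps) u)"

lemma finite_jumps: "finite jumps"
  using u by (simp add: piecewise_W21_def)

lemma open_complement_jumps: "open ({a<..<b} - jumps)"
  using finite_jumps by (simp add: finite_imp_closed open_Diff)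

lemma integrable_sub: "a \<le> s \<Longrightarrow> t \<le> b \<Longrightarrow> u absolutely_integrable_on {s..t}"
  by (rule absolutely_integrable_on_subinterval[OF ui]) auto

lemma smooth_representative:
  assumes st: "s < t" "{s<..<t} \<subseteq> {a<..<b} - jumps"
  obtains v' v'' W W' where
    "has_weak_deriv {s<..<t} u v'" "has_weak_deriv {s<..<t} v' v''"
    "u absolutely_integrable_on {s..t}" "v' absolutely_integrable_on {s..t}" "v'' absolutely_integrable_on {s..t}"
    "negligible {x \<in> {s<..<t}. u x \<noteq> W x}"
    "\<forall>x\<in>{s..t}. (W has_real_derivative W' x) (at x within {s..t})"
    "\<forall>x\<in>{s..t}. W' x = W' s + integral {s..x} v''"
    "continuous_on {s..t} W"
    "\<forall>z\<in>{s<..t}. approx_left u z (W z)" "\<forall>z\<in>{s..<t}. approx_right u z (W z)"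
proof -
  obtain v' v'' W W' where R:
    "has_weak_deriv {s<..<t} u v'" "has_weak_deriv {s<..<t} v' v''"
    "u absolutely_integrable_on {s..t}" "v' absolutely_integrable_on {s..t}" "v'' absolutely_integrable_on {s..t}"
    "negligible {x \<in> {s<..<t}. u x \<noteq> W x}"
    and D: "\<And>x. x \<in> {s..t} \<Longrightarrow> (W has_real_derivative W' x) (at x within {s..t})"
    "\<And>x. x \<in> {s..t} \<Longrightarrow> W' x = W' s + integral {s..x} v''"
    using W21_representative[OF piecewise_W21_imp_W21[OF u st(2)] st(1)] by blast
  have c: "continuous_on {s..t} W"
    using D(1) DERIV_continuous_on by blast
  show ?thesis
    using that[OF R _ _ c] D approx_limits_of_continuous[OF R(3,6) c] by blast
qed

text \<open>Punctured neighbourhoods without jumps exist because there are only finitely many jumps; hence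
  all one-sided approximate limits exist.\<close>
lemma jump_free_gap:
  assumes "z \<in> {a..b}"
  obtains d where "d > 0" "\<And>x. x \<in> {a<..<b} \<Longrightarrow> \<bar>x - z\<bar> < d \<Longrightarrow> x \<noteq> z \<Longrightarrow> x \<notin> jumps"
proof -
  obtain d where "d > 0" "\<forall>x\<in>jumps. x \<noteq> z \<longrightarrow> d \<le> dist z x"
    using finite_set_avoid[OF finite_jumps, of z] by blast
  then show ?thesis using that[of d] by (force simp: dist_real_def)
qed

lemma approx_left_f: "approx_left u z (f z)" if z: "z \<in> {a<..b}"
proof -
  obtain d where d: "d > 0" "\<And>x. x \<in> {a<..<b} \<Longrightarrow> \<bar>x - z\<bar> < d \<Longrightarrow> x \<noteq> z \<Longrightarrow> x \<notin> jumps"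
    using jump_free_gap[of z] z by auto
  have "{max a (z - d)<..<z} \<subseteq> {a<..<b} - jumps" "max a (z - d) < z"
    using d z by auto
  then obtain W where "\<forall>y\<in>{max a (z - d)<..z}. approx_left u y (W y)"
    using smooth_representative[of "max a (z - d)" z] by metis
  then have "\<exists>l. approx_left u z l" using \<open>max a (z - d) < z\<close> by fastforce
  then show ?thesis using z someI_ex[of "approx_left u z"] by (simp add: good_rep_def)
qed

lemma approx_right_f: "approx_right u a (f a)"
proof -
  obtain d where d: "d > 0" "\<And>x. x \<in> {a<..<b} \<Longrightarrow> \<bar>x - a\<bar> < d \<Longrightarrow> x \<noteq> a \<Longrightarrow> x \<notin> jumps"
    using jump_free_gap[of a] ab by auto
  have "{a<..<min b (a + d)} \<subseteq> {a<..<b} - jumps" "a < min b (a + d)"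
    using d ab by auto
  then obtain W where "\<forall>y\<in>{a..<min b (a + d)}. approx_right u y (W y)"
    using smooth_representative[of a "min b (a + d)"] by metis
  then have "\<exists>l. approx_right u a l" using \<open>a < min b (a + d)\<close> by fastforce
  then show ?thesis using someI_ex[of "approx_right u a"] by (simp add: good_rep_def)
qed

lemma f_eqI_left: "z \<in> {a<..b} \<Longrightarrow> approx_left u z l \<Longrightarrow> f z = l"
  using approx_left_unique[where v = u and a = a and z = z] approx_left_f integrable_sub[of a z] by auto

text \<open>At an interior point this is the definition of the jump set: outside of it the left and the right
  approximate limits, both of which exist, are equal.\<close>
lemma f_eqI_right:
  assumes "z \<in> {a..<b}" "z \<notin> jumps" "approx_right u z l"
  shows "f z = l"
proof (cases "z = a")
  case True
  then show ?thesis using approx_right_unique[OF ui ab approx_right_f] assms(3) by simp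
next
  case False
  then have z: "z \<in> {a<..<b}" using assms(1) by simp
  have "approx_limit ({a<..<b} \<inter> {..<z}) u z (f z)"
    using approx_limit_iff_approx_left[OF ui, of z] approx_left_f[of z] z by simp
  moreover have "approx_limit ({a<..<b} \<inter> {z<..}) u z l"
    using approx_limit_iff_approx_right[OF ui, of z] assms(3) z by simp
  ultimately show ?thesis using assms(2) z unfolding jump_set_def by blast
qed

text \<open>At a right Lebesgue point that is not a jump, the value of \<open>u\<close> is the right approximate limit and
  therefore also the left one.\<close>
lemma f_AE: "negligible {x \<in> {a..b}. u x \<noteq> f x}"
proof -
  let ?N = "{x \<in> {a<..<b}. \<not> right_lebesgue_point u x} \<union> jumps \<union> {a, b}"
  have "negligible ?N"
    using right_lebesgue_points_interval[OF ui] finite_jumps by (simp add: negligible_finite)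
  moreover have "{x \<in> {a..b}. u x \<noteq> f x} \<subseteq> ?N"
    using f_eqI_right by fastforce
  ultimately show ?thesis by (rule negligible_subset)
qed

lemma f_eq_representative:
  assumes "{s<..<t} \<subseteq> {a<..<b} - jumps" "s < t"
    and W: "\<forall>z\<in>{s<..t}. approx_left u z (W z)" "\<forall>z\<in>{s..<t}. approx_right u z (W z)"
    and x: "x \<in> {s<..t} \<or> x = s \<and> s \<notin> jumps"
  shows "f x = W x"
proof -
  have "a \<le> s" "t \<le> b"
    using assms(1,2) greaterThanLessThan_subseteq_greaterThanLessThan[of s t a b] by auto
  then show ?thesis
    using x f_eqI_left[of x "W x"] f_eqI_right[of x "W x"] W assms(2) ab by auto
qed

lemma isCont_f:
  assumes "z \<in> {a<..<b} - jumps"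
  shows "isCont f z"
proof -
  obtain e where e: "e > 0" "cball z e \<subseteq> {a<..<b} - jumps"
    using assms open_complement_jumps open_contains_cball by blast
  then have sub: "{z - e<..<z + e} \<subseteq> {a<..<b} - jumps"
    by (auto simp: subset_iff dist_real_def)
  have "z - e < z + e" using e by simp
  from smooth_representative[OF this sub] obtain W where W: "continuous_on {z - e..z + e} W"
    "\<forall>y\<in>{z - e<..z + e}. approx_left u y (W y)" "\<forall>y\<in>{z - e..<z + e}. approx_right u y (W y)"
    by metis
  have cW: "continuous_on {z - e<..<z + e} W"
    by (rule continuous_on_subset[OF W(1)]) auto
  have "continuous_on {z - e<..<z + e} f"
    using cW f_eq_representative[OF sub \<open>z - e < z + e\<close> W(2,3)]
    by (subst continuous_on_cong[OF refl, of _ _ W]) auto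
  then show ?thesis
    using e(1) by (auto simp: continuous_on_eq_continuous_at)
qed

lemma second_deriv_integrable: "second_deriv absolutely_integrable_on {a..b}"
  using piecewise_W21_weak_derivs(3)[OF u]
proof (rule absolutely_integrable_spike_set)
  show "negligible {x \<in> ({a<..<b} - jumps) - {a..b}. second_deriv x \<noteq> 0}"
    by (rule negligible_subset[of "{}"]) auto
  show "negligible {x \<in> {a..b} - ({a<..<b} - jumps). second_deriv x \<noteq> 0}"
    by (rule negligible_subset[of "jumps \<union> {a, b}"]) (auto simp: negligible_finite finite_jumps)
qed

lemma L1_norm_second_deriv:
  "L1_norm ({a<..<b} - jumps) second_deriv = integral {a..b} (\<lambda>x. \<bar>second_deriv x\<bar>)"
proof -
  have S: "{a<..<b} - jumps \<in> sets lebesgue" using open_complement_jumps by simp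
  have "(\<lambda>x. \<bar>second_deriv x\<bar>) absolutely_integrable_on ({a<..<b} - jumps)"
    using piecewise_W21_weak_derivs(3)[OF u] by (rule set_integrable_abs)
  then have "L1_norm ({a<..<b} - jumps) second_deriv = integral ({a<..<b} - jumps) (\<lambda>x. \<bar>second_deriv x\<bar>)"
    unfolding L1_norm_def by (rule LINT_lebesgue_on_eq_integral[OF S])
  also have "\<dots> = integral {a..b} (\<lambda>x. \<bar>second_deriv x\<bar>)"
  proof (rule integral_spike_set)
    show "negligible {x \<in> ({a<..<b} - jumps) - {a..b}. \<bar>second_deriv x\<bar> \<noteq> 0}"
      by (rule negligible_subset[of "{}"]) auto
    show "negligible {x \<in> {a..b} - ({a<..<b} - jumps). \<bar>second_deriv x\<bar> \<noteq> 0}"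
      by (rule negligible_subset[of "jumps \<union> {a, b}"]) (auto simp: negligible_finite finite_jumps)
  qed
  finally show ?thesis .
qed

text \<open>At \<open>p\<close> the value of \<open>f\<close> is the limit from the left, outside of the interval. It is also the
  limit from the right because \<open>p\<close> is not a jump; hence \<open>f\<close> agrees on the closed interval
  with a function to which the interpolation estimate applies.\<close>
lemma second_order_error:
  assumes pq: "p < q" "{p<..<q} \<subseteq> {a<..<b} - jumps" "p \<notin> jumps" and x: "x \<in> {p..q}"
  shows "\<bar>f x - affine_through f p q x\<bar> \<le> (q - p) * integral {p..q} (\<lambda>x. \<bar>second_deriv x\<bar>)"
proof -
  let ?S = "{a<..<b} - jumps" and ?I = "{p<..<q}"
  obtain v' v'' W W' where R:
    "has_weak_deriv {p<..<q} u v'" "has_weak_deriv {p<..<q} v' v''"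
    "u absolutely_integrable_on {p..q}" "v' absolutely_integrable_on {p..q}" "v'' absolutely_integrable_on {p..q}"
    "negligible {x \<in> {p<..<q}. u x \<noteq> W x}"
    "\<forall>x\<in>{p..q}. (W has_real_derivative W' x) (at x within {p..q})"
    "\<forall>x\<in>{p..q}. W' x = W' p + integral {p..x} v''"
    "continuous_on {p..q} W"
    "\<forall>z\<in>{p<..q}. approx_left u z (W z)" "\<forall>z\<in>{p..<q}. approx_right u z (W z)"
    using pq(1,2) by (rule smooth_representative)
  have I: "?I \<in> sets lebesgue" "open ?I" and S: "?S \<in> sets lebesgue"
    using open_complement_jumps by auto
  have w1: "has_weak_deriv ?I u (weak_deriv ?S u)" and w2: "has_weak_deriv ?I (weak_deriv ?S u) second_deriv"
    using piecewise_W21_weak_derivs(1,2)[OF u] has_weak_deriv_restrict[OF _ S I(1) pq(2)] by auto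
  have "has_weak_deriv ?I (weak_deriv ?S u) v''"
    by (rule has_weak_deriv_cong_AE[OF R(2) I(1) weak_deriv_unique[OF R(1) w1 I(2)]]) simp
  from weak_deriv_unique[OF this w2 I(2)] have "negligible {x \<in> ?I. v'' x \<noteq> second_deriv x}" .
  then have N: "negligible ({x \<in> ?I. v'' x \<noteq> second_deriv x} \<union> {p, q})" by simp
  have "integral {p..q} (\<lambda>x. \<bar>v'' x\<bar>) = integral {p..q} (\<lambda>x. \<bar>second_deriv x\<bar>)"
    by (rule integral_spike[OF N]) auto
  moreover have "f y = W y" if "y \<in> {p..q}" for y
    using f_eq_representative[OF pq(2,1) R(10,11), of y] that pq(3) by (cases "y = p") auto
  then have "f x = W x" "affine_through f p q x = affine_through W p q x"
    using x by (auto simp: affine_through_def)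
  moreover have "\<bar>W x - affine_through W p q x\<bar> \<le> (q - p) * integral {p..q} (\<lambda>x. \<bar>v'' x\<bar>)"
    by (rule affine_interpolation_error[OF R(7)[rule_format] R(8)[rule_format] R(5) order_refl pq(1) order_refl x])
  ultimately show ?thesis by simp
qed

lemma variation_le:
  assumes "\<D> division_of {a..b}"
  shows "ereal (\<Sum>T\<in>\<D>. \<bar>f (Sup T) - f (Inf T)\<bar>) \<le> total_variation {a<..<b} u"
  using total_variation_ge_division[OF ui ab assms approx_right_f approx_left_f] .

text \<open>The interval between the two points extends to a division of the whole interval.\<close>
lemma oscillation_le:
  assumes "x \<in> {a..b}" "y \<in> {a..b}"
  shows "ereal \<bar>f x - f y\<bar> \<le> total_variation {a<..<b} u"
proof -
  have *: "ereal \<bar>f y - f x\<bar> \<le> total_variation {a<..<b} u" if "a \<le> x" "x < y" "y \<le> b" for x y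
  proof -
    have "{cbox x y} division_of \<Union>{cbox x y}"
      using that(2) by (intro division_of_self[THEN division_of_union_self]) simp
    moreover have "\<Union>{cbox x y} \<subseteq> cbox a b" using that by simp
    ultimately obtain \<D> where "{cbox x y} \<subseteq> \<D>" "\<D> division_of cbox a b"
      by (rule partial_division_extend_interval)
    then have D: "{{x..y}} \<subseteq> \<D>" "\<D> division_of {a..b}" by simp_all
    have "\<bar>f y - f x\<bar> = (\<Sum>T\<in>{{x..y}}. \<bar>f (Sup T) - f (Inf T)\<bar>)" using that by simp
    also have "\<dots> \<le> (\<Sum>T\<in>\<D>. \<bar>f (Sup T) - f (Inf T)\<bar>)"
      using D by (intro sum_mono2 division_of_finite) auto
    finally show ?thesis
      using order_trans[OF _ variation_le[OF D(2)]] by simp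
  qed
  consider "x < y" | "x = y" | "y < x" by linarith
  then show ?thesis
    using *[of x y] *[of y x] assms total_variation_nonneg[of "{a<..<b}" u]
    by cases (auto simp: abs_minus_commute zero_ereal_def)
qed

lemma f_integrable: "f absolutely_integrable_on {a..b}"
  by (rule absolutely_integrable_spike[OF ui f_AE]) auto

text \<open>On a cell with a jump at its left end both \<open>f\<close> and its interpolant stay within the total
  variation \<open>V\<close> of each other; on every other cell the second-order estimate applies. The bounds for
  the lengths of the two kinds of cells are separate parameters because the grading makes the first
  kind much shorter.\<close>
lemma interpolation_L1_error:
  assumes D: "\<D> division_of {a..b}" and nd: "\<And>T. T \<in> \<D> \<Longrightarrow> Inf T < Sup T"
    and free: "\<And>T. T \<in> \<D> \<Longrightarrow> {Inf T<..<Sup T} \<inter> jumps = {}"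
    and TV: "total_variation {a<..<b} u = ereal V"
    and m: "\<And>T. T \<in> \<D> \<Longrightarrow> Inf T \<notin> jumps \<Longrightarrow> Sup T - Inf T \<le> m" "m \<ge> 0"
    and \<mu>: "\<And>T. T \<in> \<D> \<Longrightarrow> Inf T \<in> jumps \<Longrightarrow> Sup T - Inf T \<le> \<mu>" "\<mu> \<ge> 0"
    and n: "card {T \<in> \<D>. Inf T \<in> jumps} \<le> n"
  shows "integral {a..b} (\<lambda>x. \<bar>f x - interpolant \<D> f x\<bar>)
    \<le> real n * \<mu> * V + m\<^sup>2 * integral {a..b} (\<lambda>x. \<bar>second_deriv x\<bar>)"
proof -
  have finD: "finite \<D>" using D by (rule division_of_finite)
  have V0: "V \<ge> 0" using total_variation_nonneg[of "{a<..<b}" u] TV by simp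
  have dist: "\<bar>f x - f y\<bar> \<le> V" if "x \<in> {a..b}" "y \<in> {a..b}" for x y
    using oscillation_le[OF that] TV by simp
  have w: "(\<lambda>x. \<bar>second_deriv x\<bar>) integrable_on {a..b}"
    using second_deriv_integrable by (simp add: absolutely_integrable_on_def)
  have "interpolant \<D> f absolutely_integrable_on {a..b}"
    by (intro absolutely_integrable_continuous_real continuous_on_piecewise_affine[OF D] interpolant_affine[OF D nd])
  then have "(\<lambda>x. f x - interpolant \<D> f x) absolutely_integrable_on {a..b}"
    using f_integrable by (rule set_integral_diff(1)[rotated])
  then have i: "(\<lambda>x. \<bar>f x - interpolant \<D> f x\<bar>) integrable_on {a..b}"
    by (simp add: absolutely_integrable_on_def)
  define E where "E T = (if Inf T \<in> jumps then \<mu> * V else m\<^sup>2 * integral T (\<lambda>x. \<bar>second_deriv x\<bar>))" for T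
  have loc: "integral T (\<lambda>x. \<bar>f x - interpolant \<D> f x\<bar>) \<le> E T" if T: "T \<in> \<D>" for T
  proof -
    obtain p q where pq: "T = {p..q}" "p \<le> q" "Inf T = p" "Sup T = q" "a \<le> p" "q \<le> b"
      using D T by (rule division_of_Icc_elementE)
    have "p < q" using nd[OF T] pq(3,4) by simp
    have sub: "{p..q} \<subseteq> {a..b}" using pq by auto
    have eq: "interpolant \<D> f x = affine_through f p q x" if "x \<in> {p..q}" for x
      using interpolant_eq[OF D nd T] that pq by simp
    have bound: "integral T (\<lambda>x. \<bar>f x - interpolant \<D> f x\<bar>) \<le> c * (q - p)"
      if "\<And>x. x \<in> {p..q} \<Longrightarrow> \<bar>f x - affine_through f p q x\<bar> \<le> c" for c
    proof -
      have "integral {p..q} (\<lambda>x. \<bar>f x - interpolant \<D> f x\<bar>) \<le> integral {p..q} (\<lambda>_. c)"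
        using integrable_on_subinterval[OF i sub] that eq by (intro integral_le) auto
      then show ?thesis using pq by (simp add: mult.commute)
    qed
    show ?thesis
    proof (cases "p \<in> jumps")
      case True
      have "\<bar>f x - affine_through f p q x\<bar> \<le> V" if x: "x \<in> {p..q}" for x
        using affine_through_dist[OF \<open>p < q\<close> x, of f "f x" V] dist sub x \<open>p \<le> q\<close>
        by (auto simp: abs_minus_commute)
      then have "integral T (\<lambda>x. \<bar>f x - interpolant \<D> f x\<bar>) \<le> V * (q - p)" by (rule bound)
      also have "\<dots> \<le> \<mu> * V"
        using \<mu>(1)[OF T] True pq V0 by (simp add: mult.commute mult_left_mono)
      finally show ?thesis using True pq by (simp add: E_def)
    next
      case False
      let ?w = "integral {p..q} (\<lambda>x. \<bar>second_deriv x\<bar>)"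
      have free': "{p<..<q} \<subseteq> {a<..<b} - jumps" using free[OF T] pq by auto
      have w0: "?w \<ge> 0" using integrable_on_subinterval[OF w sub] by (intro integral_nonneg) auto
      have "integral T (\<lambda>x. \<bar>f x - interpolant \<D> f x\<bar>) \<le> ((q - p) * ?w) * (q - p)"
        using second_order_error[OF \<open>p < q\<close> free' False] by (rule bound)
      also have "\<dots> = (q - p)\<^sup>2 * ?w" by (simp add: power2_eq_square)
      also have "\<dots> \<le> m\<^sup>2 * ?w"
        using m(1)[OF T] False pq w0 \<open>p < q\<close> by (intro mult_right_mono power_mono) auto
      finally show ?thesis using False pq by (simp add: E_def)
    qed
  qed
  let ?B = "{T \<in> \<D>. Inf T \<in> jumps}"
  have wT: "integral T (\<lambda>x. \<bar>second_deriv x\<bar>) \<ge> 0" if "T \<in> \<D>" for T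
    using D that
  proof (rule division_of_Icc_elementE)
    fix p q assume "T = {p..q}" "a \<le> p" "q \<le> b"
    then show ?thesis by (auto intro!: integral_nonneg integrable_on_subinterval[OF w])
  qed
  have "integral {a..b} (\<lambda>x. \<bar>f x - interpolant \<D> f x\<bar>) = (\<Sum>T\<in>\<D>. integral T (\<lambda>x. \<bar>f x - interpolant \<D> f x\<bar>))"
    using i D by (rule integral_combine_division_topdown)
  also have "\<dots> \<le> (\<Sum>T\<in>\<D>. E T)" using loc by (rule sum_mono)
  also have "\<dots> = (\<Sum>T\<in>?B. \<mu> * V) + (\<Sum>T\<in>\<D> - ?B. m\<^sup>2 * integral T (\<lambda>x. \<bar>second_deriv x\<bar>))"
    using finD by (subst sum.subset_diff[of ?B]) (auto simp: E_def add.commute intro!: arg_cong2[where f = "(+)"] sum.cong)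
  also have "(\<Sum>T\<in>?B. \<mu> * V) \<le> real n * \<mu> * V"
    using n \<mu>(2) V0 by (simp add: mult.assoc mult_right_mono)
  also have "(\<Sum>T\<in>\<D> - ?B. m\<^sup>2 * integral T (\<lambda>x. \<bar>second_deriv x\<bar>)) \<le> (\<Sum>T\<in>\<D>. m\<^sup>2 * integral T (\<lambda>x. \<bar>second_deriv x\<bar>))"
    using wT finD by (intro sum_mono2) auto
  also have "\<dots> = m\<^sup>2 * integral {a..b} (\<lambda>x. \<bar>second_deriv x\<bar>)"
    using integral_combine_division_topdown[OF w D] by (simp add: sum_distrib_left)
  finally show ?thesis by simp
qed

end

section \<open>Graded divisions\<close>

lemma graded_node_0: "graded_node \<beta> J 0 = 0"
  by (simp add: graded_node_def)

lemma graded_node_last: "J \<ge> 1 \<Longrightarrow> graded_node \<beta> J J = 1"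
  by (simp add: graded_node_def)

lemma graded_node_1: "graded_node \<beta> J 1 = (1 / real J) powr \<beta>"
  by (simp add: graded_node_def)

lemma graded_node_strict_mono:
  assumes "\<beta> > 0" "J \<ge> 1" "i < j"
  shows "graded_node \<beta> J i < graded_node \<beta> J j"
  unfolding graded_node_def using assms by (intro powr_less_mono2) (auto simp: divide_strict_right_mono)

text \<open>On the unit interval the derivative of \<open>z powr \<beta>\<close> is at most \<open>\<beta>\<close>.\<close>
lemma powr_diff_le:
  fixes x y \<beta> :: real
  assumes "0 \<le> x" "x < y" "y \<le> 1" "\<beta> \<ge> 1"
  shows "y powr \<beta> - x powr \<beta> \<le> \<beta> * (y - x)"
proof -
  have "continuous_on {x..y} (\<lambda>z. z powr \<beta>)"
    using assms by (intro continuous_on_powr' continuous_intros) auto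
  moreover have D: "((\<lambda>z. z powr \<beta>) has_real_derivative \<beta> * z powr (\<beta> - 1)) (at z)" if "x < z" "z < y" for z
    using that assms by (intro has_real_derivative_powr) auto
  ultimately obtain l z where z: "x < z" "z < y" "((\<lambda>z. z powr \<beta>) has_real_derivative l) (at z)"
    "y powr \<beta> - x powr \<beta> = (y - x) * l"
    using MVT[of x y "\<lambda>z. z powr \<beta>"] assms real_differentiable_def by metis
  have "l = \<beta> * z powr (\<beta> - 1)" using DERIV_unique[OF z(3) D[OF z(1,2)]] .
  also have "\<dots> \<le> \<beta> * 1"
    using assms z powr_mono2[of "\<beta> - 1" z 1] by (intro mult_left_mono) auto
  finally have "(y - x) * l \<le> (y - x) * \<beta>" using assms(2) by (intro mult_left_mono) auto
  then show ?thesis using z(4) by (simp add: mult.commute)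
qed

lemma graded_node_step:
  assumes "\<beta> \<ge> 1" "J \<ge> 1" "j < J"
  shows "graded_node \<beta> J (Suc j) - graded_node \<beta> J j \<le> \<beta> / real J"
proof -
  have "real (Suc j) / real J - real j / real J = 1 / real J"
    by (simp add: diff_divide_distrib[symmetric])
  with powr_diff_le[of "real j / real J" "real (Suc j) / real J" \<beta>] assms show ?thesis
    unfolding graded_node_def by (simp add: divide_strict_right_mono)
qed

lemma between_consecutive_nodes:
  fixes \<xi> :: "nat \<Rightarrow> real"
  assumes "n > 0" "\<xi> 0 \<le> s" "s \<le> \<xi> n"
  shows "\<exists>j<n. \<xi> j \<le> s \<and> s \<le> \<xi> (Suc j)"
  using assms
proof (induction n)
  case (Suc n)
  show ?case
  proof (cases "n > 0 \<and> s \<le> \<xi> n")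
    case True
    with Suc obtain j where "j < n" "\<xi> j \<le> s" "s \<le> \<xi> (Suc j)" by blast
    then show ?thesis by (intro exI[of _ j]) auto
  next
    case False
    with Suc.prems show ?thesis by (intro exI[of _ n]) (cases "n = 0", auto)
  qed
qed simp

text \<open>The direction is free: for \<open>q < p\<close> the cells are numbered from right to left.\<close>
definition cell :: "(nat \<Rightarrow> real) \<Rightarrow> real \<Rightarrow> real \<Rightarrow> nat \<Rightarrow> real set" where
  "cell \<xi> p q j = closed_segment (p + \<xi> j * (q - p)) (p + \<xi> (Suc j) * (q - p))"

lemma cell_eq:
  assumes "\<xi> j < \<xi> (Suc j)" "p \<noteq> q"
  shows "cell \<xi> p q j = (if p < q then {p + \<xi> j * (q - p)..p + \<xi> (Suc j) * (q - p)}
     else {p + \<xi> (Suc j) * (q - p)..p + \<xi> j * (q - p)})"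
  using assms unfolding cell_def closed_segment_eq_real_ivl by (auto simp: mult_le_cancel_right)

lemma cell_bounds:
  assumes "\<xi> j < \<xi> (Suc j)" "p \<noteq> q"
  shows "Inf (cell \<xi> p q j) < Sup (cell \<xi> p q j)"
    and "Sup (cell \<xi> p q j) - Inf (cell \<xi> p q j) = (\<xi> (Suc j) - \<xi> j) * \<bar>q - p\<bar>"
    and "Inf (cell \<xi> p q j) \<in> {p + \<xi> j * (q - p), p + \<xi> (Suc j) * (q - p)}"
    and "cell \<xi> p q j = {Inf (cell \<xi> p q j)..Sup (cell \<xi> p q j)}"
proof -
  consider "p < q" | "q < p" using assms(2) by linarith
  then have "Inf (cell \<xi> p q j) < Sup (cell \<xi> p q j) \<and>
    Sup (cell \<xi> p q j) - Inf (cell \<xi> p q j) = (\<xi> (Suc j) - \<xi> j) * \<bar>q - p\<bar> \<and>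
    Inf (cell \<xi> p q j) \<in> {p + \<xi> j * (q - p), p + \<xi> (Suc j) * (q - p)} \<and>
    cell \<xi> p q j = {Inf (cell \<xi> p q j)..Sup (cell \<xi> p q j)}"
  proof cases
    case 1
    with assms(1) have "\<xi> j * (q - p) < \<xi> (Suc j) * (q - p)" by simp
    with 1 show ?thesis unfolding cell_eq[of \<xi>, OF assms] by (simp add: algebra_simps)
  next
    case 2
    with assms(1) have "\<xi> (Suc j) * (q - p) < \<xi> j * (q - p)" by (simp add: mult_less_cancel_right)
    with 2 show ?thesis unfolding cell_eq[of \<xi>, OF assms] by (simp add: algebra_simps)
  qed
  then show "Inf (cell \<xi> p q j) < Sup (cell \<xi> p q j)"
    "Sup (cell \<xi> p q j) - Inf (cell \<xi> p q j) = (\<xi> (Suc j) - \<xi> j) * \<bar>q - p\<bar>"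
    "Inf (cell \<xi> p q j) \<in> {p + \<xi> j * (q - p), p + \<xi> (Suc j) * (q - p)}"
    "cell \<xi> p q j = {Inf (cell \<xi> p q j)..Sup (cell \<xi> p q j)}" by blast+
qed

lemma cells_division:
  fixes \<xi> :: "nat \<Rightarrow> real"
  assumes \<xi>: "\<xi> 0 = 0" "\<xi> J = 1" "\<And>i j. i < j \<Longrightarrow> \<xi> i < \<xi> j" and "J > 0" and pq: "p \<noteq> q"
  shows "cell \<xi> p q ` {..<J} division_of closed_segment p q"
proof (rule division_ofI)
  have S: "\<xi> j < \<xi> (Suc j)" for j using \<xi>(3) by simp
  have mono: "\<xi> i \<le> \<xi> j" if "i \<le> j" for i j using \<xi>(3)[of i j] that by (cases "i = j") auto
  have seg: "p + s * (q - p) \<in> closed_segment p q" if "0 \<le> s" "s \<le> 1" for s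
    using that by (auto simp: in_segment algebra_simps intro!: exI[of _ s])
  show "finite (cell \<xi> p q ` {..<J})" by simp
  show sub: "K \<subseteq> closed_segment p q" if "K \<in> cell \<xi> p q ` {..<J}" for K
  proof -
    from that obtain j where j: "j < J" "K = cell \<xi> p q j" by auto
    have "0 \<le> \<xi> j" "\<xi> j \<le> 1" "0 \<le> \<xi> (Suc j)" "\<xi> (Suc j) \<le> 1"
      using mono[of 0 j] mono[of j J] mono[of 0 "Suc j"] mono[of "Suc j" J] \<xi>(1,2) j by auto
    then show ?thesis
      unfolding j(2) cell_def using seg by (intro closed_segment_subset convex_closed_segment) auto
  qed
  show "K \<noteq> {}" if "K \<in> cell \<xi> p q ` {..<J}" for K
    using that by (auto simp: cell_def)
  show "\<exists>c d. K = cbox c d" if "K \<in> cell \<xi> p q ` {..<J}" for K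
    using that by (auto simp: cell_def closed_segment_eq_real_ivl)
  have disj: "interior (cell \<xi> p q i) \<inter> interior (cell \<xi> p q j) = {}" if "i < j" for i j
  proof -
    have le: "\<xi> (Suc i) \<le> \<xi> j" using that by (intro mono) simp
    show ?thesis
    proof (cases "p < q")
      case True
      then have "\<xi> (Suc i) * (q - p) \<le> \<xi> j * (q - p)" using le by (intro mult_right_mono) auto
      then show ?thesis using True by (auto simp: cell_eq[of \<xi>, OF S pq] min_le_iff_disj le_max_iff_disj)
    next
      case False
      then have "\<xi> j * (q - p) \<le> \<xi> (Suc i) * (q - p)" using le pq by (intro mult_right_mono_neg) auto
      then show ?thesis using False by (auto simp: cell_eq[of \<xi>, OF S pq] min_le_iff_disj le_max_iff_disj)
    qed
  qed
  show "interior K1 \<inter> interior K2 = {}"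
    if K: "K1 \<in> cell \<xi> p q ` {..<J}" "K2 \<in> cell \<xi> p q ` {..<J}" "K1 \<noteq> K2" for K1 K2
  proof -
    from K obtain i j where "K1 = cell \<xi> p q i" "K2 = cell \<xi> p q j" "i \<noteq> j" by auto
    then show ?thesis using disj[of i j] disj[of j i] by (cases "i < j") auto
  qed
  show "\<Union>(cell \<xi> p q ` {..<J}) = closed_segment p q"
  proof
    show "\<Union>(cell \<xi> p q ` {..<J}) \<subseteq> closed_segment p q" using sub by blast
    show "closed_segment p q \<subseteq> \<Union>(cell \<xi> p q ` {..<J})"
    proof
      fix x assume "x \<in> closed_segment p q"
      then obtain s where s: "0 \<le> s" "s \<le> 1" "x = p + s * (q - p)"
        by (auto simp: in_segment algebra_simps)
      from between_consecutive_nodes[of J \<xi> s] s \<xi> \<open>J > 0\<close> obtain j where j: "j < J" "\<xi> j \<le> s" "s \<le> \<xi> (Suc j)" by auto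
      have "x \<in> cell \<xi> p q j"
      proof (cases "p < q")
        case True
        with j show ?thesis unfolding cell_eq[of \<xi>, OF S pq] by (simp add: s(3))
      next
        case False
        with j pq show ?thesis unfolding cell_eq[of \<xi>, OF S pq] by (simp add: s(3) mult_right_mono_neg)
      qed
      with j(1) show "x \<in> \<Union>(cell \<xi> p q ` {..<J})" by blast
    qed
  qed
qed

text \<open>A point of \<open>Z\<close> is an endpoint of some macro interval, so it is interior to none of them, because
  distinct macro intervals do not overlap. Hence a cell whose left end lies in \<open>Z\<close> touches the endpoint
  \<open>p K\<close> towards which its macro interval \<open>K\<close> is graded, and it is the first cell of \<open>K\<close>.\<close>
lemma graded_triangulation_properties:
  assumes ab: "a < b" and M: "macro_partition {a<..<b} \<M>" and G: "graded_triangulation \<M> Z \<beta> J \<T>"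
    and \<beta>: "\<beta> \<ge> 1" and J: "J \<ge> 1"
  shows "\<T> division_of {a..b}"
    and "\<And>T. T \<in> \<T> \<Longrightarrow> Inf T < Sup T"
    and "\<And>T. T \<in> \<T> \<Longrightarrow> {Inf T<..<Sup T} \<inter> Z = {}"
    and "\<And>T. T \<in> \<T> \<Longrightarrow> Sup T - Inf T \<le> \<beta> / real J * (b - a)"
    and "\<And>T. T \<in> \<T> \<Longrightarrow> Inf T \<in> Z \<Longrightarrow> Sup T - Inf T \<le> (1 / real J) powr \<beta> * (b - a)"
    and "card {T \<in> \<T>. Inf T \<in> Z} \<le> card \<M>"
proof -
  define \<xi> where "\<xi> = graded_node \<beta> J"
  have Md: "\<M> division_of {a..b}" and Mi: "\<And>K. K \<in> \<M> \<Longrightarrow> interior K \<noteq> {}"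
    using M ab by (auto simp: macro_partition_def)
  have finM: "finite \<M>" using Md by (rule division_of_finite)
  obtain p q where pq: "\<And>K. K \<in> \<M> \<Longrightarrow> K = closed_segment (p K) (q K)"
      "\<And>K. K \<in> \<M> \<Longrightarrow> frontier K \<inter> Z \<subseteq> {p K}"
    and Tdef: "\<T> = {closed_segment (p K + graded_node \<beta> J j * (q K - p K))
                            (p K + graded_node \<beta> J (Suc j) * (q K - p K)) | K j. K \<in> \<M> \<and> j < J}"
    and Zf: "\<And>z. z \<in> Z \<Longrightarrow> \<exists>K\<in>\<M>. z \<in> frontier K"
    using G unfolding graded_triangulation_def by blast
  have \<T>: "\<T> = (\<Union>K\<in>\<M>. cell \<xi> (p K) (q K) ` {..<J})"
    unfolding Tdef cell_def \<xi>_def by blast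
  have \<xi>: "\<xi> 0 = 0" "\<xi> J = 1" "\<And>i j. i < j \<Longrightarrow> \<xi> i < \<xi> j"
    unfolding \<xi>_def using \<beta> J graded_node_0 graded_node_last graded_node_strict_mono by auto
  have S: "\<xi> j < \<xi> (Suc j)" for j using \<xi>(3) by simp
  note CB = cell_bounds[of \<xi>, OF S]
  have ne: "p K \<noteq> q K" if "K \<in> \<M>" for K
  proof
    assume "p K = q K"
    then have "closed_segment (p K) (q K) = {q K}" by simp
    from trans[OF pq(1)[OF that] this] have "interior K = interior {q K}" by (rule arg_cong)
    with Mi[OF that] show False by simp
  qed
  have cd: "cell \<xi> (p K) (q K) ` {..<J} division_of K" if "K \<in> \<M>" for K
  proof -
    have "cell \<xi> (p K) (q K) ` {..<J} division_of closed_segment (p K) (q K)"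
      using J by (intro cells_division[OF \<xi>] ne[OF that]) auto
    then show ?thesis by (simp only: pq(1)[OF that, symmetric])
  qed
  have len: "\<bar>q K - p K\<bar> \<le> b - a" if "K \<in> \<M>" for K
  proof -
    have "p K \<in> {a..b}" "q K \<in> {a..b}"
      using division_ofD(2)[OF Md that] pq(1)[OF that] ends_in_segment by blast+
    then show ?thesis by auto
  qed
  have T_cases: "\<exists>K j. K \<in> \<M> \<and> j < J \<and> T = cell \<xi> (p K) (q K) j" if "T \<in> \<T>" for T
    using that unfolding \<T> by auto
  show div: "\<T> division_of {a..b}"
  proof -
    let ?F = "(\<lambda>K. cell \<xi> (p K) (q K) ` {..<J}) ` \<M>"
    have "\<Union>?F division_of
        \<Union>(\<Union>?F)"
    proof (rule division_of_Union)
      show "finite ?F" using finM by simp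
      show "D division_of \<Union>D" if "D \<in> ?F" for D
        using that cd division_of_union_self by blast
      show "interior k1 \<inter> interior k2 = {}"
        if k: "k1 \<in> \<Union>?F" "k2 \<in> \<Union>?F"
          "k1 \<noteq> k2" for k1 k2
      proof -
        from k obtain K1 K2 where K: "K1 \<in> \<M>" "K2 \<in> \<M>"
          "k1 \<in> cell \<xi> (p K1) (q K1) ` {..<J}" "k2 \<in> cell \<xi> (p K2) (q K2) ` {..<J}" by blast
        show ?thesis
        proof (cases "K1 = K2")
          case True
          then show ?thesis using division_ofD(5)[OF cd[OF K(1)] K(3)] K(4) k(3) by blast
        next
          case False
          have "k1 \<subseteq> K1" "k2 \<subseteq> K2"
            using division_ofD(2)[OF cd[OF K(1)] K(3)] division_ofD(2)[OF cd[OF K(2)] K(4)] by auto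
          then show ?thesis
            using division_ofD(5)[OF Md K(1,2) False] interior_mono by blast
        qed
      qed
    qed
    moreover have "\<Union>(\<Union>?F) = (\<Union>K\<in>\<M>. \<Union>(cell \<xi> (p K) (q K) ` {..<J}))"
      by blast
    moreover have "\<dots> = (\<Union>K\<in>\<M>. K)"
      using division_ofD(6)[OF cd] by (intro SUP_cong) auto
    moreover have "\<dots> = {a..b}" using division_ofD(6)[OF Md] by simp
    ultimately show ?thesis by (simp add: \<T>)
  qed
  show nd: "Inf T < Sup T" if T: "T \<in> \<T>" for T
    using T_cases[OF T] CB(1)[OF ne] by blast
  show "Sup T - Inf T \<le> \<beta> / real J * (b - a)" if T: "T \<in> \<T>" for T
  proof -
    from T_cases[OF T] obtain K j where K: "K \<in> \<M>" "j < J" "T = cell \<xi> (p K) (q K) j" by blast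
    have "Sup T - Inf T = (\<xi> (Suc j) - \<xi> j) * \<bar>q K - p K\<bar>"
      unfolding K(3) by (rule CB(2)[OF ne[OF K(1)]])
    also have "\<dots> \<le> \<beta> / real J * (b - a)"
      using graded_node_step[OF \<beta> J K(2)] len[OF K(1)] \<beta> unfolding \<xi>_def by (intro mult_mono) auto
    finally show ?thesis .
  qed
  have ivl: "K = {min (p K) (q K)..max (p K) (q K)}" "min (p K) (q K) < max (p K) (q K)" if "K \<in> \<M>" for K
  proof -
    have "closed_segment (p K) (q K) = {min (p K) (q K)..max (p K) (q K)}"
      by (auto simp: closed_segment_eq_real_ivl min_def max_def)
    with pq(1)[OF that] show "K = {min (p K) (q K)..max (p K) (q K)}" by (rule trans)
    show "min (p K) (q K) < max (p K) (q K)" using ne[OF that] by (auto simp: min_def max_def)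
  qed
  have Zint: "interior K \<inter> Z = {}" if K: "K \<in> \<M>" for K
  proof (rule ccontr)
    assume "interior K \<inter> Z \<noteq> {}"
    then obtain z where z: "z \<in> interior K" "z \<in> Z" by blast
    from Zf[OF z(2)] obtain K' where K': "K' \<in> \<M>" "z \<in> frontier K'" by blast
    have "K \<noteq> K'" using z(1) K'(2) by (auto simp: frontier_def)
    from division_ofD(5)[OF Md K K'(1) this] have "interior K \<inter> closure (interior K') = {}"
      by (simp add: open_Int_closure_eq_empty)
    moreover have "closure (interior K') = K'"
    proof -
      have "interior K' = {min (p K') (q K')<..<max (p K') (q K')}"
        using arg_cong[OF ivl(1)[OF K'(1)], of interior] unfolding interior_atLeastAtMost_real .
      then have "closure (interior K') = {min (p K') (q K')..max (p K') (q K')}"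
        using ivl(2)[OF K'(1)] by (simp only: closure_greaterThanLessThan)
      then show ?thesis using ivl(1)[OF K'(1)] by (rule trans[OF _ sym])
    qed
    moreover have "z \<in> K'"
    proof -
      have "closed (closed_segment (p K') (q K'))" by (rule closed_segment)
      then have "closed K'" by (simp only: pq(1)[OF K'(1), symmetric])
      then show ?thesis using K'(2) by (simp add: frontier_def)
    qed
    ultimately show False using z(1) by blast
  qed
  show "{Inf T<..<Sup T} \<inter> Z = {}" if T: "T \<in> \<T>" for T
  proof -
    from T_cases[OF T] obtain K j where K: "K \<in> \<M>" "j < J" "T = cell \<xi> (p K) (q K) j" by blast
    have "T \<subseteq> K" using division_ofD(2)[OF cd[OF K(1)]] K(2,3) by blast
    moreover have "T = {Inf T..Sup T}" unfolding K(3) by (rule CB(4)[OF ne[OF K(1)]])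
    from arg_cong[OF this, of interior] have "interior T = {Inf T<..<Sup T}"
      unfolding interior_atLeastAtMost_real .
    ultimately show ?thesis using interior_mono Zint[OF K(1)] by blast
  qed
  have first: "\<exists>K\<in>\<M>. T = cell \<xi> (p K) (q K) 0" if T: "T \<in> \<T>" "Inf T \<in> Z" for T
  proof -
    from T_cases[OF T(1)] obtain K j where K: "K \<in> \<M>" "j < J" "T = cell \<xi> (p K) (q K) j" by blast
    have "T \<subseteq> K" using division_ofD(2)[OF cd[OF K(1)]] K(2,3) by blast
    moreover have "Inf T \<in> T"
    proof -
      have "Inf T \<in> {Inf T..Sup T}" using nd[OF T(1)] by simp
      also have "{Inf T..Sup T} = T" unfolding K(3) by (rule CB(4)[OF ne[OF K(1)], symmetric])
      finally show ?thesis .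
    qed
    ultimately have "Inf T \<in> K" by blast
    moreover have "Inf T \<notin> interior K" using Zint[OF K(1)] T(2) by blast
    ultimately have "Inf T \<in> frontier K" using closure_subset by (auto simp: frontier_def)
    with pq(2)[OF K(1)] T(2) have "Inf T = p K" by blast
    with CB(3)[OF ne[OF K(1)], of j] K(3) ne[OF K(1)] have "\<xi> j = 0 \<or> \<xi> (Suc j) = 0" by auto
    moreover have "0 < \<xi> (Suc j)" using \<xi>(3)[of 0 "Suc j"] \<xi>(1) by simp
    moreover have "j > 0 \<Longrightarrow> 0 < \<xi> j" using \<xi>(3)[of 0 j] \<xi>(1) by simp
    ultimately have "j = 0" by (cases "j = 0") auto
    with K show ?thesis by blast
  qed
  show "Sup T - Inf T \<le> (1 / real J) powr \<beta> * (b - a)" if T: "T \<in> \<T>" "Inf T \<in> Z" for T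
  proof -
    from first[OF T] obtain K where K: "K \<in> \<M>" "T = cell \<xi> (p K) (q K) 0" by blast
    have "Sup T - Inf T = (\<xi> (Suc 0) - \<xi> 0) * \<bar>q K - p K\<bar>"
      unfolding K(2) by (rule CB(2)[OF ne[OF K(1)]])
    also have "\<dots> \<le> (1 / real J) powr \<beta> * (b - a)"
      using len[OF K(1)] graded_node_1[of \<beta> J] \<xi>(1) by (intro mult_mono) (auto simp: \<xi>_def)
    finally show ?thesis .
  qed
  have "{T \<in> \<T>. Inf T \<in> Z} \<subseteq> (\<lambda>K. cell \<xi> (p K) (q K) 0) ` \<M>" using first by blast
  then show "card {T \<in> \<T>. Inf T \<in> Z} \<le> card \<M>"
    using finM by (meson card_image_le card_mono finite_imageI order_trans)
qed

text \<open>A uniform grid is a graded grid of strength 1 with a single macro interval and no jump.\<close>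
lemma uniform_division:
  assumes "a < b" "J \<ge> 1"
  obtains \<D> where "\<D> division_of {a..b::real}" "\<And>T. T \<in> \<D> \<Longrightarrow> Inf T < Sup T"
    "\<And>T. T \<in> \<D> \<Longrightarrow> Sup T - Inf T \<le> (b - a) / real J"
proof -
  let ?T = "{closed_segment (a + graded_node 1 J j * (b - a)) (a + graded_node 1 J (Suc j) * (b - a)) | K j. K \<in> {{a..b}} \<and> j < J}"
  have M: "macro_partition {a<..<b} {{a..b}}"
    using assms division_of_self[of a b] by (simp add: macro_partition_def)
  have G: "graded_triangulation {{a..b}} {} 1 J ?T"
    unfolding graded_triangulation_def
  proof (intro conjI)
    have "\<forall>K\<in>{{a..b}}. K = closed_segment a b \<and> frontier K \<inter> {} \<subseteq> {a}"
      using assms(1) by (simp add: closed_segment_eq_real_ivl)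
    then show "\<exists>p q. (\<forall>K\<in>{{a..b}}. K = closed_segment (p K) (q K) \<and> frontier K \<inter> {} \<subseteq> {p K}) \<and>
        ?T = {closed_segment (p K + graded_node 1 J j * (q K - p K))
          (p K + graded_node 1 J (Suc j) * (q K - p K)) | K j. K \<in> {{a..b}} \<and> j < J}"
      by (rule_tac x = "\<lambda>_. a" in exI, rule_tac x = "\<lambda>_. b" in exI) simp
  qed auto
  from graded_triangulation_properties[OF assms(1) M G _ assms(2)] that[of ?T] show ?thesis by simp
qed

section \<open>Square integrable functions, boundary values and truncation\<close>

lemma AE_lebesgue_on_iff_negligible:
  assumes "S \<in> sets lebesgue"
  shows "(AE x in lebesgue_on S. P x) \<longleftrightarrow> negligible {x \<in> S. \<not> P x}"
proof -
  have "(AE x in lebesgue_on S. P x) \<longleftrightarrow> (AE x in lebesgue. x \<in> S \<longrightarrow> P x)"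
    using assms by (intro AE_restrict_space_iff) simp
  also have "\<dots> \<longleftrightarrow> negligible {x \<in> S. \<not> P x}"
    unfolding eventually_ae_filter_negligible
  proof
    assume "\<exists>N. negligible N \<and> {x. \<not> (x \<in> S \<longrightarrow> P x)} \<subseteq> N"
    then obtain N where "negligible N" "{x. \<not> (x \<in> S \<longrightarrow> P x)} \<subseteq> N" by blast
    then show "negligible {x \<in> S. \<not> P x}" by (elim negligible_subset) auto
  next
    assume "negligible {x \<in> S. \<not> P x}"
    then show "\<exists>N. negligible N \<and> {x. \<not> (x \<in> S \<longrightarrow> P x)} \<subseteq> N"
      by (intro exI[of _ "{x \<in> S. \<not> P x}"]) auto
  qed
  finally show ?thesis .
qed

lemma Linf_norm_bound:
  assumes g: "g \<in> Linf {a<..<b}" and ab: "a < b"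
  shows "AE x in lebesgue_on {a<..<b}. \<bar>g x\<bar> \<le> Linf_norm {a<..<b} g" and "Linf_norm {a<..<b} g \<ge> 0"
proof -
  let ?M = "lebesgue_on {a<..<b}" and ?e = "esssup (lebesgue_on {a<..<b}) (\<lambda>x. ereal \<bar>g x\<bar>)"
  have nn: "\<not> negligible {a<..<b}"
    using negligible_interval(2)[of a b] ab by (simp add: box_real)
  have fin: "?e < \<infinity>" using g by (simp add: Linf_def)
  have AE: "AE x in ?M. ereal \<bar>g x\<bar> \<le> ?e" by (rule esssup_AE)
  show B: "AE x in ?M. \<bar>g x\<bar> \<le> Linf_norm {a<..<b} g"
    using AE
  proof eventually_elim
    case (elim x)
    with fin show ?case by (cases ?e) (auto simp: Linf_norm_def)
  qed
  show "Linf_norm {a<..<b} g \<ge> 0"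
  proof (rule ccontr)
    assume "\<not> Linf_norm {a<..<b} g \<ge> 0"
    then have "{x \<in> {a<..<b}. \<not> \<bar>g x\<bar> \<le> Linf_norm {a<..<b} g} = {a<..<b}"
      by (auto simp: not_le)
    with B nn show False by (simp add: AE_lebesgue_on_iff_negligible)
  qed
qed

lemma L2_norm_squared: "(L2_norm S v)\<^sup>2 = (LINT x|lebesgue_on S. (v x)\<^sup>2)"
  unfolding L2_norm_def by (rule real_sqrt_pow2) simp

lemma L2_linear:
  assumes "v \<in> L2 S" "w \<in> L2 S"
  shows "(\<lambda>x. r * v x + s * w x) \<in> L2 S"
proof -
  have m: "v \<in> borel_measurable (lebesgue_on S)" "w \<in> borel_measurable (lebesgue_on S)"
    and i: "integrable (lebesgue_on S) (\<lambda>x. (v x)\<^sup>2)" "integrable (lebesgue_on S) (\<lambda>x. (w x)\<^sup>2)"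
    using assms by (auto simp: L2_def)
  have m': "(\<lambda>x. r * v x + s * w x) \<in> borel_measurable (lebesgue_on S)" using m by measurable
  have "integrable (lebesgue_on S) (\<lambda>x. (r * v x + s * w x)\<^sup>2)"
  proof (rule Bochner_Integration.integrable_bound)
    show "integrable (lebesgue_on S) (\<lambda>x. 2 * r\<^sup>2 * (v x)\<^sup>2 + 2 * s\<^sup>2 * (w x)\<^sup>2)"
      using i by auto
    show "(\<lambda>x. (r * v x + s * w x)\<^sup>2) \<in> borel_measurable (lebesgue_on S)"
      using m' by measurable
    have "(r * v x + s * w x)\<^sup>2 \<le> 2 * r\<^sup>2 * (v x)\<^sup>2 + 2 * s\<^sup>2 * (w x)\<^sup>2" for x
      using zero_le_power2[of "r * v x - s * w x"] by (simp add: power2_sum power2_diff power_mult_distrib)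
    then show "AE x in lebesgue_on S. norm ((r * v x + s * w x)\<^sup>2)
        \<le> norm (2 * r\<^sup>2 * (v x)\<^sup>2 + 2 * s\<^sup>2 * (w x)\<^sup>2)"
      by (auto intro!: AE_I2 intro: order_trans)
  qed
  with m' show ?thesis by (simp add: L2_def)
qed

lemma L2_diff: "v \<in> L2 S \<Longrightarrow> w \<in> L2 S \<Longrightarrow> (\<lambda>x. v x - w x) \<in> L2 S"
  using L2_linear[of v S w 1 "-1"] by simp

lemma L2_integrable: "v \<in> L2 S \<Longrightarrow> integrable (lebesgue_on S) (\<lambda>x. (v x)\<^sup>2)"
  by (simp add: L2_def)

lemma bounded_in_L2:
  assumes "v \<in> borel_measurable (lebesgue_on {a<..<b})" "AE x in lebesgue_on {a<..<b}. \<bar>v x\<bar> \<le> G"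
  shows "v \<in> L2 {a<..<b}"
proof -
  interpret finite_measure "lebesgue_on {a<..<b}"
    by (rule finite_measure_lebesgue_on) simp
  have "integrable (lebesgue_on {a<..<b}) (\<lambda>x. (v x)\<^sup>2)"
  proof (rule integrable_const_bound[where B = "G\<^sup>2"])
    show "AE x in lebesgue_on {a<..<b}. norm ((v x)\<^sup>2) \<le> G\<^sup>2"
      using assms(2) by eventually_elim (metis abs_ge_zero norm_power power_mono real_norm_def)
    show "(\<lambda>x. (v x)\<^sup>2) \<in> borel_measurable (lebesgue_on {a<..<b})"
      using assms(1) by measurable
  qed
  with assms(1) show ?thesis by (simp add: L2_def)
qed

lemma continuous_in_L2:
  assumes "continuous_on {a..b} v"
  shows "v \<in> L2 {a<..<b}"
proof -
  obtain B where B: "\<forall>x\<in>{a..b}. \<bar>v x\<bar> \<le> B"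
    using compact_imp_bounded[OF compact_continuous_image[OF assms compact_Icc]]
    by (auto simp: bounded_iff)
  have "continuous_on {a<..<b} v" by (rule continuous_on_subset[OF assms]) auto
  then have "v \<in> borel_measurable (lebesgue_on {a<..<b})"
    by (rule continuous_imp_measurable_on_sets_lebesgue) simp
  then show ?thesis
    using B by (intro bounded_in_L2[where G = B]) (auto intro!: AE_I2)
qed

lemma approx_limit_left_end: "approx_limit {a<..<b} v a l \<longleftrightarrow> approx_right v a l"
  if "v absolutely_integrable_on {a..b}" "a < b"
proof -
  have "{a<..<b} \<inter> {a<..} = {a<..<b}" by auto
  then show ?thesis using approx_limit_iff_approx_right[of a b v a l] that by simp
qed

lemma approx_limit_right_end: "approx_limit {a<..<b} v b l \<longleftrightarrow> approx_left v b l"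
  if "v absolutely_integrable_on {a..b}" "a < b"
proof -
  have "{a<..<b} \<inter> {..<b} = {a<..<b}" by auto
  then show ?thesis using approx_limit_iff_approx_left[of a b v b l] that by simp
qed

text \<open>Finite element functions are admissible in the continuous problem: by continuity their traces are
  their boundary values.\<close>
lemma piecewise_affine_in_BV_L2_D:
  assumes ab: "a < b" and D: "\<D> division_of {a..b}" and \<Gamma>: "\<Gamma> \<subseteq> {a, b}"
    and aff: "\<And>T. T \<in> \<D> \<Longrightarrow> \<exists>m k. \<forall>x\<in>T. v x = m * x + k" and bc: "\<And>z. z \<in> \<Gamma> \<Longrightarrow> v z = 0"
  shows "v \<in> BV_L2_D {a<..<b} \<Gamma>"
proof -
  have c: "continuous_on {a..b} v" using D aff by (rule continuous_on_piecewise_affine)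
  then have i: "v absolutely_integrable_on {a..b}" by (rule absolutely_integrable_continuous_real)
  then have "integrable (lebesgue_on {a<..<b}) v"
    by (simp add: integrable_lebesgue_on_iff absolutely_integrable_on_Icc_iff_Ioo)
  moreover have "total_variation {a<..<b} v < \<infinity>"
    using total_variation_piecewise_affine_le[OF ab c D aff] by (rule le_less_trans) simp_all
  moreover have "approx_limit {a<..<b} v z 0" if "z \<in> \<Gamma>" for z
  proof -
    have lim: "approx_right v a (v a)" "approx_left v b (v b)"
      using approx_limits_of_continuous[OF i _ c] ab by auto
    from that \<Gamma> bc[OF that] consider "z = a" "v a = 0" | "z = b" "v b = 0" by auto
    then show ?thesis
      using lim approx_limit_left_end[OF i ab] approx_limit_right_end[OF i ab] by cases auto
  qed
  ultimately show ?thesis using continuous_in_L2[OF c] by (simp add: BV_L2_D_def BV_def)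
qed

lemma total_variation_midpoint:
  assumes S: "S \<in> sets lebesgue" and v: "v absolutely_integrable_on S" and w: "w absolutely_integrable_on S"
    and V: "total_variation S v = ereal V" and W: "total_variation S w = ereal W"
  shows "total_variation S (\<lambda>x. (v x + w x) / 2) \<le> ereal ((V + W) / 2)"
proof (rule total_variation_leI[OF S])
  show "(\<lambda>x. (v x + w x) / 2) absolutely_integrable_on S" using v w by auto
  fix \<phi> assume \<phi>: "\<phi> \<in> C1c S" "\<And>x. \<bar>\<phi> x\<bar> \<le> 1"
  have i: "(\<lambda>x. v x * deriv \<phi> x) integrable_on S" "(\<lambda>x. w x * deriv \<phi> x) integrable_on S"
    using C1c_integral[OF \<phi>(1)] v w by (auto simp: set_lebesgue_integral_eq_integral)
  have "integral S (\<lambda>x. (v x + w x) / 2 * deriv \<phi> x)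
      = integral S (\<lambda>x. (v x * deriv \<phi> x + w x * deriv \<phi> x) / 2)"
    by (rule integral_cong) (simp add: field_simps)
  also have "\<dots> = (integral S (\<lambda>x. v x * deriv \<phi> x) + integral S (\<lambda>x. w x * deriv \<phi> x)) / 2"
    using i by (simp add: integral_add)
  also have "\<dots> \<le> (V + W) / 2"
    using total_variation_geI[OF S v \<phi>] total_variation_geI[OF S w \<phi>] V W by simp
  finally show "integral S (\<lambda>x. (v x + w x) / 2 * deriv \<phi> x) \<le> (V + W) / 2" .
qed

definition clip :: "real \<Rightarrow> real \<Rightarrow> real" where
  "clip G t = max (- G) (min G t)"

lemma clip_props:
  assumes "G \<ge> 0"
  shows abs_clip: "\<bar>clip G t\<bar> \<le> G" and clip_contract: "\<bar>clip G s - clip G t\<bar> \<le> \<bar>s - t\<bar>"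
    and clip_0: "clip G 0 = 0"
  using assms by (auto simp: clip_def min_def max_def)

text \<open>Truncation is the metric projection onto the interval \<open>{- G..G}\<close>, so the angle at \<open>clip G t\<close>
  is obtuse.\<close>
lemma clip_projection:
  assumes "\<bar>y\<bar> \<le> G"
  shows "(y - clip G t)\<^sup>2 + (t - clip G t)\<^sup>2 \<le> (y - t)\<^sup>2"
proof -
  have "(y - clip G t) * (t - clip G t) \<le> 0"
    using assms by (auto simp: clip_def min_def max_def mult_le_0_iff)
  then show ?thesis by (simp add: power2_eq_square algebra_simps)
qed

lemma averages_limit_bound:
  fixes v :: "real \<Rightarrow> real"
  assumes "d > 0" and I: "\<And>r. 0 < r \<Longrightarrow> r < d \<Longrightarrow> v absolutely_integrable_on {p r..q r} \<and> q r - p r = r"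
    and N: "negligible N" "\<And>r x. 0 < r \<Longrightarrow> r < d \<Longrightarrow> x \<in> {p r..q r} - N \<Longrightarrow> \<bar>v x\<bar> \<le> G"
    and l: "((\<lambda>r. integral {p r..q r} (\<lambda>x. \<bar>v x - l\<bar>) / r) \<longlongrightarrow> 0) (at_right 0)"
  shows "\<bar>l\<bar> \<le> G"
proof -
  have "\<forall>\<^sub>F r in at_right 0. \<bar>l\<bar> - G \<le> integral {p r..q r} (\<lambda>x. \<bar>v x - l\<bar>) / r"
    unfolding eventually_at_right_field
  proof (intro exI[of _ d] conjI allI impI)
    fix r assume r: "0 < r" "r < d"
    let ?w = "\<lambda>x. if x \<in> N then \<bar>l\<bar> - G else \<bar>v x - l\<bar>"
    have vi: "v absolutely_integrable_on {p r..q r}" using I[OF r] by simp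
    have "(\<bar>l\<bar> - G) * r = integral {p r..q r} (\<lambda>_. \<bar>l\<bar> - G)" using r I[OF r] by simp
    also have "\<dots> \<le> integral {p r..q r} ?w"
    proof (rule integral_le)
      show "?w integrable_on {p r..q r}"
        by (rule integrable_spike[OF absolutely_integrable_abs_diff_const(2)[OF vi, of l] N(1)]) auto
      show "\<bar>l\<bar> - G \<le> ?w x" if "x \<in> {p r..q r}" for x
        using N(2)[OF r, of x] that by auto
    qed auto
    also have "\<dots> = integral {p r..q r} (\<lambda>x. \<bar>v x - l\<bar>)"
      by (rule integral_spike[OF N(1)]) auto
    finally show "\<bar>l\<bar> - G \<le> integral {p r..q r} (\<lambda>x. \<bar>v x - l\<bar>) / r" using r by (simp add: field_simps)
  qed (use assms(1) in auto)
  with l have "\<bar>l\<bar> - G \<le> 0"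
    by (intro tendsto_lowerbound[where F = "at_right 0"]) auto
  then show ?thesis by simp
qed

section \<open>Error estimate for minimizers\<close>

locale piecewise_W21_minimizer = piecewise_W21_function a b u for a b :: real and u :: "real \<Rightarrow> real" +
  fixes \<alpha> :: real and g :: "real \<Rightarrow> real" and \<Gamma> :: "real set"
  assumes \<alpha>: "\<alpha> > 0" and \<Gamma>: "\<Gamma> \<subseteq> {a, b}" and g: "g \<in> Linf {a<..<b}"
    and minimizer: "is_arg_min (functional {a<..<b} \<alpha> g) (\<lambda>v. v \<in> BV_L2_D {a<..<b} \<Gamma>) u"
begin

abbreviation \<Omega> :: "real set" where "\<Omega> \<equiv> {a<..<b}"

definition V :: real where "V = real_of_ereal (total_variation \<Omega> u)"

definition G :: real where "G = Linf_norm \<Omega> g"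

definition dist2 :: "(real \<Rightarrow> real) \<Rightarrow> (real \<Rightarrow> real) \<Rightarrow> real" where
  "dist2 v w = (LINT x|lebesgue_on \<Omega>. (v x - w x)\<^sup>2)"

lemma u_mem: "u \<in> BV_L2_D \<Omega> \<Gamma>"
  and u_min: "v \<in> BV_L2_D \<Omega> \<Gamma> \<Longrightarrow> functional \<Omega> \<alpha> g u \<le> functional \<Omega> \<alpha> g v"
  using minimizer by (auto simp: is_arg_min_def not_less)

lemma TV_real: "v \<in> BV_L2_D \<Omega> \<Gamma> \<Longrightarrow> total_variation \<Omega> v = ereal (real_of_ereal (total_variation \<Omega> v))"
  using total_variation_nonneg[of \<Omega> v] by (cases "total_variation \<Omega> v") (auto simp: BV_L2_D_def BV_def)

lemma V: "total_variation \<Omega> u = ereal V" and V_nonneg: "V \<ge> 0"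
  using TV_real[OF u_mem] total_variation_nonneg[of \<Omega> u] by (auto simp: V_def real_of_ereal_pos)

lemma functional_eq: "functional \<Omega> \<alpha> g v = total_variation \<Omega> v + ereal (\<alpha> / 2 * dist2 g v)"
  by (simp add: functional_def L2_norm_squared dist2_def)

lemma G_nonneg: "G \<ge> 0" and g_bound: "AE x in lebesgue_on \<Omega>. \<bar>g x\<bar> \<le> G"
  using Linf_norm_bound[OF g ab] by (auto simp: G_def)

lemma g_L2: "g \<in> L2 \<Omega>"
  using g_bound g by (intro bounded_in_L2) (auto simp: Linf_def)

lemma u_L2: "u \<in> L2 \<Omega>"
  using u_mem by (simp add: BV_L2_D_def)

text \<open>Comparison of \<open>u\<close> with the midpoint of \<open>u\<close> and \<open>w\<close>: the parallelogram identity turns the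
  convexity of the total variation into a quadratic gain. The midpoint of \<open>u\<close> and \<open>w\<close> instead of a
  point close to \<open>u\<close> costs a factor 2 in the constant.\<close>
lemma strong_convexity:
  assumes w: "w \<in> BV_L2_D \<Omega> \<Gamma>" and W: "total_variation \<Omega> w = ereal W"
  shows "\<alpha> / 4 * dist2 u w \<le> (W + \<alpha> / 2 * dist2 g w) - (V + \<alpha> / 2 * dist2 g u)"
proof -
  let ?m = "\<lambda>x. (u x + w x) / 2"
  have wL2: "w \<in> L2 \<Omega>" and wi: "integrable (lebesgue_on \<Omega>) w" and ui': "integrable (lebesgue_on \<Omega>) u"
    using w u_mem by (auto simp: BV_L2_D_def BV_def)
  have wa: "w absolutely_integrable_on \<Omega>" and ua: "u absolutely_integrable_on \<Omega>"
    using wi ui' by (simp_all add: integrable_lebesgue_on_iff)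
  have wa': "w absolutely_integrable_on {a..b}" using wa by (simp add: absolutely_integrable_on_Icc_iff_Ioo)
  have mTV: "total_variation \<Omega> ?m \<le> ereal ((V + W) / 2)"
    by (rule total_variation_midpoint[OF _ ua wa V W]) simp
  have mi: "integrable (lebesgue_on \<Omega>) ?m" using wi ui' by auto
  have mL2: "?m \<in> L2 \<Omega>" using L2_linear[OF u_L2 wL2, of "1/2" "1/2"] by (simp add: add_divide_distrib)
  have "approx_limit \<Omega> ?m z 0" if z: "z \<in> \<Gamma>" for z
  proof -
    have l: "approx_limit \<Omega> u z 0" "approx_limit \<Omega> w z 0"
      using u_mem w z by (auto simp: BV_L2_D_def)
    define A where "A v r = (LINT x|lebesgue_on (\<Omega> \<inter> ball z r). \<bar>v x - 0\<bar>)" for v :: "real \<Rightarrow> real" and r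
    have "((\<lambda>r. (A u r / r + A w r / r) / 2) \<longlongrightarrow> (0 + 0) / 2) (at_right 0)"
      using l unfolding approx_limit_def A_def by (intro tendsto_intros) auto
    then have lim: "((\<lambda>r. (A u r / r + A w r / r) / 2) \<longlongrightarrow> 0) (at_right 0)" by simp
    have "norm (A ?m r / r) \<le> (A u r / r + A w r / r) / 2" if "r > 0" for r
    proof -
      have S: "\<Omega> \<inter> ball z r \<in> sets lebesgue" by simp
      have i: "integrable (lebesgue_on (\<Omega> \<inter> ball z r)) v" if "integrable (lebesgue_on \<Omega>) v" for v :: "real \<Rightarrow> real"
        using that absolutely_integrable_on_subset[where f = v and S = \<Omega>, OF _ S]
        by (simp add: integrable_lebesgue_on_iff S)
      have "A ?m r \<le> (LINT x|lebesgue_on (\<Omega> \<inter> ball z r). (\<bar>u x - 0\<bar> + \<bar>w x - 0\<bar>) / 2)"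
        unfolding A_def using i[OF mi] i[OF ui'] i[OF wi] by (intro integral_mono) auto
      also have "\<dots> = (A u r + A w r) / 2"
        unfolding A_def using i[OF ui'] i[OF wi] by simp
      finally have "A ?m r \<le> (A u r + A w r) / 2" .
      moreover have "A ?m r \<ge> 0" by (simp add: A_def)
      ultimately show ?thesis using that by (simp add: field_simps)
    qed
    then have "\<forall>\<^sub>F r in at_right 0. norm (A ?m r / r) \<le> (A u r / r + A w r / r) / 2"
      unfolding eventually_at_right_field by (intro exI[of _ 1]) auto
    then have "((\<lambda>r. A ?m r / r) \<longlongrightarrow> 0) (at_right 0)"
      using lim by (rule Lim_null_comparison)
    then show ?thesis by (simp add: approx_limit_def A_def)
  qed
  then have m: "?m \<in> BV_L2_D \<Omega> \<Gamma>"
    using mi mL2 le_less_trans[OF mTV, of \<infinity>] by (simp add: BV_L2_D_def BV_def)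
  have "ereal (V + \<alpha> / 2 * dist2 g u) \<le> total_variation \<Omega> ?m + ereal (\<alpha> / 2 * dist2 g ?m)"
    using u_min[OF m] V by (simp add: functional_eq)
  also have "\<dots> \<le> ereal ((V + W) / 2) + ereal (\<alpha> / 2 * dist2 g ?m)"
    using mTV by (rule add_right_mono)
  finally have 1: "V + \<alpha> / 2 * dist2 g u \<le> (V + W) / 2 + \<alpha> / 2 * dist2 g ?m" by simp
  have "dist2 g ?m = (LINT x|lebesgue_on \<Omega>. (g x - u x)\<^sup>2 / 2 + (g x - w x)\<^sup>2 / 2 - (u x - w x)\<^sup>2 / 4)"
    unfolding dist2_def by (rule Bochner_Integration.integral_cong) (auto simp: power2_eq_square field_simps)
  also have "\<dots> = dist2 g u / 2 + dist2 g w / 2 - dist2 u w / 4"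
    unfolding dist2_def
    using L2_integrable[OF L2_diff[OF g_L2 u_L2]] L2_integrable[OF L2_diff[OF g_L2 wL2]]
      L2_integrable[OF L2_diff[OF u_L2 wL2]] by simp
  finally have 2: "dist2 g ?m = dist2 g u / 2 + dist2 g w / 2 - dist2 u w / 4" .
  have "\<alpha> / 2 * dist2 g ?m = \<alpha> / 4 * dist2 g u + \<alpha> / 4 * dist2 g w - \<alpha> / 8 * dist2 u w"
    unfolding 2 by (simp add: algebra_simps)
  with 1 show ?thesis by (simp add: field_simps)
qed

lemma f_boundary: "z \<in> \<Gamma> \<Longrightarrow> f z = 0"
proof -
  assume z: "z \<in> \<Gamma>"
  then have l: "approx_limit \<Omega> u z 0" using u_mem by (simp add: BV_L2_D_def)
  from z \<Gamma> consider "z = a" | "z = b" by blast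
  then show "f z = 0"
  proof cases
    case 1
    with l have "approx_right u a 0" by (simp add: approx_limit_left_end[OF ui ab])
    then show ?thesis using 1 approx_right_unique[OF ui ab approx_right_f] by simp
  next
    case 2
    with l have "approx_left u b 0" by (simp add: approx_limit_right_end[OF ui ab])
    then show ?thesis using 2 f_eqI_left[of b 0] ab by simp
  qed
qed

lemma endpoint_in_division:
  assumes D: "\<D> division_of {a..b}" and nd: "\<And>T. T \<in> \<D> \<Longrightarrow> Inf T < Sup T" and z: "z \<in> {a, b}"
  shows "interpolant \<D> h z = h z"
proof -
  have "z \<in> \<Union>\<D>" using division_ofD(6)[OF D] z ab by auto
  then obtain T where T: "T \<in> \<D>" "z \<in> T" by blast
  obtain p q where pq: "T = {p..q}" "p \<le> q" "Inf T = p" "Sup T = q" "a \<le> p" "q \<le> b"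
    using D T(1) by (rule division_of_Icc_elementE)
  have "z = Inf T \<or> z = Sup T" using pq T(2) z by auto
  then show ?thesis using interpolant_endpoints[OF D nd T(1)] by auto
qed

text \<open>The function \<open>h\<close> stands for \<open>f\<close> itself and for its truncation; both have increments bounded by
  those of \<open>f\<close>.\<close>
lemma interpolant_admissible:
  assumes D: "\<D> division_of {a..b}" and nd: "\<And>T. T \<in> \<D> \<Longrightarrow> Inf T < Sup T"
    and h: "\<And>x y. \<bar>h x - h y\<bar> \<le> \<bar>f x - f y\<bar>" "\<And>z. z \<in> \<Gamma> \<Longrightarrow> h z = 0"
  shows "interpolant \<D> h \<in> BV_L2_D \<Omega> \<Gamma>" and "total_variation \<Omega> (interpolant \<D> h) \<le> ereal V"
proof -
  let ?v = "interpolant \<D> h"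
  note aff = interpolant_affine[OF D nd]
  have "?v z = 0" if "z \<in> \<Gamma>" for z
    using endpoint_in_division[OF D nd] \<Gamma> h(2) that by (metis subsetD)
  then show "?v \<in> BV_L2_D \<Omega> \<Gamma>"
    using piecewise_affine_in_BV_L2_D[OF ab D \<Gamma> aff] by blast
  have "total_variation \<Omega> ?v \<le> ereal (\<Sum>T\<in>\<D>. \<bar>?v (Sup T) - ?v (Inf T)\<bar>)"
    using aff continuous_on_piecewise_affine[OF D aff] by (intro total_variation_piecewise_affine_le[OF ab _ D]) auto
  also have "\<dots> = ereal (\<Sum>T\<in>\<D>. \<bar>h (Sup T) - h (Inf T)\<bar>)"
    using interpolant_endpoints[OF D nd] by simp
  also have "\<dots> \<le> ereal (\<Sum>T\<in>\<D>. \<bar>f (Sup T) - f (Inf T)\<bar>)"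
    using h(1) by (simp add: sum_mono)
  also have "\<dots> \<le> ereal V" using variation_le[OF D] V by simp
  finally show "total_variation \<Omega> ?v \<le> ereal V" .
qed

text \<open>The nodes of the cell that contains \<open>x\<close> have distance at most \<open>d\<close> from \<open>x\<close>, so only
  the values of \<open>h\<close> that close to \<open>x\<close> enter. With \<open>c = 0\<close> this bounds the interpolant, with \<open>c = h x\<close> it gives its
  convergence at points of continuity.\<close>
lemma interpolant_bound:
  assumes D: "\<D> division_of {a..b}" and nd: "\<And>T. T \<in> \<D> \<Longrightarrow> Inf T < Sup T"
    and x: "x \<in> {a..b}" and h: "\<And>y. y \<in> {a..b} \<Longrightarrow> \<bar>h y - c\<bar> \<le> e \<or> \<bar>y - x\<bar> > d"
    and d: "\<And>T. T \<in> \<D> \<Longrightarrow> Sup T - Inf T \<le> d"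
  shows "\<bar>interpolant \<D> h x - c\<bar> \<le> e"
proof -
  have "x \<in> \<Union>\<D>" using division_ofD(6)[OF D] x by simp
  then obtain T where T: "T \<in> \<D>" "x \<in> T" by blast
  obtain p q where pq: "T = {p..q}" "p \<le> q" "Inf T = p" "Sup T = q" "a \<le> p" "q \<le> b"
    using D T(1) by (rule division_of_Icc_elementE)
  have "p < q" using nd[OF T(1)] pq by simp
  have "x \<in> {p..q}" using T(2) pq(1) by simp
  have "\<bar>h p - c\<bar> \<le> e" "\<bar>h q - c\<bar> \<le> e"
    using h[of p] h[of q] d[OF T(1)] pq \<open>x \<in> {p..q}\<close> by auto
  then show ?thesis
    using affine_through_dist[OF \<open>p < q\<close> \<open>x \<in> {p..q}\<close>] interpolant_eq[OF D nd T] pq(3,4) by simp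
qed

text \<open>Interpolants of the truncation on uniform grids do not exceed \<open>u\<close> in total variation, so the
  minimality of \<open>u\<close> becomes an inequality between fidelity terms, which passes to the limit by
  dominated convergence. This avoids estimating the total variation of the truncation itself.\<close>
lemma dist2_clip_le: "dist2 g u \<le> dist2 g (\<lambda>x. clip G (f x))"
proof -
  let ?h = "\<lambda>x. clip G (f x)"
  have "\<exists>\<D>. \<D> division_of {a..b} \<and> (\<forall>T\<in>\<D>. Inf T < Sup T \<and> Sup T - Inf T \<le> (b - a) / real (Suc n))" for n
    using uniform_division[OF ab, of "Suc n"] by (metis le_add1 plus_1_eq_Suc)
  then obtain \<D> where D: "\<And>n. \<D> n division_of {a..b}"
    and nd: "\<And>n T. T \<in> \<D> n \<Longrightarrow> Inf T < Sup T"
    and mesh: "\<And>n T. T \<in> \<D> n \<Longrightarrow> Sup T - Inf T \<le> (b - a) / real (Suc n)"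
    by metis
  define v where "v n = interpolant (\<D> n) ?h" for n
  have hb: "\<bar>?h y\<bar> \<le> G" for y using G_nonneg by (rule abs_clip)
  have hc: "\<bar>?h x - ?h y\<bar> \<le> \<bar>f x - f y\<bar>" for x y using G_nonneg by (rule clip_contract)
  have h0: "?h z = 0" if "z \<in> \<Gamma>" for z using f_boundary[OF that] G_nonneg clip_0 by simp
  have adm: "v n \<in> BV_L2_D \<Omega> \<Gamma>" "total_variation \<Omega> (v n) \<le> ereal V" for n
    unfolding v_def using interpolant_admissible[OF D[of n] nd[of _ n] hc h0] by auto
  have vb: "\<bar>v n x\<bar> \<le> G" if "x \<in> {a..b}" for n x
  proof -
    have "\<bar>v n x - 0\<bar> \<le> G"
      unfolding v_def using D[of n] nd[of _ n] that
    proof (rule interpolant_bound)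
      show "\<bar>?h y - 0\<bar> \<le> G \<or> \<bar>y - x\<bar> > (b - a) / real (Suc n)" for y using hb by simp
      show "Sup T - Inf T \<le> (b - a) / real (Suc n)" if "T \<in> \<D> n" for T using mesh[OF that] .
    qed
    then show ?thesis by simp
  qed
  have le: "dist2 g u \<le> dist2 g (v n)" for n
  proof -
    have "ereal (V + \<alpha> / 2 * dist2 g u) \<le> total_variation \<Omega> (v n) + ereal (\<alpha> / 2 * dist2 g (v n))"
      using u_min[OF adm(1)] V by (simp add: functional_eq)
    also have "\<dots> \<le> ereal V + ereal (\<alpha> / 2 * dist2 g (v n))"
      using adm(2) by (rule add_right_mono)
    finally show ?thesis using \<alpha> by simp
  qed
  have lim: "(\<lambda>n. v n x) \<longlonglongrightarrow> ?h x" if x: "x \<in> \<Omega> - jumps" for x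
  proof (rule LIMSEQ_I)
    fix e :: real assume e: "e > 0"
    from isCont_f[OF x] e obtain d where d: "d > 0" "\<forall>y. \<bar>y - x\<bar> < d \<longrightarrow> \<bar>f y - f x\<bar> < e / 2"
      unfolding continuous_at_eps_delta dist_real_def by (metis half_gt_zero)
    have "(\<lambda>n. (b - a) / real (Suc n)) \<longlonglongrightarrow> 0"
      using LIMSEQ_Suc[OF lim_const_over_n[of "b - a"]] by simp
    from order_tendstoD(2)[OF this d(1)] obtain n0 where n0: "\<forall>n\<ge>n0. (b - a) / real (Suc n) < d"
      by (auto simp: eventually_sequentially)
    have "norm (v n x - ?h x) < e" if "n \<ge> n0" for n
    proof -
      have "\<bar>?h y - ?h x\<bar> \<le> e / 2 \<or> \<bar>y - x\<bar> > (b - a) / real (Suc n)" for y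
        using d(2) n0 that hc[of y x] by (smt (verit))
      then have "\<bar>v n x - ?h x\<bar> \<le> e / 2"
        unfolding v_def using D[of n] nd[of _ n] x mesh[of _ n] by (intro interpolant_bound) auto
      then show ?thesis using e by simp
    qed
    then show "\<exists>n0. \<forall>n\<ge>n0. norm (v n x - ?h x) < e" by blast
  qed
  have hm: "?h \<in> borel_measurable (lebesgue_on \<Omega>)"
  proof -
    have "f absolutely_integrable_on \<Omega>"
      using f_integrable by (simp add: absolutely_integrable_on_Icc_iff_Ioo)
    then have "f \<in> borel_measurable (lebesgue_on \<Omega>)"
      by (rule absolutely_integrable_imp_borel_measurable) simp
    then show ?thesis unfolding clip_def by measurable
  qed
  have gm: "g \<in> borel_measurable (lebesgue_on \<Omega>)" using g by (simp add: Linf_def)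
  have vm: "v n \<in> borel_measurable (lebesgue_on \<Omega>)" for n
    using adm(1)[of n] by (simp add: BV_L2_D_def L2_def)
  interpret finite_measure "lebesgue_on \<Omega>" by (rule finite_measure_lebesgue_on) simp
  have "(\<lambda>n. dist2 g (v n)) \<longlonglongrightarrow> dist2 g ?h"
    unfolding dist2_def
  proof (rule integral_dominated_convergence[where w = "\<lambda>_. (2 * G)\<^sup>2"])
    show "(\<lambda>x. (g x - ?h x)\<^sup>2) \<in> borel_measurable (lebesgue_on \<Omega>)" using gm hm by measurable
    show "(\<lambda>x. (g x - v n x)\<^sup>2) \<in> borel_measurable (lebesgue_on \<Omega>)" for n using gm vm[of n] by measurable
    have "AE x in lebesgue_on \<Omega>. x \<notin> jumps"
      using finite_jumps by (auto simp: AE_lebesgue_on_iff_negligible negligible_finite intro: negligible_subset[of jumps])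
    then show "AE x in lebesgue_on \<Omega>. (\<lambda>n. (g x - v n x)\<^sup>2) \<longlonglongrightarrow> (g x - ?h x)\<^sup>2"
      using AE_space
    proof eventually_elim
      case (elim x)
      then show ?case by (intro tendsto_intros lim) simp
    qed
    show "AE x in lebesgue_on \<Omega>. norm ((g x - v n x)\<^sup>2) \<le> (2 * G)\<^sup>2" for n
      using g_bound AE_space
    proof eventually_elim
      case (elim x)
      then have "\<bar>g x - v n x\<bar> \<le> 2 * G" using vb[of x n] by auto
      then have "\<bar>g x - v n x\<bar>\<^sup>2 \<le> (2 * G)\<^sup>2" by (intro power_mono) auto
      then show ?case by simp
    qed
  qed auto
  then show ?thesis
    by (rule LIMSEQ_le_const) (use le in auto)
qed

text \<open>Since \<open>g\<close> is bounded by \<open>G\<close>, truncating \<open>u\<close> at level \<open>G\<close> decreases the squared \<open>L\<^sup>2\<close> distance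
  to \<open>g\<close> by at least the squared distance from \<open>u\<close> to its truncation; by the previous lemma it
  cannot decrease at all.\<close>
lemma u_bound: "AE x in lebesgue_on \<Omega>. \<bar>u x\<bar> \<le> G"
proof -
  let ?h = "\<lambda>x. clip G (u x)"
  have uf: "AE x in lebesgue_on \<Omega>. u x = f x"
    using f_AE by (auto simp: AE_lebesgue_on_iff_negligible intro: negligible_subset)
  have um: "u \<in> borel_measurable (lebesgue_on \<Omega>)" using u_L2 by (simp add: L2_def)
  then have hm: "?h \<in> borel_measurable (lebesgue_on \<Omega>)" unfolding clip_def by measurable
  have hL2: "?h \<in> L2 \<Omega>"
    using abs_clip[OF G_nonneg] by (intro bounded_in_L2[OF hm, of G]) auto
  have gm: "g \<in> borel_measurable (lebesgue_on \<Omega>)" using g by (simp add: Linf_def)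
  have fm: "f \<in> borel_measurable (lebesgue_on \<Omega>)"
    using f_integrable absolutely_integrable_imp_borel_measurable[where f = f and S = \<Omega>]
    by (simp add: absolutely_integrable_on_Icc_iff_Ioo)
  then have hfm: "(\<lambda>x. clip G (f x)) \<in> borel_measurable (lebesgue_on \<Omega>)" unfolding clip_def by measurable
  have "dist2 g (\<lambda>x. clip G (f x)) = dist2 g ?h"
    unfolding dist2_def
  proof (rule integral_cong_AE)
    show "AE x in lebesgue_on \<Omega>. (g x - clip G (f x))\<^sup>2 = (g x - ?h x)\<^sup>2"
      using uf by eventually_elim simp
  qed (use gm hm hfm in measurable)
  with dist2_clip_le have 1: "dist2 g u \<le> dist2 g ?h" by simp
  have i: "integrable (lebesgue_on \<Omega>) (\<lambda>x. (g x - ?h x)\<^sup>2)" "integrable (lebesgue_on \<Omega>) (\<lambda>x. (u x - ?h x)\<^sup>2)"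
    "integrable (lebesgue_on \<Omega>) (\<lambda>x. (g x - u x)\<^sup>2)"
    using L2_integrable L2_diff g_L2 u_L2 hL2 by blast+
  have "dist2 g ?h + dist2 u ?h = (LINT x|lebesgue_on \<Omega>. (g x - ?h x)\<^sup>2 + (u x - ?h x)\<^sup>2)"
    unfolding dist2_def using i by simp
  also have "\<dots> \<le> dist2 g u"
    unfolding dist2_def
  proof (rule integral_mono_AE)
    show "AE x in lebesgue_on \<Omega>. (g x - ?h x)\<^sup>2 + (u x - ?h x)\<^sup>2 \<le> (g x - u x)\<^sup>2"
      using g_bound by eventually_elim (rule clip_projection)
  qed (use i in auto)
  finally have "dist2 u ?h \<le> 0" using 1 by simp
  then have "(LINT x|lebesgue_on \<Omega>. (u x - ?h x)\<^sup>2) = 0"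
    unfolding dist2_def by (intro antisym) auto
  then have "AE x in lebesgue_on \<Omega>. (u x - ?h x)\<^sup>2 = 0"
    using integral_nonneg_eq_0_iff_AE[OF i(2)] by simp
  then show ?thesis
  proof eventually_elim
    case (elim x)
    then show ?case using abs_clip[OF G_nonneg, of "u x"] by simp
  qed
qed

lemma f_bound:
  assumes "x \<in> {a..b}"
  shows "\<bar>f x\<bar> \<le> G"
proof -
  let ?N = "{x \<in> \<Omega>. \<not> \<bar>u x\<bar> \<le> G} \<union> {a, b}"
  have N: "negligible ?N"
    using u_bound by (simp add: AE_lebesgue_on_iff_negligible)
  show ?thesis
  proof (cases "x = a")
    case True
    show ?thesis unfolding True
      by (rule averages_limit_bound[OF _ _ N _ approx_right_f[unfolded approx_right_def], where d = "b - a"])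
        (use ab in \<open>auto intro: integrable_sub\<close>)
  next
    case False
    with assms have x: "x \<in> {a<..b}" by simp
    show ?thesis
      by (rule averages_limit_bound[OF _ _ N _ approx_left_f[OF x, unfolded approx_left_def], where d = "x - a"])
        (use x in \<open>auto intro: integrable_sub\<close>)
  qed
qed

text \<open>The interpolant of \<open>f\<close> competes with \<open>u\<^sub>h\<close> and has at most the total variation of \<open>u\<close>, so only the
  fidelity terms remain. The factor 8 is \<open>4 / \<alpha> * (\<alpha> / 2)\<close>, from the convexity estimate, times the
  bound \<open>4 * G\<close> for \<open>\<bar>2 * g - u - v\<bar>\<close>.\<close>
lemma error_by_interpolation:
  assumes D: "\<D> division_of {a..b}" and nd: "\<And>T. T \<in> \<D> \<Longrightarrow> Inf T < Sup T"
    and uh: "is_arg_min (functional \<Omega> \<alpha> g) (\<lambda>v. v \<in> P1_D \<Omega> \<Gamma> \<D>) u\<^sub>h"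
  shows "(L2_norm \<Omega> (\<lambda>x. u x - u\<^sub>h x))\<^sup>2 \<le> 8 * G * integral {a..b} (\<lambda>x. \<bar>f x - interpolant \<D> f x\<bar>)"
proof -
  let ?v = "interpolant \<D> f"
  have uhP: "u\<^sub>h \<in> P1_D \<Omega> \<Gamma> \<D>" and uhm: "\<And>v. v \<in> P1_D \<Omega> \<Gamma> \<D> \<Longrightarrow> functional \<Omega> \<alpha> g u\<^sub>h \<le> functional \<Omega> \<alpha> g v"
    using uh by (auto simp: is_arg_min_def not_less)
  have uhB: "u\<^sub>h \<in> BV_L2_D \<Omega> \<Gamma>"
    using uhP by (intro piecewise_affine_in_BV_L2_D[OF ab D \<Gamma>]) (auto simp: P1_D_def)
  define W where "W = real_of_ereal (total_variation \<Omega> u\<^sub>h)"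
  have W: "total_variation \<Omega> u\<^sub>h = ereal W" using TV_real[OF uhB] by (simp add: W_def)
  have TVv: "total_variation \<Omega> ?v \<le> ereal V"
    using D nd f_boundary by (intro interpolant_admissible(2)) auto
  have vc: "continuous_on {a..b} ?v"
    by (rule continuous_on_piecewise_affine[OF D interpolant_affine[OF D nd]])
  have "?v \<in> P1_D \<Omega> \<Gamma> \<D>"
    using vc interpolant_affine[OF D nd] endpoint_in_division[OF D nd] f_boundary \<Gamma> ab
    by (auto simp: P1_D_def)
  from uhm[OF this] have "ereal (W + \<alpha> / 2 * dist2 g u\<^sub>h) \<le> total_variation \<Omega> ?v + ereal (\<alpha> / 2 * dist2 g ?v)"
    using W by (simp add: functional_eq)
  also have "\<dots> \<le> ereal V + ereal (\<alpha> / 2 * dist2 g ?v)"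
    using TVv by (rule add_right_mono)
  finally have "W + \<alpha> / 2 * dist2 g u\<^sub>h \<le> V + \<alpha> / 2 * dist2 g ?v" by simp
  with strong_convexity[OF uhB W] have "\<alpha> / 4 * dist2 u u\<^sub>h \<le> \<alpha> / 2 * (dist2 g ?v - dist2 g u)"
    by (simp add: right_diff_distrib)
  then have "\<alpha> * dist2 u u\<^sub>h \<le> \<alpha> * (2 * (dist2 g ?v - dist2 g u))" by (simp add: algebra_simps)
  then have 1: "dist2 u u\<^sub>h \<le> 2 * (dist2 g ?v - dist2 g u)" using \<alpha> by simp
  have vL2: "?v \<in> L2 \<Omega>" using vc by (rule continuous_in_L2)
  have vb: "\<bar>?v x\<bar> \<le> G" if "x \<in> {a..b}" for x
    using interpolant_bound[where c = 0 and e = G and d = "b - a" and h = f, OF D nd that] f_bound division_of_Icc_element(3,4)[OF D]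
    by (force simp: diff_mono)
  have i: "integrable (lebesgue_on \<Omega>) (\<lambda>x. (g x - ?v x)\<^sup>2)" "integrable (lebesgue_on \<Omega>) (\<lambda>x. (g x - u x)\<^sup>2)"
    using L2_integrable L2_diff g_L2 u_L2 vL2 by blast+
  have "?v absolutely_integrable_on {a..b}" using vc by (rule absolutely_integrable_continuous_real)
  then have uvi: "(\<lambda>x. \<bar>u x - ?v x\<bar>) absolutely_integrable_on \<Omega>"
    using ui by (auto simp: absolutely_integrable_on_Icc_iff_Ioo intro!: set_integrable_abs set_integral_diff)
  have "dist2 g ?v - dist2 g u = (LINT x|lebesgue_on \<Omega>. (g x - ?v x)\<^sup>2 - (g x - u x)\<^sup>2)"
    unfolding dist2_def using i by simp
  also have "\<dots> \<le> (LINT x|lebesgue_on \<Omega>. 4 * G * \<bar>u x - ?v x\<bar>)"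
  proof (rule integral_mono_AE)
    show "AE x in lebesgue_on \<Omega>. (g x - ?v x)\<^sup>2 - (g x - u x)\<^sup>2 \<le> 4 * G * \<bar>u x - ?v x\<bar>"
      using g_bound u_bound AE_space
    proof eventually_elim
      case (elim x)
      have "(g x - ?v x)\<^sup>2 - (g x - u x)\<^sup>2 = (2 * g x - u x - ?v x) * (u x - ?v x)"
        by (simp add: power2_eq_square algebra_simps)
      also have "\<dots> \<le> \<bar>2 * g x - u x - ?v x\<bar> * \<bar>u x - ?v x\<bar>"
        by (metis abs_ge_self abs_mult)
      also have "\<dots> \<le> 4 * G * \<bar>u x - ?v x\<bar>"
        using elim vb[of x] by (intro mult_right_mono) auto
      finally show ?case .
    qed
    show "integrable (lebesgue_on \<Omega>) (\<lambda>x. 4 * G * \<bar>u x - ?v x\<bar>)"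
      using uvi by (simp add: integrable_lebesgue_on_iff)
  qed (use i in auto)
  also have "\<dots> = 4 * G * integral \<Omega> (\<lambda>x. \<bar>u x - ?v x\<bar>)"
    using uvi by (simp add: LINT_lebesgue_on_eq_integral)
  also have "integral \<Omega> (\<lambda>x. \<bar>u x - ?v x\<bar>) = integral {a..b} (\<lambda>x. \<bar>u x - ?v x\<bar>)"
    by (simp add: integral_open_interval_real)
  also have "\<dots> = integral {a..b} (\<lambda>x. \<bar>f x - ?v x\<bar>)"
    by (rule integral_spike[OF f_AE]) auto
  finally show ?thesis using 1 by (simp add: L2_norm_squared dist2_def)
qed

end

theorem proposition4p3:
  fixes a b \<alpha> :: real and \<Omega> :: "real set" and \<M> :: "real set set"
  assumes "a < b" and "\<Omega> = {a<..<b}" and "\<alpha> > 0"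
    and "macro_partition \<Omega> \<M>"
  shows "\<exists>c>0. \<forall>(\<Gamma>\<^sub>D :: real set) (g :: real \<Rightarrow> real) (u :: real \<Rightarrow> real) (\<beta> :: real).
    \<Gamma>\<^sub>D \<subseteq> frontier \<Omega> \<longrightarrow> g \<in> Linf \<Omega> \<longrightarrow>
    is_arg_min (functional \<Omega> \<alpha> g) (\<lambda>v. v \<in> BV_L2_D \<Omega> \<Gamma>\<^sub>D) u \<longrightarrow>
    u \<in> piecewise_W21 \<Omega> \<longrightarrow> \<beta> \<ge> 1 \<longrightarrow>
    (\<forall>(J :: nat) (h :: real) (\<T> :: real set set) (u\<^sub>h :: real \<Rightarrow> real).
      J \<ge> 1 \<longrightarrow> h = 1 / real J \<longrightarrow>
      graded_triangulation \<M> (jump_set \<Omega> u) \<beta> J \<T> \<longrightarrow>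
      is_arg_min (functional \<Omega> \<alpha> g) (\<lambda>v. v \<in> P1_D \<Omega> \<Gamma>\<^sub>D \<T>) u\<^sub>h \<longrightarrow>
      (L2_norm \<Omega> (\<lambda>x. u x - u\<^sub>h x))\<^sup>2
        \<le> c * (h powr \<beta> * real_of_ereal (total_variation \<Omega> u)
               + \<beta>\<^sup>2 * h\<^sup>2 * L1_norm (\<Omega> - jump_set \<Omega> u)
                   (weak_deriv (\<Omega> - jump_set \<Omega> u) (weak_deriv (\<Omega> - jump_set \<Omega> u) u)))
            * Linf_norm \<Omega> g)"
proof -
  \<comment> \<open>Each macro interval has at most one cell with a jump at its left end; such a cell contributes
    at most \<open>h powr \<beta> * (b - a)\<close> times the total variation.\<close>
  define n where "n = card \<M>"
  define c where "c = 8 * (real n * (b - a) + (b - a)\<^sup>2)"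
  have "c > 0" using assms(1) by (auto simp: c_def intro!: add_nonneg_pos)
  moreover have "(L2_norm \<Omega> (\<lambda>x. u x - u\<^sub>h x))\<^sup>2
        \<le> c * (h powr \<beta> * real_of_ereal (total_variation \<Omega> u)
               + \<beta>\<^sup>2 * h\<^sup>2 * L1_norm (\<Omega> - jump_set \<Omega> u)
                   (weak_deriv (\<Omega> - jump_set \<Omega> u) (weak_deriv (\<Omega> - jump_set \<Omega> u) u)))
            * Linf_norm \<Omega> g"
    if \<Gamma>: "\<Gamma>\<^sub>D \<subseteq> frontier \<Omega>" and g: "g \<in> Linf \<Omega>"
      and u: "is_arg_min (functional \<Omega> \<alpha> g) (\<lambda>v. v \<in> BV_L2_D \<Omega> \<Gamma>\<^sub>D) u"
      and pw: "u \<in> piecewise_W21 \<Omega>" and \<beta>: "\<beta> \<ge> 1" and J: "J \<ge> 1" and h: "h = 1 / real J"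
      and T: "graded_triangulation \<M> (jump_set \<Omega> u) \<beta> J \<T>"
      and uh: "is_arg_min (functional \<Omega> \<alpha> g) (\<lambda>v. v \<in> P1_D \<Omega> \<Gamma>\<^sub>D \<T>) u\<^sub>h"
    for \<Gamma>\<^sub>D g u \<beta> J h \<T> u\<^sub>h
  proof -
    note \<Omega> = assms(2)
    have "u \<in> BV {a<..<b}" using u by (simp add: is_arg_min_def BV_L2_D_def \<Omega>)
    then have ui: "u absolutely_integrable_on {a..b}"
      by (simp add: BV_def integrable_lebesgue_on_iff absolutely_integrable_on_Icc_iff_Ioo)
    interpret piecewise_W21_minimizer a b u \<alpha> g \<Gamma>\<^sub>D
      using assms(1,3) \<Gamma> g u pw ui by unfold_locales (auto simp: \<Omega> frontier_def)
    have M: "macro_partition {a<..<b} \<M>" using assms(4) by (simp add: \<Omega>)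
    have T': "graded_triangulation \<M> (jump_set {a<..<b} u) \<beta> J \<T>" using T by (simp add: \<Omega>)
    note P = graded_triangulation_properties[OF assms(1) M T' \<beta> J]
    define w where "w = integral {a..b} (\<lambda>x. \<bar>second_deriv x\<bar>)"
    have w0: "w \<ge> 0"
      unfolding w_def using second_deriv_integrable
      by (intro integral_nonneg) (auto simp: absolutely_integrable_on_def)
    define \<mu> where "\<mu> = h powr \<beta> * (b - a)"
    define m where "m = \<beta> * h * (b - a)"
    have \<mu>m: "\<mu> \<ge> 0" "m \<ge> 0" using assms(1) \<beta> by (auto simp: \<mu>_def m_def h)
    have "integral {a..b} (\<lambda>x. \<bar>f x - interpolant \<T> f x\<bar>) \<le> real n * \<mu> * V + m\<^sup>2 * w"
      unfolding w_def n_def using P \<mu>m V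
      by (intro interpolation_L1_error) (auto simp: \<mu>_def m_def h)
    then have "8 * G * integral {a..b} (\<lambda>x. \<bar>f x - interpolant \<T> f x\<bar>) \<le> 8 * G * (real n * \<mu> * V + m\<^sup>2 * w)"
      using G_nonneg by (intro mult_left_mono) auto
    with error_by_interpolation[OF P(1,2), of u\<^sub>h] uh
    have est: "(L2_norm \<Omega> (\<lambda>x. u x - u\<^sub>h x))\<^sup>2 \<le> 8 * G * (real n * \<mu> * V + m\<^sup>2 * w)"
      by (simp add: \<Omega>)
    have "real n * \<mu> * V + m\<^sup>2 * w = (real n * (b - a)) * (h powr \<beta> * V) + (b - a)\<^sup>2 * (\<beta>\<^sup>2 * h\<^sup>2 * w)"
      by (simp add: \<mu>_def m_def power_mult_distrib)
    also have "\<dots> \<le> (c / 8) * (h powr \<beta> * V) + (c / 8) * (\<beta>\<^sup>2 * h\<^sup>2 * w)"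
      using assms(1) w0 V_nonneg by (intro add_mono mult_right_mono) (auto simp: c_def)
    finally have "8 * G * (real n * \<mu> * V + m\<^sup>2 * w)
        \<le> 8 * G * ((c / 8) * (h powr \<beta> * V) + (c / 8) * (\<beta>\<^sup>2 * h\<^sup>2 * w))"
      using G_nonneg by (intro mult_left_mono) auto
    also have "\<dots> = c * (h powr \<beta> * V + \<beta>\<^sup>2 * h\<^sup>2 * w) * G"
      by (simp add: algebra_simps)
    finally have "8 * G * (real n * \<mu> * V + m\<^sup>2 * w) \<le> c * (h powr \<beta> * V + \<beta>\<^sup>2 * h\<^sup>2 * w) * G" .
    with est show ?thesis
      by (simp add: \<Omega> V_def G_def w_def L1_norm_second_deriv)
  qed
  ultimately show ?thesis by blast
qed

end
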